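(* Up to conjugation (by a linear change of the homogeneous coordinates $z_0,z_1,z_2,z_3$), every $\mathscr{L}$-foliation (of codimension one) of degree $2$ on $\mathbf{C}\mathbf{P}(3)$ has one of the following first integrals: $$z_0^{\lambda_0}z_1^{\lambda_1}z_2^{\lambda_2}z_3^{\lambda_3}\ \text{ with } \sum_{i=0}^3\lambda_i=0,$$ $$\frac{z_1z_2+z_0z_3}{z_1z_3},\qquad \frac{z_1}{z_3}\exp\left(\frac{z_0z_3+z_2z_1}{z_1z_3}\right),\qquad \frac{z_0}{z_3}\exp\left(\frac{z_2^2-z_1z_3}{z_3^2}\right),$$ $$\frac{z_1z_3^{\kappa-1}}{z_0^{\kappa}}\exp\left(\frac{z_2}{z_3}\right),\qquad \frac{z_0z_3^2+z_1z_2z_3+z_2^3}{z_3^3},$$ $$\frac{\left(z_0z_3^2-z_1z_2z_3+\frac{z_2^3}{3}\right)^2}{\left(z_1z_3-\frac{z_2^2}{2}\right)^3}\ \text{ (the exceptional foliation)},$$ $$\frac{z_0^2z_3^{2(\kappa-1)}}{(z_1z_3-z_2^2)^{\kappa}},\qquad \frac{z_3^2}{z_1z_3-z_2^2}\exp\left(\frac{z_0}{z_3}\right),\qquad \frac{z_0}{z_3}\exp\left(\frac{z_2^2-z_1z_3}{z_0z_3}\right),$$ $$\frac{z_2}{z_3}\exp\left(\frac{z_0z_3-z_1z_2}{z_3^2}\right),\qquad \frac{(z_0z_3-z_1z_2)^{\kappa}}{z_2^{\kappa+1}z_3^{\kappa-1}},\qquad \frac{z_0z_3-z_1z_2}{z_3^2}\exp\left(-\frac{z_2}{z_3}\right),$$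 where $\kappa$ and the $\lambda_i$ are complex numbers.
   Context: A codimension one foliation $\mathscr{F}$ of degree $\nu$ on $\mathbf{C}\mathbf{P}(n)$ is given in homogeneous coordinates by a $1$-form $\omega=\sum_{k=0}^nA_kdz_k$ on $\mathbf{C}^{n+1}$, with $A_k$ homogeneous polynomials of degree $\nu+1$, $\omega\wedge d\omega=0$, $\sum z_kA_k=0$, and $\{A_0=\dots=A_n=0\}$ of codimension $\geq2$. Let $\chi(\mathbf{C}\mathbf{P}(n))$ be the Lie algebra of holomorphic vector fields on $\mathbf{C}\mathbf{P}(n)$. $\mathscr{F}$ is an $\mathscr{L}$-foliation if there is a Lie subalgebra $\mathscr{L}\subset\chi(\mathbf{C}\mathbf{P}(n))$ such that, for generic $z$, $\mathscr{L}(z)=\{X(z):X\in\mathscr{L}\}$ is the tangent space at $z$ to the leaf of $\mathscr{F}$ (so it has dimension $n-1$). A first integral is a non-constant (possibly multivalued) function constant on the leaves of $\mathscr{F}$. *)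

theory Defs
  imports "HOL-Analysis.Analysis"
begin

text \<open>Points of \<open>\<complex>P(n)\<close> are given by homogeneous coordinates \<open>z :: complex^'n\<close>, \<open>z \<noteq> 0\<close>, where
  \<open>CARD('n) = n + 1\<close>.\<close>

subsection \<open>Homogeneous polynomials and holomorphic functions of several variables\<close>

lemma finite_multidegrees: "finite {m :: 'n::finite \<Rightarrow> nat. (\<Sum>i\<in>UNIV. m i) = d}"
proof (rule finite_subset)
  show "{m :: 'n \<Rightarrow> nat. (\<Sum>i\<in>UNIV. m i) = d} \<subseteq> PiE UNIV (\<lambda>_. {..d})"
    by (auto simp: PiE_def intro: member_le_sum)
  show "finite (PiE (UNIV :: 'n set) (\<lambda>_. {..d}))"
    by (intro finite_PiE) auto
qed

definition hom_poly :: "nat \<Rightarrow> (complex^'n \<Rightarrow> complex) \<Rightarrow> bool" where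
  "hom_poly d p \<longleftrightarrow> (\<exists>c. \<forall>z. p z =
     (\<Sum>m | (\<Sum>i\<in>UNIV. m i) = d. c m * (\<Prod>i\<in>UNIV. z $ i ^ m i)))"

definition mholomorphic_on :: "(complex^'n \<Rightarrow> complex) \<Rightarrow> (complex^'n) set \<Rightarrow> bool"
    (infix "mholomorphic'_on" 50) where
  "f mholomorphic_on U \<longleftrightarrow>
     (\<forall>z\<in>U. \<exists>D. (f has_derivative D) (at z) \<and> (\<forall>c v. D (c *s v) = c * D v))"

subsection \<open>Codimension one foliations\<close>

text \<open>The form \<open>\<omega> = \<Sum>\<^sub>k A\<^sub>k dz\<^sub>k\<close> is represented by \<open>A = (A\<^sub>k)\<^sub>k\<close>;
  \<open>one_form A z v\<close> is \<open>\<omega>\<^sub>z(v)\<close> and \<open>d_form A z u v\<close> is \<open>(d\<omega>)\<^sub>z(u, v)\<close>.\<close>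

definition one_form :: "(complex^'n \<Rightarrow> complex^'n) \<Rightarrow> complex^'n \<Rightarrow> complex^'n \<Rightarrow> complex" where
  "one_form A z v = (\<Sum>k\<in>UNIV. A z $ k * v $ k)"

definition d_form ::
  "(complex^'n \<Rightarrow> complex^'n) \<Rightarrow> complex^'n \<Rightarrow> complex^'n \<Rightarrow> complex^'n \<Rightarrow> complex" where
  "d_form A z u v =
     (\<Sum>k\<in>UNIV. frechet_derivative A (at z) u $ k * v $ k)
     - (\<Sum>k\<in>UNIV. frechet_derivative A (at z) v $ k * u $ k)"

text \<open>\<open>\<omega> \<and> d\<omega> = 0\<close>, evaluated on triples of vectors\<close>

definition integrable_form :: "(complex^'n \<Rightarrow> complex^'n) \<Rightarrow> bool" where
  "integrable_form A \<longleftrightarrow> (\<forall>z u v w.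
     one_form A z u * d_form A z v w + one_form A z v * d_form A z w u
       + one_form A z w * d_form A z u v = 0)"

text \<open>A closed cone has codimension at least 2 iff it contains no hypersurface \<open>{P = 0}\<close>; for cones
  it is enough to consider homogeneous \<open>P\<close>.\<close>

definition codim_ge_2 :: "(complex^'n) set \<Rightarrow> bool" where
  "codim_ge_2 Z \<longleftrightarrow>
     \<not> (\<exists>d P. 1 \<le> d \<and> hom_poly d P \<and> (\<exists>z. P z \<noteq> 0) \<and> {z. P z = 0} \<subseteq> Z)"

definition codim_one_foliation :: "nat \<Rightarrow> (complex^'n \<Rightarrow> complex^'n) \<Rightarrow> bool" where
  "codim_one_foliation \<nu> A \<longleftrightarrow>
     (\<forall>k. hom_poly (\<nu> + 1) (\<lambda>z. A z $ k)) \<and>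
     integrable_form A \<and>
     (\<forall>z. (\<Sum>k\<in>UNIV. z $ k * A z $ k) = 0) \<and>
     codim_ge_2 {z. A z = 0}"

text \<open>The form \<open>g\<^sup>*\<omega>\<close> for the linear change of coordinates \<open>g\<close>:
  \<open>(g\<^sup>*\<omega>)\<^sub>z(v) = \<omega>\<^bsub>g z\<^esub>(g v)\<close>\<close>

definition pullback_form ::
  "complex^'n^'n \<Rightarrow> (complex^'n \<Rightarrow> complex^'n) \<Rightarrow> complex^'n \<Rightarrow> complex^'n" where
  "pullback_form g A z = transpose g *v A (g *v z)"

subsection \<open>Holomorphic vector fields on projective space\<close>

text \<open>A vector field \<open>X\<close> on \<open>\<complex>P(n)\<close> is given by its expressions in the affine charts
  \<open>{z\<^sub>k \<noteq> 0}\<close>, whose coordinates are \<open>w\<^sub>j = z\<^sub>j / z\<^sub>k\<close>, \<open>j \<noteq> k\<close>: the vector \<open>X k z\<close> has the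
  components \<open>X(z\<^sub>j / z\<^sub>k)\<close> at the point \<open>[z]\<close>. The \<open>k\<close>-th one is \<open>X(1) = 0\<close>. The last clause
  is the change of charts \<open>z\<^sub>j / z\<^sub>l = (z\<^sub>j / z\<^sub>k) / (z\<^sub>l / z\<^sub>k)\<close>. Off its chart, \<open>X k\<close> is set to 0,
  so that equality of vector fields is equality of functions.\<close>

type_synonym 'n vfield = "'n \<Rightarrow> complex^'n \<Rightarrow> complex^'n"

definition hol_vfields :: "('n::finite) vfield set" where
  "hol_vfields = {X.
     (\<forall>k z. z $ k = 0 \<longrightarrow> X k z = 0) \<and>
     (\<forall>k z. X k z $ k = 0) \<and>
     (\<forall>k c z. c \<noteq> 0 \<longrightarrow> X k (c *s z) = X k z) \<and>
     (\<forall>k j. (\<lambda>z. X k z $ j) mholomorphic_on {z. z $ k \<noteq> 0}) \<and>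
     (\<forall>k l j z. z $ k \<noteq> 0 \<longrightarrow> z $ l \<noteq> 0 \<longrightarrow>
        X l z $ j = (X k z $ j * (z $ l / z $ k) - (z $ j / z $ k) * X k z $ l)
                      / (z $ l / z $ k)\<^sup>2)}"

text \<open>In each chart, \<open>[X, Y] = DY(X) - DX(Y)\<close>, computed at the representative of \<open>[z]\<close>
  with \<open>k\<close>-th coordinate 1.\<close>

definition lie_bracket :: "('n::finite) vfield \<Rightarrow> 'n vfield \<Rightarrow> 'n vfield" where
  "lie_bracket X Y k z =
     (if z $ k = 0 then 0
      else frechet_derivative (Y k) (at ((1 / z $ k) *s z)) (X k z)
           - frechet_derivative (X k) (at ((1 / z $ k) *s z)) (Y k z))"

definition lie_subalgebra :: "('n::finite) vfield set \<Rightarrow> bool" where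
  "lie_subalgebra L \<longleftrightarrow>
     L \<subseteq> hol_vfields \<and>
     (\<lambda>k z. 0) \<in> L \<and>
     (\<forall>X\<in>L. \<forall>Y\<in>L. (\<lambda>k z. X k z + Y k z) \<in> L) \<and>
     (\<forall>c. \<forall>X\<in>L. (\<lambda>k z. c *s X k z) \<in> L) \<and>
     (\<forall>X\<in>L. \<forall>Y\<in>L. lie_bracket X Y \<in> L)"

subsection \<open>\<open>\<L>\<close>-foliations\<close>

text \<open>The tangent space at \<open>[z]\<close> to the leaf through \<open>[z]\<close>, in the chart \<open>{z\<^sub>k \<noteq> 0}\<close>. Since the
  \<open>A\<^sub>j\<close> are homogeneous of the same degree, \<open>A(z)\<close> and \<open>A(z / z\<^sub>k)\<close> are proportional.\<close>

definition leaf_tangent ::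
  "(complex^'n \<Rightarrow> complex^'n) \<Rightarrow> 'n \<Rightarrow> complex^'n \<Rightarrow> (complex^'n) set" where
  "leaf_tangent A k z = {v. v $ k = 0 \<and> one_form A z v = 0}"

definition generically :: "(complex^'n \<Rightarrow> bool) \<Rightarrow> bool" where
  "generically Q \<longleftrightarrow>
     (\<exists>d P. hom_poly d P \<and> (\<exists>z. P z \<noteq> 0) \<and> (\<forall>z. z \<noteq> 0 \<longrightarrow> P z \<noteq> 0 \<longrightarrow> Q z))"

definition L_foliation :: "(complex^'n \<Rightarrow> complex^'n) \<Rightarrow> bool" where
  "L_foliation A \<longleftrightarrow> (\<exists>L. lie_subalgebra L \<and>
     generically (\<lambda>z. A z \<noteq> 0 \<and>
       (\<forall>k. z $ k \<noteq> 0 \<longrightarrow> (\<lambda>X. X k z) ` L = leaf_tangent A k z)))"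

subsection \<open>Multivalued functions\<close>

text \<open>A multivalued function maps an open set \<open>V\<close> to the set of its single-valued branches
  over \<open>V\<close>; only the values on \<open>V\<close> of a branch are meaningful. A branch of \<open>p\<^sup>\<kappa>\<close> is
  \<open>exp (\<kappa> log p)\<close> for a branch of \<open>log p\<close>.\<close>

type_synonym 'n multifun = "(complex^'n) set \<Rightarrow> (complex^'n \<Rightarrow> complex) set"

definition mf_single :: "(complex^'n \<Rightarrow> complex) \<Rightarrow> 'n multifun" where
  "mf_single p V = {p}"

definition mf_power :: "(complex^'n \<Rightarrow> complex) \<Rightarrow> complex \<Rightarrow> 'n multifun" where
  "mf_power p \<kappa> V =
     {(\<lambda>z. exp (\<kappa> * l z)) | l. l mholomorphic_on V \<and> (\<forall>z\<in>V. exp (l z) = p z)}"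

definition mf_exp :: "'n multifun \<Rightarrow> ('n::finite) multifun" where
  "mf_exp F V = {(\<lambda>z. exp (f z)) | f. f \<in> F V}"

definition mf_times :: "'n multifun \<Rightarrow> 'n multifun \<Rightarrow> ('n::finite) multifun"
    (infixl "\<odot>" 70) where
  "(F \<odot> G) V = {(\<lambda>z. f z * g z) | f g. f \<in> F V \<and> g \<in> G V}"

definition mf_divide :: "'n multifun \<Rightarrow> 'n multifun \<Rightarrow> ('n::finite) multifun"
    (infixl "\<oslash>" 70) where
  "(F \<oslash> G) V =
     {(\<lambda>z. f z / g z) | f g. f \<in> F V \<and> g \<in> G V \<and> (\<forall>z\<in>V. g z \<noteq> 0)}"

subsection \<open>Leaves and first integrals\<close>

text \<open>The leaves (upstairs, in \<open>\<complex>\<^sup>n\<^sup>+\<^sup>1\<close>, off the singular set) of the foliation restricted to \<open>V\<close>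
  consist of the points joined by piecewise \<open>C\<^sup>1\<close> paths tangent to \<open>ker \<omega>\<close>. As
  \<open>\<Sum>\<^sub>k z\<^sub>k A\<^sub>k = 0\<close>, they contain the radial directions, so for a function on \<open>\<complex>P(n)\<close> it is
  the same to be constant on them or on the leaves in \<open>\<complex>P(n)\<close>.\<close>

definition leafwise_path ::
  "(complex^'n \<Rightarrow> complex^'n) \<Rightarrow> (complex^'n) set \<Rightarrow> (real \<Rightarrow> complex^'n) \<Rightarrow> bool" where
  "leafwise_path A V \<gamma> \<longleftrightarrow>
     path \<gamma> \<and> path_image \<gamma> \<subseteq> {z \<in> V. A z \<noteq> 0} \<and>
     (\<exists>S. finite S \<and> \<gamma> C1_differentiable_on ({0..1} - S) \<and>
        (\<forall>t\<in>{0..1} - S. one_form A (\<gamma> t) (vector_derivative \<gamma> (at t)) = 0))"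

definition leaf :: "(complex^'n \<Rightarrow> complex^'n) \<Rightarrow> (complex^'n) set \<Rightarrow> complex^'n \<Rightarrow> (complex^'n) set"
  where "leaf A V p = {pathfinish \<gamma> | \<gamma>. leafwise_path A V \<gamma> \<and> pathstart \<gamma> = p}"

definition first_integral :: "(complex^'n \<Rightarrow> complex^'n) \<Rightarrow> 'n multifun \<Rightarrow> bool" where
  "first_integral A F \<longleftrightarrow>
     (\<exists>V f. open V \<and> connected V \<and> f \<in> F V \<and> \<not> f constant_on V) \<and>
     (\<forall>V f p. open V \<longrightarrow> connected V \<longrightarrow> f \<in> F V \<longrightarrow> p \<in> V \<longrightarrow> A p \<noteq> 0 \<longrightarrow>
        f constant_on leaf A V p)"

end

theory Submission
  imports Defs "HOL-Complex_Analysis.Complex_Analysis" "HOL-Computational_Algebra.Polynomial_Factorial"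
    "HOL-Computational_Algebra.Field_as_Ring" "HOL-Computational_Algebra.Fundamental_Theorem_Algebra"
begin

text \<open>
  A holomorphic vector field on \<open>\<complex>P(3)\<close> is the projection of a linear vector field \<open>z \<mapsto> M z\<close> on
  \<open>\<complex>\<^sup>4\<close> (\<open>linear_lift\<close>, by Liouville's theorem on the lines of a chart). Two elements of the Lie algebra
  that span the tangent space of the leaf at one point therefore give matrices \<open>M\<close> and \<open>N\<close> with
  \<open>\<omega>(M z) = \<omega>(N z) = 0\<close>. The form \<open>det(z, M z, N z, \<cdot>)\<close> has cubic coefficients, like \<open>\<omega>\<close>, and both
  annihilate \<open>z\<close>, \<open>M z\<close>, \<open>N z\<close>, so they are proportional at every point. Since \<open>\<omega>\<close> vanishes on no hypersurface, the two forms agree up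
  to a constant (\<open>proportional_forms\<close>). Integrability makes \<open>[M, N] z\<close> tangent to the leaves too, and
  the same comparison shows that \<open>[M, N]\<close> is a combination of \<open>1\<close>, \<open>M\<close> and \<open>N\<close>
  (\<open>L_foliation_linear_pair\<close>). So the foliation is given by a pair of matrices which, after removal of
  the traces and a change of generators, either commutes or satisfies \<open>[M, N] = N\<close>.

  Of the codimension of the singular set only one consequence is used from there on: every hyperplane
  contains a \<open>z\<close> such that \<open>z\<close>, \<open>M z\<close>, \<open>N z\<close> are independent (\<open>nondeg\<close>).

  If \<open>[M, N] = N\<close>, then \<open>N\<close> is nilpotent of rank at least two, so its Jordan type is \<open>(4)\<close>, \<open>(3,1)\<close>
  or \<open>(2,2)\<close>. A Jordan basis of \<open>N\<close> can be chosen such that \<open>M\<close> is diagonal up to a resonant part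
  (\<open>affine_classification\<close>). Type \<open>(4)\<close> is the exceptional foliation.

  If \<open>M\<close> and \<open>N\<close> commute, a common left eigenvector provides an invariant hyperplane. Either some
  combination of \<open>M\<close> and \<open>N\<close> acts cyclically on it, and its square may be taken as the other generator there, or \<open>nondeg\<close>
  fails. This splits \<open>\<complex>\<^sup>4\<close> into blocks on which \<open>M\<close> and \<open>N\<close> are polynomials in one nilpotent matrix
  (\<open>abelian_classification\<close>). The exponents of the first integral solve two linear equations in three
  unknowns, one equation for \<open>M\<close> and one for \<open>N\<close>, so they exist (\<open>two_equations\<close>).

  In all cases the result is a system of coordinates in which one of thirteen explicit forms \<open>\<Theta>\<close>
  annihilates \<open>z\<close>, \<open>M z\<close> and \<open>N z\<close>, hence also the kernel of \<open>\<omega>\<close> (\<open>listed_form_tangential\<close>). Each \<open>\<Theta>\<close>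
  is a multiple of the differential of the branches of one of the listed functions, which are therefore constant
  on the leaves (\<open>first_integralI\<close>).
\<close>

(* the dollar sign denotes components of vectors only, as in the definitions *)
no_notation fps_nth (infixl "$" 75)

section \<open>Homogeneous polynomials\<close>

lemma hom_poly_zero: "hom_poly d (\<lambda>z::complex^'n. 0)"
  unfolding hom_poly_def by (rule exI[of _ "\<lambda>_. 0"]) simp

lemma hom_poly_add:
  assumes "hom_poly d p" "hom_poly d q" shows "hom_poly d (\<lambda>z::complex^'n. p z + q z)"
proof -
  obtain c c' where "\<forall>z. p z = (\<Sum>m | (\<Sum>i\<in>UNIV. m i) = d. c m * (\<Prod>i\<in>UNIV. z $ i ^ m i))"
    "\<forall>z. q z = (\<Sum>m | (\<Sum>i\<in>UNIV. m i) = d. c' m * (\<Prod>i\<in>UNIV. z $ i ^ m i))"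
    using assms unfolding hom_poly_def by blast
  then show ?thesis
    unfolding hom_poly_def
    by (intro exI[of _ "\<lambda>m. c m + c' m"]) (simp add: sum.distrib distrib_right)
qed

lemma hom_poly_cmult:
  assumes "hom_poly d p" shows "hom_poly d (\<lambda>z::complex^'n. a * p z)"
proof -
  obtain c where "\<forall>z. p z = (\<Sum>m | (\<Sum>i\<in>UNIV. m i) = d. c m * (\<Prod>i\<in>UNIV. z $ i ^ m i))"
    using assms unfolding hom_poly_def by blast
  then show ?thesis
    unfolding hom_poly_def
    by (intro exI[of _ "\<lambda>m. a * c m"]) (simp add: sum_distrib_left mult.assoc)
qed

lemma hom_poly_sum:
  "(\<And>x. x \<in> S \<Longrightarrow> hom_poly d (p x)) \<Longrightarrow> hom_poly d (\<lambda>z::complex^'n. \<Sum>x\<in>S. p x z)"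
  by (induction S rule: infinite_finite_induct) (auto intro: hom_poly_zero hom_poly_add)

lemma hom_poly_monomial: "hom_poly (\<Sum>i\<in>UNIV. m i) (\<lambda>z::complex^'n. \<Prod>i\<in>UNIV. z $ i ^ m i)"
  unfolding hom_poly_def
  by (rule exI[of _ "\<lambda>m'. if m' = m then 1 else 0"])
     (simp add: if_distrib[of "\<lambda>x. x * _"] finite_multidegrees cong: if_cong)

lemma hom_poly_mult:
  assumes "hom_poly d p" "hom_poly e q" shows "hom_poly (d + e) (\<lambda>z::complex^'n. p z * q z)"
proof -
  obtain c c' where c: "\<forall>z. p z = (\<Sum>m | (\<Sum>i\<in>UNIV. m i) = d. c m * (\<Prod>i\<in>UNIV. z $ i ^ m i))"
    "\<forall>z. q z = (\<Sum>m | (\<Sum>i\<in>UNIV. m i) = e. c' m * (\<Prod>i\<in>UNIV. z $ i ^ m i))"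
    using assms unfolding hom_poly_def by blast
  have eq: "(\<lambda>z. p z * q z) = (\<lambda>z. \<Sum>m | (\<Sum>i\<in>UNIV. m i) = d. \<Sum>m' | (\<Sum>i\<in>UNIV. m' i) = e.
      (c m * c' m') * (\<Prod>i\<in>UNIV. z $ i ^ (m i + m' i)))"
    unfolding c[rule_format] sum_product
    by (intro ext sum.cong refl) (simp add: power_add prod.distrib mult_ac)
  show ?thesis
    unfolding eq
  proof (intro hom_poly_sum hom_poly_cmult)
    fix m m' :: "'n \<Rightarrow> nat"
    assume "m \<in> {m. (\<Sum>i\<in>UNIV. m i) = d}" "m' \<in> {m. (\<Sum>i\<in>UNIV. m i) = e}"
    then show "hom_poly (d + e) (\<lambda>z. \<Prod>i\<in>UNIV. z $ i ^ (m i + m' i))"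
      using hom_poly_monomial[of "\<lambda>i. m i + m' i"] by (simp add: sum.distrib)
  qed
qed

lemma hom_poly_const: "hom_poly 0 (\<lambda>z::complex^'n. a)"
  using hom_poly_cmult[OF hom_poly_monomial[of "\<lambda>_. 0"], of a] by simp

lemma hom_poly_coord: "hom_poly 1 (\<lambda>z::complex^'n. z $ j)"
proof -
  have "(\<Prod>i\<in>UNIV. z $ i ^ (if i = j then 1 else 0)) = z $ j" for z :: "complex^'n"
    by (simp add: if_distrib[of "\<lambda>k. _ ^ k"] cong: if_cong)
  then show ?thesis
    using hom_poly_monomial[of "\<lambda>i. if i = j then 1 else 0"] by simp
qed

lemma hom_poly_linear: "hom_poly 1 (\<lambda>z::complex^'n. \<Sum>j\<in>UNIV. l j * z $ j)"
  by (intro hom_poly_sum hom_poly_cmult hom_poly_coord)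

lemma hom_poly_homogeneous:
  assumes "hom_poly d p" shows "p (t *s z) = t ^ d * p (z::complex^'n)"
proof -
  obtain c where c: "\<forall>z. p z = (\<Sum>m | (\<Sum>i\<in>UNIV. m i) = d. c m * (\<Prod>i\<in>UNIV. z $ i ^ m i))"
    using assms unfolding hom_poly_def by blast
  show ?thesis
    unfolding c[rule_format] sum_distrib_left
    by (intro sum.cong refl) (auto simp: power_mult_distrib prod.distrib power_sum mult_ac)
qed

lemma hom_poly_minus:
  "hom_poly d p \<Longrightarrow> hom_poly d q \<Longrightarrow> hom_poly d (\<lambda>z::complex^'n. p z - q z)"
  using hom_poly_add[of d p "\<lambda>z. -1 * q z"] hom_poly_cmult[of d q "-1"] by simp

section \<open>Polynomial functions as elements of a factorial ring\<close>

text \<open>Iterating univariate polynomials over a field yields a factorial ring, so that polynomial functions of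
  four variables have greatest common divisors.\<close>

type_synonym poly4 = "complex poly poly poly poly"

definition ev :: "poly4 \<Rightarrow> complex^4 \<Rightarrow> complex" where
  "ev p z = poly (poly (poly (poly p [:[:[:z$0:]:]:]) [:[:z$1:]:]) [:z$2:]) (z$3)"

lemma ev_simps [simp]:
  "ev 0 z = 0" "ev 1 z = 1" "ev (p + q) z = ev p z + ev q z" "ev (p * q) z = ev p z * ev q z"
  "ev (p - q) z = ev p z - ev q z"
  by (simp_all add: ev_def)

lemma ex_nonroot:
  fixes p :: "'a::idom poly"
  assumes "p \<noteq> 0" "inj f"
  shows "\<exists>c::complex. poly p (f c) \<noteq> 0"
proof (rule ccontr)
  assume "\<not> ?thesis"
  then have "range f \<subseteq> {x. poly p x = 0}" by auto
  then have "finite (range f)"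
    using poly_roots_finite[OF assms(1)] finite_subset by blast
  then show False
    using assms(2) finite_imageD infinite_UNIV_char_0 by blast
qed

definition vec4 :: "'a \<Rightarrow> 'a \<Rightarrow> 'a \<Rightarrow> 'a \<Rightarrow> 'a^4" where
  "vec4 a b c d = (\<chi> i. if i = 0 then a else if i = 1 then b else if i = 2 then c else d)"

lemma vec4_nth [simp]:
  "vec4 a b c d $ 0 = a" "vec4 a b c d $ 1 = b" "vec4 a b c d $ 2 = c" "vec4 a b c d $ 3 = d"
  by (simp_all add: vec4_def)

lemma four_eq_zero: "(4::4) = 0"
  by simp

lemma sum4: "sum f (UNIV::4 set) = f 0 + f 1 + f 2 + f 3"
  by (simp add: sum_4 four_eq_zero add_ac)

lemma all4: "(\<forall>i::4. P i) \<longleftrightarrow> P 0 \<and> P 1 \<and> P 2 \<and> P 3"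
  by (auto simp: forall_4 four_eq_zero)

lemma ev_eq_zeroD:
  assumes "\<And>z. ev p z = 0" shows "p = 0"
proof (rule ccontr)
  assume "p \<noteq> 0"
  then obtain z0 where "poly p [:[:[:z0:]:]:] \<noteq> 0"
    using ex_nonroot[of p "\<lambda>c. [:[:[:c:]:]:]"] by (auto simp: inj_def)
  then obtain z1 where "poly (poly p [:[:[:z0:]:]:]) [:[:z1:]:] \<noteq> 0"
    using ex_nonroot[of _ "\<lambda>c. [:[:c:]:]"] by (auto simp: inj_def)
  then obtain z2 where "poly (poly (poly p [:[:[:z0:]:]:]) [:[:z1:]:]) [:z2:] \<noteq> 0"
    using ex_nonroot[of _ "\<lambda>c. [:c:]"] by (auto simp: inj_def)
  then obtain z3 where "poly (poly (poly (poly p [:[:[:z0:]:]:]) [:[:z1:]:]) [:z2:]) z3 \<noteq> 0"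
    using ex_nonroot[of _ "\<lambda>c. c"] by (auto simp: inj_def)
  then have "ev p (vec4 z0 z1 z2 z3) \<noteq> 0" by (simp add: ev_def)
  then show False using assms by blast
qed

lemma ev_inject: "(\<And>z. ev p z = ev q z) \<Longrightarrow> p = q"
  using ev_eq_zeroD[of "p - q"] by simp

definition polyfun :: "(complex^4 \<Rightarrow> complex) \<Rightarrow> bool" where
  "polyfun f \<longleftrightarrow> (\<exists>p. \<forall>z. f z = ev p z)"

lemma polyfun_add: "polyfun f \<Longrightarrow> polyfun g \<Longrightarrow> polyfun (\<lambda>z. f z + g z)"
  unfolding polyfun_def using ev_simps(3) by metis

lemma polyfun_mult: "polyfun f \<Longrightarrow> polyfun g \<Longrightarrow> polyfun (\<lambda>z. f z * g z)"
  unfolding polyfun_def using ev_simps(4) by metis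

lemma polyfun_const: "polyfun (\<lambda>z. c)"
  unfolding polyfun_def by (rule exI[of _ "[:[:[:[:c:]:]:]:]"]) (simp add: ev_def)

lemma polyfun_coord: "polyfun (\<lambda>z. z $ i)"
proof -
  have "polyfun (\<lambda>z. z $ 0)" unfolding polyfun_def
    by (rule exI[of _ "[:0, 1:]"]) (simp add: ev_def)
  moreover have "polyfun (\<lambda>z. z $ 1)" unfolding polyfun_def
    by (rule exI[of _ "[:[:0, 1:]:]"]) (simp add: ev_def)
  moreover have "polyfun (\<lambda>z. z $ 2)" unfolding polyfun_def
    by (rule exI[of _ "[:[:[:0, 1:]:]:]"]) (simp add: ev_def)
  moreover have "polyfun (\<lambda>z. z $ 3)" unfolding polyfun_def
    by (rule exI[of _ "[:[:[:[:0, 1:]:]:]:]"]) (simp add: ev_def)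
  ultimately show ?thesis using all4[of "\<lambda>i. polyfun (\<lambda>z. z $ i)"] by blast
qed

lemma polyfun_sum: "(\<And>x. x \<in> S \<Longrightarrow> polyfun (f x)) \<Longrightarrow> polyfun (\<lambda>z. \<Sum>x\<in>S. f x z)"
  by (induction S rule: infinite_finite_induct) (auto intro: polyfun_add polyfun_const)

lemma polyfun_power: "polyfun f \<Longrightarrow> polyfun (\<lambda>z. f z ^ k)"
  by (induction k) (auto intro: polyfun_mult polyfun_const)

lemma polyfun_prod: "(\<And>x. x \<in> S \<Longrightarrow> polyfun (f x)) \<Longrightarrow> polyfun (\<lambda>z. \<Prod>x\<in>S. f x z)"
  by (induction S rule: infinite_finite_induct) (auto intro: polyfun_mult polyfun_const)

lemma hom_poly_imp_polyfun: assumes "hom_poly d f" shows "polyfun f"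
proof -
  obtain c where c: "\<forall>z. f z = (\<Sum>m | (\<Sum>i\<in>UNIV. m i) = d. c m * (\<Prod>i\<in>UNIV. z $ i ^ m i))"
    using assms unfolding hom_poly_def by blast
  have "f = (\<lambda>z. \<Sum>m | (\<Sum>i\<in>UNIV. m i) = d. c m * (\<Prod>i\<in>UNIV. z $ i ^ m i))"
    using c by auto
  then show ?thesis
    by (auto intro!: polyfun_sum polyfun_mult polyfun_prod polyfun_power polyfun_const polyfun_coord)
qed

lemma polyfun_mult_eq_zero:
  assumes "polyfun f" "polyfun g" "\<And>z. f z * g z = 0"
  shows "(\<forall>z. f z = 0) \<or> (\<forall>z. g z = 0)"
proof -
  obtain p q where pq: "\<forall>z. f z = ev p z" "\<forall>z. g z = ev q z"
    using assms unfolding polyfun_def by blast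
  then have "p * q = 0" using assms(3) by (intro ev_eq_zeroD) simp
  then have "p = 0 \<or> q = 0" by simp
  then show ?thesis using pq by (auto simp: ev_simps)
qed

text \<open>Divisors found in the factorial ring carry no grading. Homogeneous components are recovered on the
  level of functions.\<close>

definition graded :: "(complex^4 \<Rightarrow> complex) \<Rightarrow> bool" where
  "graded f \<longleftrightarrow> (\<exists>N h. (\<forall>d. hom_poly d (h d)) \<and> (\<forall>z. f z = (\<Sum>d\<le>N. h d z)))"

lemma graded_hom: assumes "hom_poly d f" shows "graded f"
  unfolding graded_def
  by (rule exI[of _ d], rule exI[of _ "\<lambda>e. if e = d then f else (\<lambda>_. 0)"])
     (auto simp: assms hom_poly_zero if_distrib[of "\<lambda>h. h _"] cong: if_cong)

lemma graded_zero: "graded (\<lambda>z. 0)"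
  by (rule graded_hom[OF hom_poly_zero])

lemma graded_add: assumes "graded f" "graded g" shows "graded (\<lambda>z. f z + g z)"
proof -
  obtain N h N' h' where h: "\<forall>d. hom_poly d (h d)" "\<forall>z. f z = (\<Sum>d\<le>N. h d z)"
    "\<forall>d. hom_poly d (h' d)" "\<forall>z. g z = (\<Sum>d\<le>N'. h' d z)"
    using assms unfolding graded_def by blast
  define k where "k = (\<lambda>d z. (if d \<le> N then h d z else 0) + (if d \<le> N' then h' d z else 0))"
  have "hom_poly d (k d)" for d
    unfolding k_def
    by (cases "d \<le> N"; cases "d \<le> N'") (auto simp: h hom_poly_zero hom_poly_add)
  moreover have "f z + g z = (\<Sum>d\<le>max N N'. k d z)" for z
  proof -
    have "(\<Sum>d\<le>N. h d z) = (\<Sum>d\<le>max N N'. if d \<le> N then h d z else 0)"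
      by (rule sum.mono_neutral_cong_left) auto
    moreover have "(\<Sum>d\<le>N'. h' d z) = (\<Sum>d\<le>max N N'. if d \<le> N' then h' d z else 0)"
      by (rule sum.mono_neutral_cong_left) auto
    ultimately show ?thesis by (simp add: h k_def sum.distrib)
  qed
  ultimately show ?thesis unfolding graded_def by blast
qed

lemma graded_sum: "(\<And>x. x \<in> S \<Longrightarrow> graded (f x)) \<Longrightarrow> graded (\<lambda>z. \<Sum>x\<in>S. f x z)"
  by (induction S rule: infinite_finite_induct)
     (auto intro: graded_add graded_zero)

lemma graded_mult: assumes "graded f" "graded g" shows "graded (\<lambda>z. f z * g z)"
proof -
  obtain N h N' h' where h: "\<forall>d. hom_poly d (h d)" "\<forall>z. f z = (\<Sum>d\<le>N. h d z)"
    "\<forall>d. hom_poly d (h' d)" "\<forall>z. g z = (\<Sum>d\<le>N'. h' d z)"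
    using assms unfolding graded_def by blast
  have "graded (\<lambda>z. h d z * h' e z)" for d e
    using hom_poly_mult[of d "h d" e "h' e"] h graded_hom by blast
  then have "graded (\<lambda>z. \<Sum>d\<le>N. \<Sum>e\<le>N'. h d z * h' e z)" by (intro graded_sum)
  then show ?thesis by (simp add: h sum_product)
qed

lemma graded_poly:
  assumes "\<And>c. graded (\<lambda>z. poly_eval c z)" "graded x"
    "\<And>z. poly_eval 0 z = 0" "\<And>a b z. poly_eval (a + b) z = poly_eval a z + poly_eval b z"
    "\<And>a b z. poly_eval (a * b) z = poly_eval a z * poly_eval b z"
    "\<And>z. poly_eval (y z) z = x z"
  shows "graded (\<lambda>z. poly_eval (poly p (y z)) z)"
  by (induction p) (auto simp: assms intro!: graded_add graded_mult graded_zero)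

lemma graded_coord: "graded (\<lambda>z. z $ i)"
  by (rule graded_hom[OF hom_poly_coord])

lemma graded_ev: "graded (ev p)"
proof -
  have 1: "graded (\<lambda>z. poly a (z$3))" for a :: "complex poly"
    by (induction a)
       (auto intro!: graded_add graded_mult graded_coord graded_zero graded_hom[OF hom_poly_const])
  have 2: "graded (\<lambda>z. poly (poly a [:z$2:]) (z$3))" for a :: "complex poly poly"
    by (rule graded_poly[of "\<lambda>a z. poly a (z$3)" "\<lambda>z. z$2"]) (auto intro: 1 graded_coord)
  have 3: "graded (\<lambda>z. poly (poly (poly a [:[:z$1:]:]) [:z$2:]) (z$3))" for a
    by (rule graded_poly[of "\<lambda>a z. poly (poly a [:z$2:]) (z$3)" "\<lambda>z. z$1"])
       (auto intro: 2 graded_coord)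
  have "graded (\<lambda>z. poly (poly (poly (poly p [:[:[:z$0:]:]:]) [:[:z$1:]:]) [:z$2:]) (z$3))"
    by (rule graded_poly[of "\<lambda>a z. poly (poly (poly a [:[:z$1:]:]) [:z$2:]) (z$3)" "\<lambda>z. z$0"])
       (auto intro: 3 graded_coord)
  then show ?thesis by (simp add: ev_def[abs_def])
qed

text \<open>On a line through the origin a divisor of a homogeneous polynomial divides a multiple of
  \<open>t\<^sup>n\<close>, so it is itself a multiple of a power of \<open>t\<close>. Therefore only one of its homogeneous
  components survives on each line.\<close>

lemma dvd_power_X:
  fixes g q :: "complex poly"
  assumes "g * q = smult c ([:0,1:] ^ n)" "c \<noteq> 0"
  shows "\<exists>a k. g = smult a ([:0,1:] ^ k)"
  using assms
proof (induction n arbitrary: g q)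
  case 0
  then have "g dvd [:c:]" by (metis dvd_triv_left power_0 one_pCons smult_pCons mult.right_neutral smult_0_right)
  then have "degree g \<le> degree [:c:]" using 0 by (intro dvd_imp_degree_le) auto
  then obtain a where "g = [:a:]" by (metis degree_eq_zeroE degree_pCons_0 le_zero_eq)
  then show ?case by (intro exI[of _ a] exI[of _ 0]) simp
next
  case (Suc n)
  have "poly (g * q) 0 = 0" using Suc.prems by simp
  then consider "poly g 0 = 0" | "poly q 0 = 0" by auto
  then show ?case
  proof cases
    case 1
    then obtain g' where g': "g = [:0,1:] * g'" by (auto simp: poly_eq_0_iff_dvd)
    have "[:0,1:] * (g' * q) = [:0,1:] * smult c ([:0,1:] ^ n)"
      using Suc.prems(1) g' by (simp only: mult.assoc power_Suc mult_smult_right)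
    then have "g' * q = smult c ([:0,1:] ^ n)"
      by (metis mult_cancel_left pCons_eq_0_iff one_neq_zero)
    then obtain a k where "g' = smult a ([:0,1:] ^ k)" using Suc by blast
    then have "g = smult a ([:0,1:] ^ Suc k)" using g' by (simp only: power_Suc mult_smult_right)
    then show ?thesis by blast
  next
    case 2
    then obtain q' where q': "q = [:0,1:] * q'" by (auto simp: poly_eq_0_iff_dvd)
    have "[:0,1:] * (g * q') = [:0,1:] * smult c ([:0,1:] ^ n)"
      using Suc.prems(1) q' by (simp only: mult.left_commute power_Suc mult_smult_right)
    then have "g * q' = smult c ([:0,1:] ^ n)"
      by (metis mult_cancel_left pCons_eq_0_iff one_neq_zero)
    then show ?thesis using Suc by blast
  qed
qed

lemma graded_on_line:
  assumes "\<forall>d. hom_poly d (h d)" "\<forall>z. f z = (\<Sum>d\<le>N. h d z)"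
  shows "f (t *s z) = poly (\<Sum>d\<le>N. monom (h d z) d) t"
  unfolding assms(2)[rule_format] poly_sum poly_monom
  by (intro sum.cong refl) (simp add: hom_poly_homogeneous[OF assms(1)[rule_format]] mult.commute)

text \<open>By \<open>dvd_power_X\<close> at most one component of \<open>f\<close> is nonzero at a point where \<open>a\<close> does not vanish. So the product
  of two components and \<open>a\<close> vanishes identically, and the polynomial functions have no zero divisors.\<close>

lemma divisor_homogeneous:
  assumes f: "polyfun f" and g: "polyfun g" and a: "hom_poly n a"
    and eq: "\<And>z. f z * g z = a z" and nz: "\<exists>z. a z \<noteq> 0"
  shows "\<exists>e. hom_poly e f"
proof -
  have gr: "graded f" "graded g"
    using f g graded_ev unfolding polyfun_def by (metis ext)+
  obtain N h N' k where h: "\<forall>d. hom_poly d (h d)" "\<forall>z. f z = (\<Sum>d\<le>N. h d z)"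
    and k: "\<forall>d. hom_poly d (k d)" "\<forall>z. g z = (\<Sum>d\<le>N'. k d z)"
    using gr unfolding graded_def by metis
  have one: "h d z = 0 \<or> h e z = 0" if "d \<le> N" "e \<le> N" "d \<noteq> e" "a z \<noteq> 0" for d e z
  proof -
    have "(\<Sum>d\<le>N. monom (h d z) d) * (\<Sum>d\<le>N'. monom (k d z) d) = smult (a z) ([:0,1:] ^ n)"
      by (rule poly_ext)
         (simp add: graded_on_line[OF h, symmetric] graded_on_line[OF k, symmetric] eq
           hom_poly_homogeneous[OF a])
    then obtain b m where "(\<Sum>d\<le>N. monom (h d z) d) = smult b ([:0,1:] ^ m)"
      using dvd_power_X \<open>a z \<noteq> 0\<close> by blast
    then have *: "(\<Sum>d\<le>N. monom (h d z) d) = monom b m"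
      by (simp add: monom_altdef)
    have "coeff (\<Sum>d\<le>N. monom (h d z) d) i = h i z" if "i \<le> N" for i
      using that by (simp add: coeff_sum)
    then have "coeff (monom b m) d = h d z" "coeff (monom b m) e = h e z"
      using * that by metis+
    then show ?thesis using that(3) by (auto split: if_splits)
  qed
  obtain z0 where z0: "a z0 \<noteq> 0" using nz by blast
  then have "f z0 \<noteq> 0" using eq[of z0] by auto
  then obtain e where e: "e \<le> N" "h e z0 \<noteq> 0"
    using h(2) by (metis atMost_iff sum.neutral)
  have "h d z = 0" if d: "d \<le> N" "d \<noteq> e" for d z
  proof -
    have pf: "polyfun (h d)" "polyfun (h e)" "polyfun a"
      using h(1) a hom_poly_imp_polyfun by blast+
    have "(\<forall>z. h d z = 0) \<or> (\<forall>z. h e z * a z = 0)"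
      by (rule polyfun_mult_eq_zero) (use pf one[OF d(1) e(1) d(2)] in \<open>auto intro: polyfun_mult\<close>)
    then show ?thesis using e z0 by auto
  qed
  then have "f z = h e z" for z
    unfolding h(2)[rule_format] using e(1) by (subst sum.remove[of _ e]) auto
  then have "f = h e" by auto
  then show ?thesis using h(1) by metis
qed

lemma dvd_mult_gcdI:
  fixes k c a b :: "'a :: semiring_gcd"
  assumes "k dvd c * a" "k dvd c * b" shows "k dvd c * gcd a b"
  using assms
  by (metis dvd_normalize_iff gcd_greatest gcd_mult_left)

text \<open>The greatest common divisor \<open>G\<close> of the \<open>A\<^sub>i\<close> is homogeneous, and \<open>{G = 0}\<close> is contained in
  \<open>{A = 0}\<close>. By the assumption on the codimension \<open>G\<close> is a constant. As \<open>A\<^sub>i\<close> divides \<open>B\<^sub>i A\<^sub>j\<close> for all \<open>j\<close>, it divides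
  \<open>B\<^sub>i\<close>. The quotient has degree 0.\<close>

lemma proportional_forms:
  fixes A B :: "complex^4 \<Rightarrow> complex^4"
  assumes homA: "\<And>k. hom_poly n (\<lambda>z. A z $ k)" and homB: "\<And>k. hom_poly n (\<lambda>z. B z $ k)"
    and codim: "codim_ge_2 {z. A z = 0}" and nz: "\<exists>z. A z \<noteq> 0"
    and prp: "\<And>z i j. A z $ i * B z $ j = A z $ j * B z $ i"
  shows "\<exists>c. \<forall>z. B z = c *s A z"
proof -
  have "\<forall>k. \<exists>p. \<forall>z. A z $ k = ev p z" "\<forall>k. \<exists>p. \<forall>z. B z $ k = ev p z"
    using homA homB hom_poly_imp_polyfun unfolding polyfun_def by blast+
  then obtain a b where a: "\<And>k z. A z $ k = ev (a k) z" and b: "\<And>k z. B z $ k = ev (b k) z"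
    by metis
  have ab: "a i * b j = a j * b i" for i j
    by (rule ev_inject) (simp add: prp flip: a b)
  define G where "G = gcd (gcd (a 0) (a 1)) (gcd (a 2) (a 3))"
  have Gd: "G dvd a i" for i
  proof -
    have "G dvd a 0" "G dvd a 1" "G dvd a 2" "G dvd a 3"
      unfolding G_def by (meson dvd_trans gcd_dvd1 gcd_dvd2)+
    then show ?thesis using all4[of "\<lambda>i. G dvd a i"] by blast
  qed
  obtain i where i: "a i \<noteq> 0"
    using nz a by (metis ev_simps(1) vec_eq_iff zero_index)
  obtain q where q: "a i = G * q" using Gd by blast
  have "\<exists>e. hom_poly e (ev G)"
  proof (rule divisor_homogeneous[where g = "ev q" and n = n and a = "ev (a i)"])
    show "polyfun (ev G)" "polyfun (ev q)" unfolding polyfun_def by blast+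
    have "ev (a i) = (\<lambda>z. A z $ i)" using a by auto
    then show "hom_poly n (ev (a i))" using homA by simp
    show "\<exists>z. ev (a i) z \<noteq> 0" using i ev_eq_zeroD by blast
  qed (simp add: q)
  then obtain e where e: "hom_poly e (ev G)" by blast
  have "G \<noteq> 0" using i q by auto
  then have Gnz: "\<exists>z. ev G z \<noteq> 0" using ev_eq_zeroD by blast
  have "{z. ev G z = 0} \<subseteq> {z. A z = 0}"
    using Gd by (auto simp: vec_eq_iff a dvd_def) (metis Gd dvdE ev_simps(4) mult_zero_left)
  then have "e = 0" using codim e Gnz unfolding codim_ge_2_def by (metis less_one not_le)
  then have const: "ev G z = ev G 0" for z
    using hom_poly_homogeneous[OF e, of 0 z] by simp
  then have "G = [:[:[:[:ev G 0:]:]:]:]" by (intro ev_inject) (simp add: ev_def)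
  then have "G * [:[:[:[:1 / ev G 0:]:]:]:] = 1"
    using Gnz const by (intro ev_inject) (simp add: ev_def)
  then have unit: "G dvd 1" by (metis dvd_triv_left)
  have "a i dvd b i * a j" for j
    using ab[of i j] by (metis dvd_triv_left mult.commute)
  then have "a i dvd b i * G" unfolding G_def by (intro dvd_mult_gcdI)
  then have "a i dvd b i" using unit by (simp add: dvd_mult_unit_iff)
  then obtain h where h: "b i = a i * h" by blast
  have bh: "b j = a j * h" for j
  proof -
    have "a i * b j = a i * (a j * h)" using ab[of i j] h by (simp add: mult_ac)
    then show ?thesis using i by simp
  qed
  have "B z = ev h 0 *s A z" for z
  proof (cases "A z = 0")
    case True
    then show ?thesis by (simp add: vec_eq_iff b bh) (simp flip: a)
  next
    case False
    then obtain k where k: "A z $ k \<noteq> 0" by (auto simp: vec_eq_iff)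
    have gr: "graded (ev h)" by (rule graded_ev)
    then obtain N c where c: "\<forall>d. hom_poly d (c d)" "\<forall>z. ev h z = (\<Sum>d\<le>N. c d z)"
      unfolding graded_def by blast
    have "ev h (t *s z) = ev h z" if "t \<noteq> 0" for t
    proof -
      have "A (t *s z) $ k * ev h (t *s z) = B (t *s z) $ k" by (simp add: a b bh)
      also have "\<dots> = t ^ n * (A z $ k * ev h z)"
        using hom_poly_homogeneous[OF homB, of t z k] by (simp add: a b bh)
      finally show ?thesis using hom_poly_homogeneous[OF homA, of t z k] k that by simp
    qed
    then have "poly ((\<Sum>d\<le>N. monom (c d z) d) - [:ev h z:]) t = 0" if "t \<noteq> 0" for t
      using graded_on_line[OF c, of t z] that by simp
    then have "- {0} \<subseteq> {t. poly ((\<Sum>d\<le>N. monom (c d z) d) - [:ev h z:]) t = 0}" by auto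
    moreover have "infinite (- {0::complex})"
      using infinite_UNIV_char_0[where 'a = complex] by (metis Compl_eq_Diff_UNIV finite.emptyI
          finite_insert infinite_remove)
    ultimately have "(\<Sum>d\<le>N. monom (c d z) d) - [:ev h z:] = 0"
      using poly_roots_finite infinite_super by blast
    then have "ev h (0 *s z) = ev h z"
      using graded_on_line[OF c, of 0 z] by simp
    then have "ev h 0 = ev h z" by simp
    then show ?thesis by (simp add: vec_eq_iff b bh a)
  qed
  then show ?thesis by blast
qed

section \<open>The form that annihilates three vectors\<close>

text \<open>The linear form \<open>det(u, v, w, \<cdot>)\<close>, where the vectors are rows, in coordinates.\<close>

definition cross4 :: "complex^4 \<Rightarrow> complex^4 \<Rightarrow> complex^4 \<Rightarrow> complex^4" where
  "cross4 u v w = vec4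
     (- (u$1 * (v$2 * w$3 - v$3 * w$2) - u$2 * (v$1 * w$3 - v$3 * w$1) + u$3 * (v$1 * w$2 - v$2 * w$1)))
     (u$0 * (v$2 * w$3 - v$3 * w$2) - u$2 * (v$0 * w$3 - v$3 * w$0) + u$3 * (v$0 * w$2 - v$2 * w$0))
     (- (u$0 * (v$1 * w$3 - v$3 * w$1) - u$1 * (v$0 * w$3 - v$3 * w$0) + u$3 * (v$0 * w$1 - v$1 * w$0)))
     (u$0 * (v$1 * w$2 - v$2 * w$1) - u$1 * (v$0 * w$2 - v$2 * w$0) + u$2 * (v$0 * w$1 - v$1 * w$0))"

definition dot :: "complex^4 \<Rightarrow> complex^4 \<Rightarrow> complex" where
  "dot a v = (\<Sum>k\<in>UNIV. a $ k * v $ k)"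

lemma one_form_dot: "one_form A z v = dot (A z) v"
  by (simp add: one_form_def dot_def)

lemma dot4: "dot a v = a$0 * v$0 + a$1 * v$1 + a$2 * v$2 + a$3 * v$3"
  by (simp add: dot_def sum4)

lemma vec4_eq_iff: "(u::'a^4) = v \<longleftrightarrow> u$0 = v$0 \<and> u$1 = v$1 \<and> u$2 = v$2 \<and> u$3 = v$3"
  by (simp add: vec_eq_iff all4)

text \<open>The \<open>2 \<times> 2\<close> minors formed from \<open>a\<close> and \<open>cross4 u v w\<close> are combinations of the three pairings of \<open>a\<close> with
  \<open>u\<close>, \<open>v\<close>, \<open>w\<close>. For independent vectors this is the uniqueness of the annihilator up to a factor.\<close>

lemma annihilator_unique:
  assumes "dot a u = 0" "dot a v = 0" "dot a w = 0"
  shows "a $ i * cross4 u v w $ j = a $ j * cross4 u v w $ i"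
proof -
  have "a$0 * cross4 u v w $ 1 - a$1 * cross4 u v w $ 0 =
      dot a u * (v$2 * w$3 - v$3 * w$2) - dot a v * (u$2 * w$3 - u$3 * w$2)
      + dot a w * (u$2 * v$3 - u$3 * v$2)"
    by (simp add: dot4 cross4_def algebra_simps)
  moreover have "a$2 * cross4 u v w $ 0 - a$0 * cross4 u v w $ 2 =
      dot a u * (v$1 * w$3 - v$3 * w$1) - dot a v * (u$1 * w$3 - u$3 * w$1)
      + dot a w * (u$1 * v$3 - u$3 * v$1)"
    by (simp add: dot4 cross4_def algebra_simps)
  moreover have "a$0 * cross4 u v w $ 3 - a$3 * cross4 u v w $ 0 =
      dot a u * (v$1 * w$2 - v$2 * w$1) - dot a v * (u$1 * w$2 - u$2 * w$1)
      + dot a w * (u$1 * v$2 - u$2 * v$1)"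
    by (simp add: dot4 cross4_def algebra_simps)
  moreover have "a$1 * cross4 u v w $ 2 - a$2 * cross4 u v w $ 1 =
      dot a u * (v$0 * w$3 - v$3 * w$0) - dot a v * (u$0 * w$3 - u$3 * w$0)
      + dot a w * (u$0 * v$3 - u$3 * v$0)"
    by (simp add: dot4 cross4_def algebra_simps)
  moreover have "a$3 * cross4 u v w $ 1 - a$1 * cross4 u v w $ 3 =
      dot a u * (v$0 * w$2 - v$2 * w$0) - dot a v * (u$0 * w$2 - u$2 * w$0)
      + dot a w * (u$0 * v$2 - u$2 * v$0)"
    by (simp add: dot4 cross4_def algebra_simps)
  moreover have "a$2 * cross4 u v w $ 3 - a$3 * cross4 u v w $ 2 =
      dot a u * (v$0 * w$1 - v$1 * w$0) - dot a v * (u$0 * w$1 - u$1 * w$0)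
      + dot a w * (u$0 * v$1 - u$1 * v$0)"
    by (simp add: dot4 cross4_def algebra_simps)
  ultimately have "\<forall>i j. a $ i * cross4 u v w $ j = a $ j * cross4 u v w $ i"
    by (simp add: all4 assms)
  then show ?thesis by blast
qed

lemma cross4_comb:
  "cross4 z (a *s z + b *s x + c *s y) (a' *s z + b' *s x + c' *s y) = (b * c' - b' * c) *s cross4 z x y"
  by (simp add: vec4_eq_iff cross4_def algebra_simps)

lemma cross4_swap: "cross4 u v w = - cross4 v u w" "cross4 u v w = - cross4 w v u"
  by (simp_all add: vec4_eq_iff cross4_def algebra_simps)

lemma cross4_comb0: "cross4 (b *s v + c *s w) v w = 0"
  by (simp add: vec4_eq_iff cross4_def algebra_simps)

lemma cross4_dependent:
  assumes "a *s u + b *s v + c *s w = 0" "a \<noteq> 0 \<or> b \<noteq> 0 \<or> c \<noteq> 0"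
  shows "cross4 u v w = 0"
proof -
  have e: "cross4 u v w = 0" if "a \<noteq> 0" "a *s u + b *s v + c *s w = 0"
    for a b c and u v w :: "complex^4"
  proof -
    have "u = (-b/a) *s v + (-c/a) *s w"
      unfolding vec_eq_iff
    proof
      fix i
      have "a * u$i + b * v$i + c * w$i = 0"
        using that(2) by (simp add: vec_eq_iff)
      then have "a * u$i = - b * v$i - c * w$i" by (simp add: algebra_simps eq_neg_iff_add_eq_0)
      then show "u $ i = ((-b/a) *s v + (-c/a) *s w) $ i"
        using that(1) by (simp add: divide_simps) (simp add: algebra_simps)
    qed
    then show ?thesis using cross4_comb0 by metis
  qed
  consider "a \<noteq> 0" | "b \<noteq> 0" | "c \<noteq> 0" using assms(2) by blast
  then show ?thesis
  proof cases
    case 1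
    then show ?thesis using e[OF 1 assms(1)] by simp
  next
    case 2
    have "b *s v + a *s u + c *s w = 0" using assms(1) by (simp add: add_ac)
    then show ?thesis using e[OF 2] cross4_swap(1)[of u v w] by simp
  next
    case 3
    have "c *s w + b *s v + a *s u = 0" using assms(1) by (simp add: add_ac)
    then show ?thesis using e[OF 3] cross4_swap(2)[of u v w] by simp
  qed
qed

section \<open>Holomorphic vector fields on projective space\<close>

text \<open>Liouville's theorem for functions of polynomial growth, with the coefficient of top degree read off at
  infinity.\<close>

lemma entire_leading_coeff:
  fixes f :: "complex \<Rightarrow> complex"
  assumes hol: "f holomorphic_on UNIV" and lim: "((\<lambda>t. f t / t ^ n) \<longlongrightarrow> c) at_infinity"
  shows "f t = (\<Sum>k<n. (deriv^^k) f 0 / fact k * t ^ k) + c * t ^ n"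
proof -
  have "eventually (\<lambda>t. dist (f t / t ^ n) c < 1) at_infinity"
    using lim by (rule tendstoD) simp
  then obtain r where r: "\<And>t. norm t \<ge> r \<Longrightarrow> dist (f t / t ^ n) c < 1"
    unfolding eventually_at_infinity by blast
  have bd: "norm (f t) \<le> (norm c + 1) * norm t ^ n" if "norm t \<ge> max r 1" for t
  proof -
    have "norm (f t / t ^ n) \<le> norm c + 1"
      using r[of t] that norm_triangle_ineq2[of "f t / t ^ n" c] by (simp add: dist_norm)
    moreover have "norm t > 0" using that by linarith
    ultimately show ?thesis by (simp add: norm_divide norm_power divide_simps)
  qed
  define a where "a = (\<lambda>k. (deriv^^k) f 0 / fact k)"
  have f: "f t = (\<Sum>k\<le>n. a k * t ^ k)" for t
    unfolding a_def by (rule Liouville_polynomial[OF hol bd])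
  have "((\<lambda>t. \<Sum>k\<le>n. a k * (if k = n then 1 else inverse t ^ (n - k))) \<longlongrightarrow>
      (\<Sum>k\<le>n. a k * (if k = n then 1 else 0))) at_infinity"
  proof (intro tendsto_sum tendsto_mult tendsto_const)
    fix k assume "k \<in> {..n}"
    have "((\<lambda>t::complex. inverse t ^ (n - k)) \<longlongrightarrow> 0) at_infinity" if "k \<noteq> n"
      using tendsto_power[OF tendsto_inverse_0, of "n - k"] that \<open>k \<in> _\<close> by (simp add: zero_power)
    then show "((\<lambda>t::complex. if k = n then 1 else inverse t ^ (n - k)) \<longlongrightarrow>
      (if k = n then 1 else 0)) at_infinity" by auto
  qed
  moreover have "eventually (\<lambda>t. (\<Sum>k\<le>n. a k * (if k = n then 1 else inverse t ^ (n - k)))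
      = f t / t ^ n) at_infinity"
    unfolding eventually_at_infinity
  proof (intro exI[of _ 1] allI impI)
    fix t :: complex assume "norm t \<ge> 1"
    then have "t \<noteq> 0" by auto
    show "(\<Sum>k\<le>n. a k * (if k = n then 1 else inverse t ^ (n - k))) = f t / t ^ n"
      unfolding f sum_divide_distrib
    proof (intro sum.cong refl)
      fix k assume "k \<in> {..n}"
      then have "t ^ n = t ^ k * t ^ (n - k)" by (simp flip: power_add)
      then have "t ^ k / t ^ n = 1 / t ^ (n - k)" using \<open>t \<noteq> 0\<close> by simp
      moreover have "inverse t ^ (n - k) = 1 / t ^ (n - k)"
        by (simp only: inverse_eq_divide power_one_over)
      ultimately have *: "inverse t ^ (n - k) = t ^ k / t ^ n" by (simp only:)
      show "a k * (if k = n then 1 else inverse t ^ (n - k)) = a k * t ^ k / t ^ n"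
      proof (cases "k = n")
        case True
        then show ?thesis using \<open>t \<noteq> 0\<close> by simp
      next
        case False
        then show ?thesis by (simp only: * if_False times_divide_eq_right)
      qed
    qed
  qed
  ultimately have "((\<lambda>t. f t / t ^ n) \<longlongrightarrow> (\<Sum>k\<le>n. a k * (if k = n then 1 else 0))) at_infinity"
    by (rule Lim_transform_eventually)
  then have "c = (\<Sum>k\<le>n. a k * (if k = n then 1 else 0))"
    using lim tendsto_unique trivial_limit_at_infinity by blast
  then have "c = a n" by (simp add: if_distrib[of "\<lambda>x. _ * x"] cong: if_cong)
  moreover have "f t = (\<Sum>k<n. a k * t ^ k) + a n * t ^ n"
    using f[of t] by (simp only: lessThan_Suc_atMost[symmetric] sum.lessThan_Suc)
  ultimately show ?thesis by (simp add: a_def)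
qed

lemma mholomorphic_line:
  assumes "f mholomorphic_on U" "p + t *s w \<in> U"
  shows "\<exists>D. (\<forall>c v. D (c *s v) = c * D v) \<and> (f has_derivative D) (at (p + t *s w)) \<and>
    ((\<lambda>t. f (p + t *s w)) has_field_derivative D w) (at t)"
proof -
  obtain D where D: "(f has_derivative D) (at (p + t *s w))" "\<forall>c v. D (c *s v) = c * D v"
    using assms unfolding mholomorphic_on_def by blast
  have lin: "bounded_linear (\<lambda>h::complex. h *s w)"
    by (rule linear_conv_bounded_linear[THEN iffD1])
       (auto simp: linear_iff vec.scale_left_distrib vec_eq_iff algebra_simps)
  have "((\<lambda>t. p + t *s w) has_derivative (\<lambda>h. 0 + h *s w)) (at t)"
    by (intro has_derivative_add has_derivative_const bounded_linear_imp_has_derivative[OF lin])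
  then have "((\<lambda>t. p + t *s w) has_derivative (\<lambda>h. h *s w)) (at t)"
    by simp
  from has_derivative_compose[OF this D(1)]
  have "((\<lambda>t. f (p + t *s w)) has_derivative (\<lambda>h. D w * h)) (at t)"
    using D(2) by (simp add: mult.commute)
  then show ?thesis using D by (auto simp: has_field_derivative_def)
qed

locale hol_vfield =
  fixes X :: "4 vfield"
  assumes X: "X \<in> hol_vfields"
begin

lemma diag: "X k z $ k = 0"
  using X by (simp add: hol_vfields_def)

lemma scale: "c \<noteq> 0 \<Longrightarrow> X k (c *s z) = X k z"
  using X by (simp add: hol_vfields_def)

lemma hol: "(\<lambda>z. X k z $ j) mholomorphic_on {z. z $ k \<noteq> 0}"
  using X by (simp add: hol_vfields_def)

lemma trans: "z $ k \<noteq> 0 \<Longrightarrow> z $ l \<noteq> 0 \<Longrightarrow>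
    X l z $ j = (X k z $ j * (z $ l / z $ k) - (z $ j / z $ k) * X k z $ l) / (z $ l / z $ k)\<^sup>2"
  using X unfolding hol_vfields_def by blast

abbreviation e0 :: "complex^4" where "e0 \<equiv> axis 0 1"

text \<open>The quadratic part at the origin of the chart \<open>{z\<^sub>0 \<noteq> 0}\<close> is determined by the behaviour on the
  hyperplane at infinity \<open>{z\<^sub>0 = 0}\<close>, seen in another chart.\<close>

lemma chart_expansion:
  assumes w: "w $ 0 = 0" "w $ l \<noteq> 0" and j: "j \<noteq> 0"
    and D: "((\<lambda>z. X 0 z $ j) has_derivative D) (at e0)" and lin: "\<forall>c v. D (c *s v) = c * D v"
  shows "X 0 (e0 + w) $ j = X 0 e0 $ j + D w - w $ j * (w $ l * X l w $ 0)"
proof -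
  define g where "g = (\<lambda>t. X 0 (e0 + t *s w) $ j)"
  have in_chart: "e0 + t *s w \<in> {z. z $ 0 \<noteq> 0}" for t
    using w by (simp add: axis_def)
  have "g field_differentiable at t" for t
    using mholomorphic_line[OF hol in_chart[of t], of j] unfolding g_def field_differentiable_def
    by blast
  then have "g holomorphic_on UNIV"
    by (simp add: holomorphic_on_def field_differentiable_at_within)
  moreover have "((\<lambda>t. g t / t ^ 2) \<longlongrightarrow> - w $ j * (w $ l * X l w $ 0)) at_infinity"
  proof -
    define k where "k = (\<lambda>s. X l (w + s *s e0) $ j * s * w $ l - w $ j * (w $ l * X l (w + s *s e0) $ 0))"
    have wl: "w + 0 *s e0 \<in> {z. z $ l \<noteq> 0}" using w by simp
    have "isCont (\<lambda>s. X l (w + s *s e0) $ i) 0" for i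
      using mholomorphic_line[OF hol wl, of i] DERIV_isCont by blast
    note c = this
    have "isCont k 0"
      unfolding k_def by (intro isCont_diff isCont_mult continuous_ident continuous_const c)
    then have "(k \<longlongrightarrow> k 0) (at 0)" by (simp add: isCont_def)
    then have "((\<lambda>t. k (inverse t)) \<longlongrightarrow> k 0) at_infinity"
      by (simp add: lim_at_infinity_0 comp_def)
    moreover have "eventually (\<lambda>t. k (inverse t) = g t / t ^ 2) at_infinity"
      unfolding eventually_at_infinity
    proof (intro exI[of _ 1] allI impI)
      fix t :: complex assume "norm t \<ge> 1"
      then have t: "t \<noteq> 0" by auto
      let ?z = "w + inverse t *s e0"
      have z: "?z $ l = w $ l" "?z $ 0 = inverse t" "?z $ j = w $ j"
        using w j by (auto simp: axis_def)
      have "e0 + t *s w = t *s ?z" using t by (simp add: vec_eq_iff distrib_left)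
      then have "g t = X 0 ?z $ j" by (simp only: g_def scale[OF t])
      also have "\<dots> = (X l ?z $ j * (?z $ 0 / ?z $ l) - (?z $ j / ?z $ l) * X l ?z $ 0) / (?z $ 0 / ?z $ l)\<^sup>2"
        by (rule trans) (use w t z in auto)
      also have "\<dots> = t ^ 2 * k (inverse t)"
        unfolding z k_def using w t by (simp add: field_simps power2_eq_square)
      finally show "k (inverse t) = g t / t ^ 2" using t by simp
    qed
    ultimately have "((\<lambda>t. g t / t ^ 2) \<longlongrightarrow> k 0) at_infinity"
      by (rule Lim_transform_eventually)
    then show ?thesis by (simp add: k_def)
  qed
  ultimately have "g 1 = (\<Sum>k<2. (deriv^^k) g 0 / fact k * 1 ^ k) + (- w $ j * (w $ l * X l w $ 0)) * 1 ^ 2"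
    by (rule entire_leading_coeff)
  moreover have "deriv g 0 = D w"
  proof -
    have "e0 + 0 *s w \<in> {z. z $ 0 \<noteq> 0}" by (rule in_chart)
    then obtain D' where D': "((\<lambda>z. X 0 z $ j) has_derivative D') (at (e0 + 0 *s w))"
      "(g has_field_derivative D' w) (at 0)"
      using mholomorphic_line[OF hol, of e0 0 w 0 j] unfolding g_def by blast
    have "((\<lambda>z. X 0 z $ j) has_derivative D') (at e0)" using D'(1) by simp
    then have "D' = D" using D by (rule has_derivative_unique)
    then show ?thesis using DERIV_imp_deriv[OF D'(2)] by simp
  qed
  ultimately show ?thesis by (simp add: g_def numeral_2_eq_2)
qed

text \<open>In the chart \<open>{z\<^sub>0 \<noteq> 0}\<close> the quadratic part of the field at \<open>e0\<close> is \<open>w \<mapsto> lead w *s w\<close> for a linear form \<open>lead\<close>.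
  Its value at \<open>w\<close> is computed at the point \<open>[w]\<close> at infinity, in an arbitrary chart around it.\<close>

definition lead :: "complex^4 \<Rightarrow> complex" where
  "lead w = (if w = 0 then 0 else let l = (SOME l. w $ l \<noteq> 0) in - (w $ l * X l w $ 0))"

lemma lead_eq:
  assumes "w $ 0 = 0" "w $ l \<noteq> 0"
  shows "lead w = - (w $ l * X l w $ 0)"
proof -
  define m where "m = (SOME l. w $ l \<noteq> 0)"
  have m: "w $ m \<noteq> 0" unfolding m_def by (rule someI[of "\<lambda>l. w $ l \<noteq> 0"]) (rule assms)
  have lm: "l \<noteq> 0" using assms by metis
  have "e0 + 0 *s w \<in> {z. z $ 0 \<noteq> 0}" by (simp add: axis_def)
  then obtain D where "((\<lambda>z. X 0 z $ l) has_derivative D) (at e0)" "\<forall>c v. D (c *s v) = c * D v"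
    using mholomorphic_line[OF hol, of e0 0 w 0 l] by auto
  then have "w $ l * (w $ l * X l w $ 0) = w $ l * (w $ m * X m w $ 0)"
    using chart_expansion[of w l l D] chart_expansion[of w m l D] assms m lm by simp
  then show ?thesis using assms m unfolding lead_def Let_def m_def[symmetric] by auto
qed

lemma lead_scale: assumes "w $ 0 = 0" shows "lead (c *s w) = c * lead w"
proof (cases "c = 0 \<or> w = 0")
  case True
  then show ?thesis by (auto simp: lead_def)
next
  case False
  then obtain l where "w $ l \<noteq> 0" by (auto simp: vec_eq_iff)
  then show ?thesis using lead_eq[of w l] lead_eq[of "c *s w" l] False scale[of c l w] assms by simp
qed

lemma lead_line:
  assumes "x $ 0 = 0" "y $ 0 = 0" "x + t *s y \<noteq> 0"
  shows "(\<lambda>t. lead (x + t *s y)) field_differentiable at t"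
proof -
  obtain l where l: "(x + t *s y) $ l \<noteq> 0" using assms(3) by (auto simp: vec_eq_iff)
  have "(\<lambda>t. X l (x + t *s y) $ 0) field_differentiable at t"
    using mholomorphic_line[OF hol, of x t y l 0] l unfolding field_differentiable_def by blast
  then have "(\<lambda>t. - ((x $ l + t * y $ l) * X l (x + t *s y) $ 0)) field_differentiable at t"
    by (intro derivative_intros field_differentiable_minus field_differentiable_mult
        field_differentiable_add field_differentiable_const field_differentiable_ident)
  moreover have "open {t. x $ l + t * y $ l \<noteq> 0}"
    by (intro open_Collect_neq continuous_intros)
  moreover have "- ((x $ l + s * y $ l) * X l (x + s *s y) $ 0) = lead (x + s *s y)"
    if "s \<in> {t. x $ l + t * y $ l \<noteq> 0}" for s
    using lead_eq[of "x + s *s y" l] that assms by simp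
  moreover have "t \<in> {t. x $ l + t * y $ l \<noteq> 0}" using l by simp
  ultimately show ?thesis
    unfolding field_differentiable_def
    by (elim exE, intro exI)
       (rule has_field_derivative_transform_within_open[of _ _ t "{t. x $ l + t * y $ l \<noteq> 0}"])
qed

text \<open>The function \<open>t \<mapsto> lead (x + t *s y)\<close> is entire and grows like \<open>t * lead y\<close>, so it is affine. Only if the
  line passes through 0, where \<open>lead\<close> is not known to be holomorphic, a direct argument is needed.\<close>

lemma lead_add:
  assumes "x $ 0 = 0" "y $ 0 = 0"
  shows "lead (x + y) = lead x + lead y"
proof (cases "\<exists>t. x + t *s y = 0")
  case True
  then obtain t where "x + t *s y = 0" by blast
  then have "x = (-t) *s y" by (simp add: vec_eq_iff add_eq_0_iff2)
  moreover from this have "x + y = (1 - t) *s y" by (simp add: vec_eq_iff algebra_simps)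
  ultimately show ?thesis using assms by (simp only: lead_scale) (simp add: algebra_simps)
next
  case False
  show ?thesis
  proof (cases "y = 0")
    case True
    then show ?thesis by (simp add: lead_def)
  next
    case y: False
    define m where "m = (\<lambda>t. lead (x + t *s y))"
    have "m field_differentiable at t" for t
      unfolding m_def using lead_line[OF assms] False by blast
    then have "m holomorphic_on UNIV"
      by (simp add: holomorphic_on_def field_differentiable_at_within)
    moreover have "((\<lambda>t. m t / t ^ 1) \<longlongrightarrow> lead y) at_infinity"
    proof -
      define k where "k = (\<lambda>s. lead (y + s *s x))"
      have "isCont k 0"
        unfolding k_def using lead_line[of y x 0] y assms field_differentiable_imp_continuous_at
        by fastforce
      then have "(k \<longlongrightarrow> k 0) (at 0)" by (simp add: isCont_def)
      then have "((\<lambda>t. k (inverse t)) \<longlongrightarrow> k 0) at_infinity"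
        by (simp add: lim_at_infinity_0 comp_def)
      moreover have "eventually (\<lambda>t. k (inverse t) = m t / t ^ 1) at_infinity"
        unfolding eventually_at_infinity
      proof (intro exI[of _ 1] allI impI)
        fix t :: complex assume "norm t \<ge> 1"
        then have t: "t \<noteq> 0" by auto
        have "x + t *s y = t *s (y + inverse t *s x)"
          using t by (simp add: vec_eq_iff field_simps)
        then have "m t = t * k (inverse t)"
          unfolding m_def k_def using lead_scale[of "y + inverse t *s x" t] assms
          by (simp only: vector_add_component vector_smult_component mult_zero_right add_0_right)
        then show "k (inverse t) = m t / t ^ 1" using t by simp
      qed
      ultimately have "((\<lambda>t. m t / t ^ 1) \<longlongrightarrow> k 0) at_infinity"
        by (rule Lim_transform_eventually)
      then show ?thesis by (simp add: k_def)
    qed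
    ultimately have "m 1 = (\<Sum>k<1. (deriv^^k) m 0 / fact k * 1 ^ k) + lead y * 1 ^ 1"
      by (rule entire_leading_coeff)
    then show ?thesis by (simp add: m_def)
  qed
qed

text \<open>In the chart the field is \<open>w \<mapsto> X(e0) + D w + lead w *s w\<close>. The matrix has the first column \<open>X(e0)\<close>, the block \<open>D\<close>
  and the first row \<open>- lead\<close>.\<close>

lemma linear_lift:
  "\<exists>M :: complex^4^4. \<forall>z j. z $ 0 \<noteq> 0 \<longrightarrow>
     X 0 z $ j = (z $ 0 * (M *v z) $ j - z $ j * (M *v z) $ 0) / (z $ 0)\<^sup>2"
proof -
  have "e0 + 0 *s e0 \<in> {z. z $ 0 \<noteq> 0}" by (simp add: axis_def)
  then have "\<exists>D. (\<forall>c v. D (c *s v) = c * D v) \<and> ((\<lambda>z. X 0 z $ j) has_derivative D) (at e0)" for j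
    using mholomorphic_line[OF hol, of e0 0 e0 0 j] by auto
  then obtain D where D: "\<And>j. ((\<lambda>z. X 0 z $ j) has_derivative D j) (at e0)"
    and lin: "\<And>j. \<forall>c v. D j (c *s v) = c * D j v"
    by metis
  have Dadd: "D j (u + v) = D j u + D j v" for j u v
    using D[of j] by (metis has_derivative_linear linear_add)
  have decomp: "w$1 *s axis 1 1 + w$2 *s axis 2 1 + w$3 *s axis 3 1 = w" if "w $ 0 = 0" for w :: "complex^4"
    using that by (simp add: vec4_eq_iff axis_def)
  have Dw: "D j w = w$1 * D j (axis 1 1) + w$2 * D j (axis 2 1) + w$3 * D j (axis 3 1)"
    if "w $ 0 = 0" for w j
  proof -
    have "D j (w$1 *s axis 1 1 + w$2 *s axis 2 1 + w$3 *s axis 3 1)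
        = w$1 * D j (axis 1 1) + w$2 * D j (axis 2 1) + w$3 * D j (axis 3 1)"
      by (simp only: Dadd lin[rule_format])
    then show ?thesis by (simp only: decomp[OF that])
  qed
  have Lw: "lead w = w$1 * lead (axis 1 1) + w$2 * lead (axis 2 1) + w$3 * lead (axis 3 1)"
    if "w $ 0 = 0" for w
  proof -
    have "axis i 1 $ 0 = (0::complex)" if "i \<noteq> 0" for i :: 4
      using that by (simp add: axis_def)
    then have "lead (w$1 *s axis 1 1 + w$2 *s axis 2 1 + w$3 *s axis 3 1)
        = w$1 * lead (axis 1 1) + w$2 * lead (axis 2 1) + w$3 * lead (axis 3 1)"
      by (simp add: lead_add lead_scale)
    then show ?thesis by (simp only: decomp[OF that])
  qed
  define M :: "complex^4^4" where "M = (\<chi> j. if j = 0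
     then vec4 0 (- lead (axis 1 1)) (- lead (axis 2 1)) (- lead (axis 3 1))
     else vec4 (X 0 e0 $ j) (D j (axis 1 1)) (D j (axis 2 1)) (D j (axis 3 1)))"
  have "X 0 z $ j = (z $ 0 * (M *v z) $ j - z $ j * (M *v z) $ 0) / (z $ 0)\<^sup>2"
    if z: "z $ 0 \<noteq> 0" for z j
  proof (cases "j = 0")
    case True
    then show ?thesis by (simp add: diag)
  next
    case j: False
    define w where "w = (1 / z $ 0) *s z - e0"
    have w0: "w $ 0 = 0" using z by (simp add: w_def axis_def)
    have wi: "w $ i = z $ i / z $ 0" if "i \<noteq> 0" for i
      using that by (simp add: w_def axis_def)
    have "X 0 z $ j = X 0 ((1 / z $ 0) *s z) $ j" using scale[of "1 / z $ 0" 0 z] z by simp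
    also have "\<dots> = X 0 (e0 + w) $ j" by (simp add: w_def)
    also have "\<dots> = X 0 e0 $ j + D j w + w $ j * lead w"
    proof (cases "w = 0")
      case True
      then show ?thesis using Dw[of w j] by simp
    next
      case False
      then obtain l where l: "w $ l \<noteq> 0" by (auto simp: vec_eq_iff)
      show ?thesis using chart_expansion[OF w0 l j D lin] lead_eq[OF w0 l] by simp
    qed
    also have "\<dots> = (z $ 0 * (M *v z) $ j - z $ j * (M *v z) $ 0) / (z $ 0)\<^sup>2"
    proof -
      have M0: "(M *v z) $ 0 = - (lead (axis 1 1) * z$1 + lead (axis 2 1) * z$2 + lead (axis 3 1) * z$3)"
        by (simp add: M_def matrix_vector_mult_def sum4)
      have Mj: "(M *v z) $ j = X 0 e0 $ j * z$0 + D j (axis 1 1) * z$1 + D j (axis 2 1) * z$2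
          + D j (axis 3 1) * z$3"
        using j by (simp add: M_def matrix_vector_mult_def sum4)
      have w123: "w $ 1 = z $ 1 / z $ 0" "w $ 2 = z $ 2 / z $ 0" "w $ 3 = z $ 3 / z $ 0"
        by (simp_all add: wi)
      have alg: "c + (p / t * d1 + q / t * d2 + r / t * d3) + x / t * (p / t * l1 + q / t * l2 + r / t * l3)
        = (t * (c * t + d1 * p + d2 * q + d3 * r) - x * - (l1 * p + l2 * q + l3 * r)) / t\<^sup>2"
        if "t \<noteq> 0" for c p q r t d1 d2 d3 x l1 l2 l3 :: complex
      proof -
        have "t * (c * t + d1 * p + d2 * q + d3 * r) - x * - (l1 * p + l2 * q + l3 * r)
          = t * (t * (c + (p / t * d1 + q / t * d2 + r / t * d3)) + x * (p / t * l1 + q / t * l2 + r / t * l3))"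
          using that by (simp add: distrib_left right_diff_distrib mult.commute mult.left_commute)
        then show ?thesis
          using that by (simp add: power2_eq_square add_divide_distrib)
      qed
      show ?thesis
        unfolding M0 Mj Dw[OF w0] Lw[OF w0] wi[OF j] w123 by (rule alg[OF z])
    qed
    finally show ?thesis .
  qed
  then show ?thesis by blast
qed

end

section \<open>First integrals with a given logarithmic derivative\<close>

text \<open>The kernel of \<open>\<omega>\<close> is contained in that of \<open>\<Theta>\<close>. Zeros of \<open>\<Theta>\<close> outside the singular set are harmless.\<close>

definition tangential :: "(complex^4 \<Rightarrow> complex^4) \<Rightarrow> (complex^4 \<Rightarrow> complex^4) \<Rightarrow> bool" where
  "tangential \<Theta> A \<longleftrightarrow> (\<forall>z v. A z \<noteq> 0 \<longrightarrow> dot (A z) v = 0 \<longrightarrow> dot (\<Theta> z) v = 0)"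

lemma leafwise_path_constant:
  fixes f :: "complex^'n \<Rightarrow> complex"
  assumes path: "leafwise_path A V \<gamma>"
    and der: "\<And>z. z \<in> V \<Longrightarrow> A z \<noteq> 0 \<Longrightarrow>
      \<exists>D. (f has_derivative D) (at z) \<and> (\<forall>v. one_form A z v = 0 \<longrightarrow> D v = 0)"
  shows "f (pathfinish \<gamma>) = f (pathstart \<gamma>)"
proof -
  obtain S where S: "finite S" "\<gamma> C1_differentiable_on ({0..1} - S)"
    "\<And>t. t \<in> {0..1} - S \<Longrightarrow> one_form A (\<gamma> t) (vector_derivative \<gamma> (at t)) = 0"
    and p: "path \<gamma>" "path_image \<gamma> \<subseteq> {z \<in> V. A z \<noteq> 0}"
    using path unfolding leafwise_path_def by blast
  have in_V: "\<gamma> t \<in> V" "A (\<gamma> t) \<noteq> 0" if "t \<in> {0..1}" for t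
    using p(2) that unfolding path_image_def by blast+
  have "(f \<circ> \<gamma>) 1 = (f \<circ> \<gamma>) 0"
  proof (rule has_derivative_zero_unique_strong_interval[OF S(1)])
    have "isCont f (\<gamma> t)" if "t \<in> {0..1}" for t
      using der[OF in_V[OF that]] has_derivative_continuous by blast
    then have "continuous_on (\<gamma> ` {0..1}) f"
      by (auto intro: continuous_at_imp_continuous_on)
    then show "continuous_on {0..1} (f \<circ> \<gamma>)"
      using p(1) by (intro continuous_on_compose) (auto simp: path_def)
  next
    fix t assume t: "t \<in> {0..1} - S"
    have "\<gamma> differentiable at t"
      using S(2) t unfolding C1_differentiable_on_eq by blast
    then have g: "(\<gamma> has_derivative (\<lambda>h. h *\<^sub>R vector_derivative \<gamma> (at t))) (at t)"
      using vector_derivative_works has_vector_derivative_def by metis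
    obtain D where D: "(f has_derivative D) (at (\<gamma> t))" "\<And>v. one_form A (\<gamma> t) v = 0 \<Longrightarrow> D v = 0"
      using der in_V t by blast
    have "((\<lambda>s. f (\<gamma> s)) has_derivative (\<lambda>h. D (h *\<^sub>R vector_derivative \<gamma> (at t)))) (at t)"
      by (rule has_derivative_compose[OF g D(1)])
    moreover have "D (h *\<^sub>R vector_derivative \<gamma> (at t)) = 0" for h
      using D S(3)[OF t] linear_scale[OF has_derivative_linear[OF D(1)]] by simp
    ultimately show "((f \<circ> \<gamma>) has_derivative (\<lambda>h. 0)) (at t within {0..1})"
      by (simp add: comp_def has_derivative_at_withinI)
  qed auto
  then show ?thesis by (simp add: pathfinish_def pathstart_def)
qed

text \<open>A first integral needs a domain with a branch that is not constant. A germ provides a branch over all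
  sufficiently small sets, and germs are compatible with the operations on multivalued functions.\<close>

definition germ :: "4 multifun \<Rightarrow> complex^4 \<Rightarrow> (complex^4 \<Rightarrow> complex) \<Rightarrow> bool" where
  "germ F z f \<longleftrightarrow> (\<exists>U. open U \<and> z \<in> U \<and> (\<forall>V. V \<subseteq> U \<longrightarrow> f \<in> F V))"

lemma germ_single: "germ (mf_single p) z p"
  unfolding germ_def mf_single_def by (intro exI[of _ UNIV]) simp

lemma germ_times:
  assumes "germ F z f" "germ G z g" shows "germ (F \<odot> G) z (\<lambda>z. f z * g z)"
proof -
  obtain U V where "open U" "z \<in> U" "\<And>W. W \<subseteq> U \<Longrightarrow> f \<in> F W" "open V" "z \<in> V" "\<And>W. W \<subseteq> V \<Longrightarrow> g \<in> G W"
    using assms unfolding germ_def by metis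
  then show ?thesis
    unfolding germ_def mf_times_def by (intro exI[of _ "U \<inter> V"]) blast
qed

lemma germ_exp: assumes "germ F z f" shows "germ (mf_exp F) z (\<lambda>z. exp (f z))"
  using assms unfolding germ_def mf_exp_def by blast

lemma germ_divide:
  assumes "germ F z f" "germ G z g" "g z \<noteq> 0" "\<And>w. isCont g w"
  shows "germ (F \<oslash> G) z (\<lambda>z. f z / g z)"
proof -
  obtain U V where UV: "open U" "z \<in> U" "\<And>W. W \<subseteq> U \<Longrightarrow> f \<in> F W" "open V" "z \<in> V" "\<And>W. W \<subseteq> V \<Longrightarrow> g \<in> G W"
    using assms unfolding germ_def by metis
  have "open {w. g w \<noteq> 0}"
    using assms(4) by (intro open_Collect_neq) (auto intro: continuous_at_imp_continuous_on)
  then show ?thesis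
    using UV assms(3) unfolding germ_def mf_divide_def
    by (intro exI[of _ "U \<inter> V \<inter> {w. g w \<noteq> 0}"]) blast
qed

text \<open>Along each branch \<open>dF = c \<Theta>\<close>, so a branch has zero derivative along paths tangent to \<open>ker \<omega>\<close>. The branch
  given by the germ is not constant, as its differential at \<open>z0\<close> is not zero.\<close>

lemma first_integralI:
  fixes A \<Theta> :: "complex^4 \<Rightarrow> complex^4"
  assumes tan: "tangential \<Theta> A"
    and der: "\<And>V f z. open V \<Longrightarrow> f \<in> F V \<Longrightarrow> z \<in> V \<Longrightarrow>
      \<exists>c. (f has_derivative (\<lambda>v. c * dot (\<Theta> z) v)) (at z) \<and> (f z \<noteq> 0 \<longrightarrow> c \<noteq> 0)"
    and ex: "germ F z0 f0" "f0 z0 \<noteq> 0" "dot (\<Theta> z0) v0 \<noteq> 0"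
  shows "first_integral A F"
  unfolding first_integral_def
proof (intro conjI allI impI)
  obtain U where U: "open U" "z0 \<in> U" "\<And>V. V \<subseteq> U \<Longrightarrow> f0 \<in> F V"
    using ex(1) unfolding germ_def by blast
  obtain r where r: "r > 0" "ball z0 r \<subseteq> U" using U(1,2) by (meson openE)
  have f0: "f0 \<in> F (ball z0 r)" using U(3) r by blast
  have "\<not> f0 constant_on ball z0 r"
  proof
    assume "f0 constant_on ball z0 r"
    then obtain k where k: "\<And>w. w \<in> ball z0 r \<Longrightarrow> f0 w = k"
      unfolding constant_on_def by blast
    obtain c where c: "(f0 has_derivative (\<lambda>v. c * dot (\<Theta> z0) v)) (at z0)" "c \<noteq> 0"
      using der[OF open_ball f0, of z0] r ex(2) by auto
    have "((\<lambda>_. k) has_derivative (\<lambda>v. c * dot (\<Theta> z0) v)) (at z0)"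
      by (rule has_derivative_transform_within_open[OF c(1), of "ball z0 r"]) (use r k in auto)
    then have "(\<lambda>v. c * dot (\<Theta> z0) v) = (\<lambda>v. 0)"
      using has_derivative_unique has_derivative_const by blast
    then show False using c(2) ex(3) by (metis mult_eq_0_iff)
  qed
  then show "\<exists>V f. open V \<and> connected V \<and> f \<in> F V \<and> \<not> f constant_on V"
    using f0 by (intro exI[of _ "ball z0 r"] exI[of _ f0]) auto
next
  fix V f p assume V: "open V" "f \<in> F V" and p: "p \<in> V" "A p \<noteq> 0"
  have "f (pathfinish \<gamma>) = f (pathstart \<gamma>)" if "leafwise_path A V \<gamma>" for \<gamma>
  proof (rule leafwise_path_constant[OF that])
    fix z assume z: "z \<in> V" "A z \<noteq> 0"
    obtain c where "(f has_derivative (\<lambda>v. c * dot (\<Theta> z) v)) (at z)"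
      using der[OF V z(1)] by blast
    moreover have "c * dot (\<Theta> z) v = 0" if "one_form A z v = 0" for v
      using tan z that unfolding tangential_def one_form_dot by simp
    ultimately show "\<exists>D. (f has_derivative D) (at z) \<and> (\<forall>v. one_form A z v = 0 \<longrightarrow> D v = 0)"
      by blast
  qed
  then show "f constant_on leaf A V p"
    unfolding constant_on_def leaf_def by (intro exI[of _ "f p"]) auto
qed

lemma power_branch_derivative:
  assumes V: "open V" "f \<in> mf_power p \<kappa> V" "z \<in> V" and p: "(p has_derivative p') (at z)"
  shows "p z \<noteq> 0 \<and> f z \<noteq> 0 \<and> (f has_derivative (\<lambda>v. f z * (\<kappa> * (p' v / p z)))) (at z)"
proof -
  obtain l where l: "f = (\<lambda>z. exp (\<kappa> * l z))" "l mholomorphic_on V" "\<And>z. z \<in> V \<Longrightarrow> exp (l z) = p z"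
    using V(2) unfolding mf_power_def by blast
  have nz: "p z \<noteq> 0" using l(3)[OF V(3)] by (metis exp_not_eq_zero)
  obtain L where L: "(l has_derivative L) (at z)"
    using l(2) V(3) unfolding mholomorphic_on_def by blast
  have "((\<lambda>z. exp (l z)) has_derivative (\<lambda>v. exp (l z) * L v)) (at z)"
    by (rule has_derivative_compose[OF L, of exp "\<lambda>x. exp (l z) * x"])
       (use DERIV_exp[of "l z"] in \<open>simp add: has_field_derivative_def\<close>)
  then have "(p has_derivative (\<lambda>v. exp (l z) * L v)) (at z)"
    by (rule has_derivative_transform_within_open[OF _ V(1,3)]) (use l(3) in auto)
  then have "(\<lambda>v. exp (l z) * L v) = p'" using p has_derivative_unique by blast
  then have "p' v = p z * L v" for v using l(3)[OF V(3)] by auto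
  then have Lv: "L v = p' v / p z" for v using nz by simp
  have "((\<lambda>z. exp (\<kappa> * l z)) has_derivative (\<lambda>v. exp (\<kappa> * l z) * (\<kappa> * L v))) (at z)"
    by (rule has_derivative_compose[OF has_derivative_mult_right[OF L], of exp "\<lambda>x. exp (\<kappa> * l z) * x" \<kappa>])
       (use DERIV_exp[of "\<kappa> * l z"] in \<open>simp add: has_field_derivative_def\<close>)
  then show ?thesis using nz by (simp add: l(1) Lv)
qed

text \<open>Where a polynomial function takes a value off the closed negative axis, the principal
  logarithm provides a branch.\<close>

lemma germ_power:
  assumes p: "\<And>w. \<exists>p'. (p has_derivative p') (at w) \<and> (\<forall>c v. p' (c *s v) = c * p' v)"
    and z: "p z \<notin> \<real>\<^sub>\<le>\<^sub>0"
  shows "germ (mf_power p \<kappa>) z (\<lambda>w. exp (\<kappa> * Ln (p w)))"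
proof -
  let ?U = "p -` (- \<real>\<^sub>\<le>\<^sub>0)"
  have cont: "continuous_on UNIV p"
    using p by (meson continuous_at_imp_continuous_on has_derivative_continuous)
  have "open ?U" using open_vimage[OF _ cont, of "- \<real>\<^sub>\<le>\<^sub>0"] by (simp add: open_Compl)
  moreover have "(\<lambda>w. exp (\<kappa> * Ln (p w))) \<in> mf_power p \<kappa> V" if "V \<subseteq> ?U" for V
    unfolding mf_power_def
  proof (intro CollectI exI[of _ "\<lambda>w. Ln (p w)"] conjI ballI refl)
    show "(\<lambda>w. Ln (p w)) mholomorphic_on V"
      unfolding mholomorphic_on_def
    proof
      fix w assume "w \<in> V"
      then have w: "p w \<notin> \<real>\<^sub>\<le>\<^sub>0" using that by auto
      obtain p' where p': "(p has_derivative p') (at w)" "\<forall>c v. p' (c *s v) = c * p' v"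
        using p by blast
      have "(Ln has_derivative (\<lambda>h. inverse (p w) * h)) (at (p w))"
        using has_field_derivative_Ln[OF w] by (simp add: has_field_derivative_def)
      from has_derivative_compose[OF p'(1) this]
      show "\<exists>D. ((\<lambda>w. Ln (p w)) has_derivative D) (at w) \<and> (\<forall>c v. D (c *s v) = c * D v)"
        using p'(2) by (intro exI[of _ "\<lambda>v. inverse (p w) * p' v"]) simp
    qed
    fix w assume "w \<in> V"
    then have "p w \<noteq> 0" using that by auto
    then show "exp (Ln (p w)) = p w" by simp
  qed
  ultimately show ?thesis unfolding germ_def using z by (intro exI[of _ ?U]) auto
qed

section \<open>Reduction to a pair of linear vector fields\<close>

lemma dot_add: "dot a (u + v) = dot a u + dot a v"
  and dot_diff: "dot a (u - v) = dot a u - dot a v"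
  and dot_smult: "dot a (k *s u) = k * dot a u"
  and smult_dot: "dot (k *s a) u = k * dot a u"
  by (simp_all add: dot4 algebra_simps)

text \<open>Cramer's rule for \<open>x\<close> in terms of \<open>u\<close>, \<open>v\<close>, \<open>w\<close> and the \<open>i\<close>-th coordinate vector.\<close>

lemma cross4_cramer:
  "cross4 u v w $ i * x $ j = cross4 x v w $ i * u $ j + cross4 u x w $ i * v $ j
     + cross4 u v x $ i * w $ j + (if i = j then dot (cross4 u v w) x else 0)"
proof -
  have "\<forall>i j. cross4 u v w $ i * x $ j = cross4 x v w $ i * u $ j + cross4 u x w $ i * v $ j
     + cross4 u v x $ i * w $ j + (if i = j then dot (cross4 u v w) x else 0)"
    unfolding all4 dot4 cross4_def vec4_nth
    by (intro conjI) (simp_all add: algebra_simps)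
  then show ?thesis by blast
qed

lemma hom_poly_det3:
  assumes "hom_poly 1 f" "hom_poly 1 g" "hom_poly 1 h" "hom_poly 1 g'" "hom_poly 1 h'"
  shows "hom_poly 3 (\<lambda>z::complex^'n. f z * (g z * h z - g' z * h' z))"
proof -
  have "hom_poly (1 + (1 + 1)) (\<lambda>z. f z * (g z * h z - g' z * h' z))"
    by (intro hom_poly_mult hom_poly_minus assms)
  then show ?thesis by (simp add: numeral_3_eq_3)
qed

lemma hom_poly_neg: "hom_poly d p \<Longrightarrow> hom_poly d (\<lambda>z::complex^'n. - p z)"
  using hom_poly_cmult[of d p "-1"] by simp

lemma hom_poly_matrix: "hom_poly 1 (\<lambda>z::complex^4. (M *v z) $ i)"
  using hom_poly_linear[of "\<lambda>j. M $ i $ j"]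
  by (simp add: matrix_vector_mult_def del: One_nat_def)

lemma hom_poly_cross4: "hom_poly 3 (\<lambda>z. cross4 z (M *v z) (N *v z) $ i)"
proof -
  have "\<forall>i. hom_poly 3 (\<lambda>z. cross4 z (M *v z) (N *v z) $ i)"
    unfolding all4 cross4_def vec4_nth
    by (intro conjI hom_poly_neg hom_poly_add hom_poly_minus hom_poly_det3 hom_poly_coord hom_poly_matrix)
  then show ?thesis by blast
qed

lemma polyfun_matrix: "polyfun (\<lambda>z. (M *v z) $ i)"
  by (rule hom_poly_imp_polyfun[OF hom_poly_matrix])

lemma generic_tangent_pair:
  fixes a z :: "complex^4"
  assumes "z $ 0 \<noteq> 0" "a \<noteq> 0" "dot a z = 0"
  shows "\<exists>u v. u $ 0 = 0 \<and> v $ 0 = 0 \<and> dot a u = 0 \<and> dot a v = 0 \<and> cross4 z u v \<noteq> 0"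
proof -
  have "a $ 1 \<noteq> 0 \<or> a $ 2 \<noteq> 0 \<or> a $ 3 \<noteq> 0"
    using assms by (auto simp: vec4_eq_iff dot4)
  then consider "a $ 1 \<noteq> 0" | "a $ 2 \<noteq> 0" | "a $ 3 \<noteq> 0" by blast
  then show ?thesis
  proof cases
    case 1
    then show ?thesis using assms(1)
      by (intro exI[of _ "vec4 0 (a$2) (- a$1) 0"] exI[of _ "vec4 0 (a$3) 0 (- a$1)"])
         (auto simp: dot4 vec4_eq_iff cross4_def)
  next
    case 2
    then show ?thesis using assms(1)
      by (intro exI[of _ "vec4 0 (a$2) (- a$1) 0"] exI[of _ "vec4 0 0 (a$3) (- a$2)"])
         (auto simp: dot4 vec4_eq_iff cross4_def)
  next
    case 3
    then show ?thesis using assms(1)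
      by (intro exI[of _ "vec4 0 (a$3) 0 (- a$1)"] exI[of _ "vec4 0 0 (a$3) (- a$2)"])
         (auto simp: dot4 vec4_eq_iff cross4_def)
  qed
qed

lemma matrix_derivative:
  "((\<lambda>z. (M :: complex^4^4) *v z) has_derivative (\<lambda>v. M *v v)) (at z)"
proof (rule bounded_linear_imp_has_derivative)
  show "bounded_linear ((*v) M)"
    by (rule linear_conv_bounded_linear[THEN iffD1])
       (auto simp: linear_iff vec_eq_iff matrix_vector_mult_def distrib_left sum.distrib
         scaleR_sum_right mult_scaleR_right)
qed

lemma hom_poly_differentiable:
  assumes "hom_poly d (p :: complex^'n \<Rightarrow> complex)" shows "p differentiable (at z)"
proof -
  obtain c where c: "\<forall>z. p z = (\<Sum>m | (\<Sum>i\<in>UNIV. m i) = d. c m * (\<Prod>i\<in>UNIV. z $ i ^ m i))"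
    using assms unfolding hom_poly_def by blast
  have vn: "((\<lambda>z::complex^'n. z $ i) has_derivative (\<lambda>v. v $ i)) (at z)" for i z
    by (rule bounded_linear_imp_has_derivative) (rule bounded_linear_vec_nth)
  have p: "p = (\<lambda>z. \<Sum>m | (\<Sum>i\<in>UNIV. m i) = d. c m * (\<Prod>i\<in>UNIV. z $ i ^ m i))"
    using c by auto
  show ?thesis unfolding p differentiable_def
    by (rule exI, rule has_derivative_sum, rule has_derivative_mult_right,
        rule has_derivative_prod, rule has_derivative_power, rule vn)
qed

text \<open>Differentiating \<open>\<omega>(X) = 0\<close> along \<open>Y\<close> and \<open>\<omega>(Y) = 0\<close> along \<open>X\<close> gives
  \<open>d\<omega>(X, Y) = - \<omega>([X, Y])\<close>, and integrability makes the left side vanish where \<open>\<omega> \<noteq> 0\<close>.\<close>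

lemma commutator_tangent:
  fixes A :: "complex^4 \<Rightarrow> complex^4" and M N :: "complex^4^4"
  assumes hom: "\<And>k. hom_poly d (\<lambda>z. A z $ k)" and int: "integrable_form A"
    and M: "\<And>z. dot (A z) (M *v z) = 0" and N: "\<And>z. dot (A z) (N *v z) = 0"
  shows "dot (A z) ((M ** N - N ** M) *v z) = 0"
proof (cases "A z = 0")
  case True
  then show ?thesis by (simp add: dot_def)
next
  case False
  have "\<exists>D. ((\<lambda>z. A z $ k) has_derivative D) (at z)" for k
    using hom_poly_differentiable[OF hom] unfolding differentiable_def by blast
  then obtain D where D: "\<And>k. ((\<lambda>z. A z $ k) has_derivative D k) (at z)" by metis
  have "(A has_derivative (\<lambda>v. \<chi> k. D k v)) (at z)"
    by (subst has_derivative_componentwise_within)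
       (auto simp: Basis_vec_def inner_axis intro!: has_derivative_inner_left D)
  then have fr: "frechet_derivative A (at z) v $ k = D k v" for v k
    using frechet_derivative_at by (metis vec_lambda_beta)
  have diff: "(\<Sum>k\<in>UNIV. A z $ k * (P *v v) $ k + D k v * (P *v z) $ k) = 0"
    if P: "\<And>z. dot (A z) (P *v z) = 0" for P v
  proof -
    have pd: "((\<lambda>z. (P *v z) $ k) has_derivative (\<lambda>v. (P *v v) $ k)) (at z)" for k
      using bounded_linear.has_derivative[OF bounded_linear_vec_nth matrix_derivative] .
    have "((\<lambda>z. dot (A z) (P *v z)) has_derivative
        (\<lambda>v. \<Sum>k\<in>UNIV. A z $ k * (P *v v) $ k + D k v * (P *v z) $ k)) (at z)"
      unfolding dot_def by (intro has_derivative_sum has_derivative_mult D pd)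
    moreover have "((\<lambda>z. dot (A z) (P *v z)) has_derivative (\<lambda>v. 0)) (at z)"
      using P by simp
    ultimately have "(\<lambda>v. \<Sum>k\<in>UNIV. A z $ k * (P *v v) $ k + D k v * (P *v z) $ k) = (\<lambda>v. 0)"
      by (rule has_derivative_unique)
    then show ?thesis by metis
  qed
  have d: "d_form A z (M *v z) (N *v z) = - dot (A z) (N *v (M *v z)) + dot (A z) (M *v (N *v z))"
    using diff[OF N, of "M *v z"] diff[OF M, of "N *v z"]
    unfolding d_form_def fr dot_def sum.distrib by (simp add: add_eq_0_iff)
  obtain i where i: "A z $ i \<noteq> 0" using False by (auto simp: vec_eq_iff)
  have "one_form A z (axis i 1) * d_form A z (M *v z) (N *v z) = 0"
    using int[unfolded integrable_form_def, rule_format, of z "axis i 1" "M *v z" "N *v z"] M N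
    by (simp add: one_form_dot)
  moreover have "one_form A z (axis i 1) = A z $ i"
    by (simp add: one_form_def axis_def if_distrib[of "\<lambda>x. _ * x"] cong: if_cong)
  ultimately have "- dot (A z) (N *v (M *v z)) + dot (A z) (M *v (N *v z)) = 0"
    using d i by simp
  then show ?thesis
    by (simp add: matrix_vector_mult_diff_rdistrib matrix_vector_mul_assoc[symmetric] dot_def
        right_diff_distrib sum_subtractf add_eq_0_iff)
qed

text \<open>The singular set contains no hyperplane.\<close>

definition sat_lin :: "complex^4^4 \<Rightarrow> complex^4^4 \<Rightarrow> bool" where
  "sat_lin M N \<longleftrightarrow> (\<forall>l. l \<noteq> 0 \<longrightarrow> (\<exists>z. dot l z = 0 \<and> cross4 z (M *v z) (N *v z) \<noteq> 0))"

text \<open>For \<open>Z = [M, N]\<close> the forms \<open>det(z, M z, Z z, \<cdot>)\<close> and \<open>det(z, N z, Z z, \<cdot>)\<close> are constant multiples of \<open>\<omega>\<close>. Subtraction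
  of a combination of \<open>M\<close> and \<open>N\<close> from \<open>Z\<close> makes both of them vanish, and the remainder \<open>W\<close> satisfies
  \<open>W z \<parallel> z\<close> for all \<open>z\<close>, so that \<open>W\<close> is scalar.\<close>

lemma L_foliation_linear_pair:
  fixes A :: "complex^4 \<Rightarrow> complex^4"
  assumes fol: "codim_one_foliation 2 A" and L: "L_foliation A"
  shows "\<exists>M N c. c \<noteq> 0 \<and> (\<forall>z. cross4 z (M *v z) (N *v z) = c *s A z) \<and> sat_lin M N \<and>
    (\<exists>a b d. M ** N - N ** M = mat a + (\<chi> i. b *s M $ i) + (\<chi> i. d *s N $ i))"
proof -
  have hom: "\<And>k. hom_poly 3 (\<lambda>z. A z $ k)" and int: "integrable_form A"
    and euler: "\<And>z. dot (A z) z = 0" and codim: "codim_ge_2 {z. A z = 0}"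
    using fol unfolding codim_one_foliation_def dot_def by (simp_all add: mult.commute)
  have pA: "\<And>k. polyfun (\<lambda>z. A z $ k)" using hom hom_poly_imp_polyfun by blast
  obtain L where L: "lie_subalgebra L" "generically (\<lambda>z. A z \<noteq> 0 \<and>
       (\<forall>k. z $ k \<noteq> 0 \<longrightarrow> (\<lambda>X. X k z) ` L = leaf_tangent A k z))"
    using L unfolding L_foliation_def by blast
  have Lhol: "L \<subseteq> hol_vfields" using L(1) unfolding lie_subalgebra_def by blast
  obtain e P where P: "hom_poly e P" "\<exists>z. P z \<noteq> 0"
    and PA: "\<forall>z. z \<noteq> 0 \<longrightarrow> P z \<noteq> 0 \<longrightarrow> A z \<noteq> 0 \<and>
       (\<forall>k. z $ k \<noteq> 0 \<longrightarrow> (\<lambda>X. X k z) ` L = leaf_tangent A k z)"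
    using L(2) unfolding generically_def by blast
  have gen: "\<And>z. z \<noteq> 0 \<Longrightarrow> P z \<noteq> 0 \<Longrightarrow> A z \<noteq> 0"
    "\<And>z. z \<noteq> 0 \<Longrightarrow> P z \<noteq> 0 \<Longrightarrow> z $ 0 \<noteq> 0 \<Longrightarrow> (\<lambda>X. X 0 z) ` L = leaf_tangent A 0 z"
    using PA by simp_all
  have pP: "polyfun P" using P(1) by (rule hom_poly_imp_polyfun)
  have Q: "polyfun (\<lambda>z. P z * z $ 0)" by (intro polyfun_mult pP polyfun_coord)
  have Qnz: "\<exists>z. P z * z $ 0 \<noteq> 0"
  proof (rule ccontr)
    assume "\<not> ?thesis"
    then have "(\<forall>z. P z = 0) \<or> (\<forall>z::complex^4. z $ 0 = 0)"
      by (intro polyfun_mult_eq_zero pP polyfun_coord) auto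
    moreover have "(axis 0 1 :: complex^4) $ 0 = 1" by (simp add: axis_def)
    ultimately show False using P(2) by (metis zero_neq_one)
  qed
  \<comment> \<open>An identity between polynomials needs to be checked only where \<open>P z\<^sub>0 \<noteq> 0\<close>.\<close>
  have dense: "f z = 0" if "polyfun f" "\<And>z. P z \<noteq> 0 \<Longrightarrow> z $ 0 \<noteq> 0 \<Longrightarrow> f z = 0" for f z
  proof -
    have "(\<forall>z. P z * z $ 0 = 0) \<or> (\<forall>z. f z = 0)"
      by (rule polyfun_mult_eq_zero[OF Q that(1)]) (use that(2) in auto)
    then show ?thesis using Qnz by blast
  qed
  have lift: "\<exists>M :: complex^4^4. (\<forall>z. dot (A z) (M *v z) = 0) \<and> (\<forall>z. z $ 0 \<noteq> 0 \<longrightarrow>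
      (\<exists>k. z $ 0 *s X 0 z = M *v z + k *s z))" if XL: "X \<in> L" for X
  proof -
    interpret hol_vfield X using XL Lhol by unfold_locales auto
    obtain M :: "complex^4^4" where M: "\<And>z j. z $ 0 \<noteq> 0 \<Longrightarrow>
        X 0 z $ j = (z $ 0 * (M *v z) $ j - z $ j * (M *v z) $ 0) / (z $ 0)\<^sup>2"
      using linear_lift by blast
    have eq: "z $ 0 *s X 0 z = M *v z + (- (M *v z) $ 0 / z $ 0) *s z" if "z $ 0 \<noteq> 0" for z
      using that by (simp add: vec_eq_iff M power2_eq_square divide_simps)
    have "dot (A z) (M *v z) = 0" for z
    proof (rule dense[of "\<lambda>z. dot (A z) (M *v z)"])
      show "polyfun (\<lambda>z. dot (A z) (M *v z))"
        unfolding dot_def by (intro polyfun_sum polyfun_mult pA polyfun_matrix)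
      fix z assume z: "P z \<noteq> 0" "z $ 0 \<noteq> 0"
      then have "z \<noteq> 0" by auto
      have "X 0 z \<in> leaf_tangent A 0 z"
        unfolding gen(2)[OF \<open>z \<noteq> 0\<close> z, symmetric] using XL by (rule imageI)
      then have "dot (A z) (X 0 z) = 0" by (simp add: leaf_tangent_def one_form_dot)
      then have "dot (A z) (z $ 0 *s X 0 z) = 0" by (simp add: dot_smult)
      then show "dot (A z) (M *v z) = 0"
        unfolding eq[OF z(2)] dot_add dot_smult euler by simp
    qed
    then show ?thesis using eq by blast
  qed
  obtain z where z: "P z \<noteq> 0" "z $ 0 \<noteq> 0" using Qnz by auto
  then have znz: "z \<noteq> 0" by auto
  obtain u v where uv: "u $ 0 = 0" "v $ 0 = 0" "dot (A z) u = 0" "dot (A z) v = 0" "cross4 z u v \<noteq> 0"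
    using generic_tangent_pair[OF z(2) gen(1)[OF znz z(1)] euler] by blast
  then have "u \<in> (\<lambda>X. X 0 z) ` L" "v \<in> (\<lambda>X. X 0 z) ` L"
    unfolding gen(2)[OF znz z] by (simp_all add: leaf_tangent_def one_form_dot)
  then obtain X Y where XY: "X \<in> L" "Y \<in> L" "X 0 z = u" "Y 0 z = v" by blast
  obtain M :: "complex^4^4" and k where M: "\<And>z. dot (A z) (M *v z) = 0" "z $ 0 *s u = M *v z + k *s z"
    using lift[OF XY(1)] XY(3) z(2) by blast
  obtain N :: "complex^4^4" and k' where N: "\<And>z. dot (A z) (N *v z) = 0" "z $ 0 *s v = N *v z + k' *s z"
    using lift[OF XY(2)] XY(4) z(2) by blast
  have "cross4 z (k *s z + 1 *s (M *v z) + 0 *s (N *v z)) (k' *s z + 0 *s (M *v z) + 1 *s (N *v z))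
      = cross4 z (M *v z) (N *v z)"
    unfolding cross4_comb by simp
  moreover have "cross4 z (0 *s z + z $ 0 *s u + 0 *s v) (0 *s z + 0 *s u + z $ 0 *s v) \<noteq> 0"
    unfolding cross4_comb using z uv by simp
  ultimately have Dz: "cross4 z (M *v z) (N *v z) \<noteq> 0"
    using M(2) N(2) by (simp add: add.commute)
  have propA: "\<exists>c. \<forall>z. cross4 z (S *v z) (T *v z) = c *s A z"
    if "\<And>z. dot (A z) (S *v z) = 0" "\<And>z. dot (A z) (T *v z) = 0" for S T
  proof (rule proportional_forms[OF hom hom_poly_cross4 codim])
    show "\<exists>z. A z \<noteq> 0" using gen(1)[OF znz z(1)] by blast
  qed (rule annihilator_unique[OF euler that])
  obtain c where c: "\<And>z. cross4 z (M *v z) (N *v z) = c *s A z"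
    using propA[OF M(1) N(1)] by blast
  then have c0: "c \<noteq> 0" using Dz by auto
  have sat: "sat_lin M N"
    unfolding sat_lin_def
  proof (intro allI impI)
    fix l :: "complex^4" assume l: "l \<noteq> 0"
    then obtain i where i: "l $ i \<noteq> 0" by (auto simp: vec_eq_iff)
    have "dot l (axis i 1) = l $ i"
      by (simp add: dot_def axis_def if_distrib[of "\<lambda>x. _ * x"] cong: if_cong)
    then have "\<exists>z. dot l z \<noteq> 0" using i by metis
    moreover have "hom_poly 1 (dot l)" unfolding dot_def by (rule hom_poly_linear)
    ultimately have "\<not> {z. dot l z = 0} \<subseteq> {z. A z = 0}"
      using codim unfolding codim_ge_2_def by blast
    then show "\<exists>z. dot l z = 0 \<and> cross4 z (M *v z) (N *v z) \<noteq> 0" using c c0 by auto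
  qed
  define Z where "Z = M ** N - N ** M"
  have Z: "dot (A z) (Z *v z) = 0" for z
    unfolding Z_def by (rule commutator_tangent[OF hom int M(1) N(1)])
  obtain c1 c2 where c1: "\<And>z. cross4 z (M *v z) (Z *v z) = c1 *s A z"
    and c2: "\<And>z. cross4 z (N *v z) (Z *v z) = c2 *s A z"
    using propA[OF M(1) Z] propA[OF N(1) Z] by blast
  \<comment> \<open>the coefficients cancel \<open>c1\<close> and \<open>c2\<close> in the two forms that involve \<open>W\<close>\<close>
  define W where "W = Z - (\<chi> i. (- c2 / c) *s M $ i) - (\<chi> i. (c1 / c) *s N $ i)"
  have smult: "(\<chi> i. k *s S $ i) *v z = k *s (S *v z)" for k and S :: "complex^4^4" and z
    by (simp add: vec_eq_iff matrix_vector_mult_def sum_distrib_left mult.assoc)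
  have W: "W *v z = Z *v z + (c2 / c) *s (M *v z) - (c1 / c) *s (N *v z)" for z
    unfolding W_def matrix_vector_mult_diff_rdistrib smult by (simp add: vec_eq_iff)
  have cMW: "cross4 z (M *v z) (W *v z) = 0" for z
  proof -
    have "cross4 z (M *v z) (W *v z) = cross4 z (M *v z) (Z *v z) - (c1 / c) *s cross4 z (M *v z) (N *v z)"
      unfolding W by (simp add: vec4_eq_iff cross4_def algebra_simps)
    then show ?thesis using c0 by (simp add: c1 c vec_eq_iff)
  qed
  have cWN: "cross4 z (W *v z) (N *v z) = 0" for z
  proof -
    have "cross4 z (W *v z) (N *v z) = (c2 / c) *s cross4 z (M *v z) (N *v z) - cross4 z (N *v z) (Z *v z)"
      unfolding W by (simp add: vec4_eq_iff cross4_def algebra_simps)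
    then show ?thesis using c0 by (simp add: c2 c vec_eq_iff)
  qed
  have dW: "dot (cross4 z (M *v z) (N *v z)) (W *v z) = 0" for z
    unfolding c W dot_add dot_diff dot_smult smult_dot Z M(1) N(1) by simp
  \<comment> \<open>all coefficients of \<open>W z\<close> in Cramer's rule but that of \<open>z\<close> vanish\<close>
  have par: "z $ j * (W *v z) $ k = z $ k * (W *v z) $ j" for z j k
  proof -
    obtain z0 i where i: "A z0 $ i \<noteq> 0" using gen(1)[OF znz z(1)] by (auto simp: vec_eq_iff)
    have "A z $ i * (z $ j * (W *v z) $ k - z $ k * (W *v z) $ j) = 0" for z
    proof -
      have "cross4 z (M *v z) (N *v z) $ i * (W *v z) $ k = cross4 (W *v z) (M *v z) (N *v z) $ i * z $ k" for k
        using cross4_cramer[of z "M *v z" "N *v z" i "W *v z" k] cMW[of z] cWN[of z] dW[of z]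
        by (simp split: if_splits)
      then have "cross4 z (M *v z) (N *v z) $ i * (z $ j * (W *v z) $ k - z $ k * (W *v z) $ j) = 0"
        by (simp add: right_diff_distrib mult.left_commute)
      then show ?thesis using c0 by (simp add: c)
    qed
    then have "(\<forall>z. A z $ i = 0) \<or> (\<forall>z. z $ j * (W *v z) $ k - z $ k * (W *v z) $ j = 0)"
    proof (rule polyfun_mult_eq_zero[rotated -1])
      have "polyfun (\<lambda>z. z $ j * (W *v z) $ k + (-1) * (z $ k * (W *v z) $ j))"
        by (intro polyfun_add polyfun_mult polyfun_coord polyfun_matrix polyfun_const)
      then show "polyfun (\<lambda>z. z $ j * (W *v z) $ k - z $ k * (W *v z) $ j)" by simp
    qed (rule pA)
    then show ?thesis using i by (metis eq_iff_diff_eq_0)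
  qed
  have ax: "(W *v axis j 1) $ k = W $ k $ j" for j k
    by (simp add: matrix_vector_mult_def axis_def if_distrib[of "\<lambda>x. _ * x"] cong: if_cong)
  have off: "W $ k $ j = 0" if "k \<noteq> j" for k j
    using par[of "axis j 1" j k] that unfolding ax by (simp add: axis_def)
  have dg: "W $ k $ k = W $ j $ j" for k j
  proof (cases "k = j")
    case False
    then show ?thesis
      using par[of "axis j 1 + axis k 1" j k] off[of j k] off[of k j]
      unfolding matrix_vector_right_distrib vector_add_component ax
      by (simp add: axis_def)
  qed simp
  have entries: "W $ i $ j = (if i = j then W $ 0 $ 0 else 0)" for i j
  proof (cases "i = j")
    case True
    show ?thesis unfolding True if_P[OF refl] by (rule dg)
  next
    case False
    show ?thesis unfolding if_not_P[OF False] by (rule off[OF False])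
  qed
  have "W = mat (W $ 0 $ 0)"
    unfolding vec_eq_iff[of W] vec_eq_iff[of "W $ _"] mat_def vec_lambda_beta
    by (intro allI) (rule entries)
  moreover have "Z = W + (\<chi> i. (- c2 / c) *s M $ i) + (\<chi> i. (c1 / c) *s N $ i)"
    by (simp add: W_def)
  ultimately have "M ** N - N ** M = mat (W $ 0 $ 0) + (\<chi> i. (- c2 / c) *s M $ i) + (\<chi> i. (c1 / c) *s N $ i)"
    by (simp only: Z_def)
  then show ?thesis using c c0 sat by blast
qed

section \<open>The closed forms of the list\<close>

lemma has_derivative_nth: "((\<lambda>z::complex^'n. z $ i) has_derivative (\<lambda>v. v $ i)) (at z)"
  by (rule bounded_linear_imp_has_derivative) (rule bounded_linear_vec_nth)

lemmas rational_derivative = has_derivative_nth has_derivative_add has_derivative_diff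
  has_derivative_minus has_derivative_mult has_derivative_divide' has_derivative_power has_derivative_const

lemma power_numeral_expand:
  "(x::complex)\<^sup>2 = x * x" "x ^ 3 = x * x * x" "x ^ 4 = x * x * x * x"
  by (simp_all add: power2_eq_square power3_eq_cube power4_eq_xxxx)

lemma exp_derivative:
  fixes s :: "complex^4 \<Rightarrow> complex"
  assumes "(s has_derivative s') (at z)"
  shows "((\<lambda>z. exp (s z)) has_derivative (\<lambda>v. exp (s z) * s' v)) (at z)"
  by (rule has_derivative_compose[OF assms, of exp "\<lambda>x. exp (s z) * x"])
     (use DERIV_exp[of "s z"] in \<open>simp add: has_field_derivative_def\<close>)

lemma eq_divide_times: "b \<noteq> 0 \<Longrightarrow> a * X = b * r \<Longrightarrow> r = a / b * (X::complex)"
  by (metis nonzero_mult_div_cancel_left times_divide_eq_left)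

lemma quotient_derivative:
  fixes p q :: "complex^4 \<Rightarrow> complex"
  assumes "(p has_derivative p') (at z)" "(q has_derivative q') (at z)" "q z \<noteq> 0" "b \<noteq> 0"
    "\<And>v. a * (q z)\<^sup>2 * dot \<theta> v = b * (p' v * q z - p z * q' v)"
  shows "((\<lambda>z. p z / q z) has_derivative (\<lambda>v. a / b * dot \<theta> v)) (at z)"
proof (rule has_derivative_eq_rhs[OF has_derivative_divide'[OF assms(1,2,3)]])
  show "(\<lambda>h. (p' h * q z - p z * q' h) / (q z * q z)) = (\<lambda>v. a / b * dot \<theta> v)"
  proof
    fix v
    have "a * (dot \<theta> v * (q z * q z)) = b * (p' v * q z - p z * q' v)"
      using assms(5)[of v] by (simp only: power2_eq_square mult_ac)
    then have "p' v * q z - p z * q' v = a / b * (dot \<theta> v * (q z * q z))"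
      by (rule eq_divide_times[OF assms(4)])
    then show "(p' v * q z - p z * q' v) / (q z * q z) = a / b * dot \<theta> v"
      using assms(3) by simp
  qed
qed

lemma square_by_cube_derivative:
  fixes F q :: "complex^4 \<Rightarrow> complex"
  assumes "(F has_derivative F') (at z)" "(q has_derivative q') (at z)" "q z \<noteq> 0"
    "\<And>v. dot \<theta> v = 2 * q z * F' v - 3 * F z * q' v"
  shows "((\<lambda>z. (F z)\<^sup>2 / q z ^ 3) has_derivative (\<lambda>v. F z / q z ^ 4 * dot \<theta> v)) (at z)"
proof (rule quotient_derivative[OF has_derivative_power[OF assms(1)] has_derivative_power[OF assms(2)]])
  show "q z ^ 3 \<noteq> 0" "q z ^ 4 \<noteq> 0" using assms(3) by simp_all
  fix v
  have id: "f * (Q ^ 3)\<^sup>2 * (2 * Q * f' - 3 * f * Q')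
      = Q ^ 4 * (2 * f' * f * Q ^ 3 - f\<^sup>2 * (3 * Q' * Q\<^sup>2))" for f Q f' Q' :: complex
    by algebra
  show "F z * (q z ^ 3)\<^sup>2 * dot \<theta> v =
      q z ^ 4 * (of_nat 2 * F' v * F z ^ (2 - 1) * q z ^ 3 - (F z)\<^sup>2 * (of_nat 3 * q' v * q z ^ (3 - 1)))"
    using id[of "F z" "q z" "F' v" "q' v"] by (simp only: assms(4)) simp
qed

lemma quotient_exp_derivative:
  fixes p q :: "complex^4 \<Rightarrow> complex"
  assumes "(p has_derivative p') (at z)" "(q has_derivative q') (at z)"
    "(m has_derivative m') (at z)" "(n has_derivative n') (at z)" "q z \<noteq> 0" "n z \<noteq> 0" "b \<noteq> 0"
    "\<And>v. a * (q z)\<^sup>2 * (n z)\<^sup>2 * dot \<theta> v =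
      b * ((p' v * q z - p z * q' v) * (n z)\<^sup>2 + p z * q z * (m' v * n z - m z * n' v))"
  shows "((\<lambda>z. p z / q z * exp (m z / n z)) has_derivative
    (\<lambda>v. exp (m z / n z) * (a / b) * dot \<theta> v)) (at z)"
proof -
  note d1 = has_derivative_divide'[OF assms(1,2,5)]
    and d2 = exp_derivative[OF has_derivative_divide'[OF assms(3,4,6)]]
  have frac: "r / (Q * Q) + P / Q * (s / (N * N)) = a / b * \<tau>"
    if "a * Q\<^sup>2 * N\<^sup>2 * \<tau> = b * (r * N\<^sup>2 + P * Q * s)" "Q \<noteq> 0" "N \<noteq> 0"
    for P Q N r s \<tau> :: complex
  proof -
    have "r / (Q * Q) + P / Q * (s / (N * N)) = (r * N\<^sup>2 + P * Q * s) / (Q\<^sup>2 * N\<^sup>2)"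
      using that(2,3) by (simp add: add_divide_distrib power2_eq_square)
    also have "r * N\<^sup>2 + P * Q * s = a / b * (\<tau> * (Q\<^sup>2 * N\<^sup>2))"
      by (rule eq_divide_times[OF \<open>b \<noteq> 0\<close>]) (use that(1) in \<open>simp only: mult_ac\<close>)
    finally show ?thesis using that(2,3) by simp
  qed
  show ?thesis
  proof (rule has_derivative_eq_rhs[OF has_derivative_mult[OF d1 d2]], rule ext)
    fix v
    have "exp (m z / n z) * ((p' v * q z - p z * q' v) / (q z * q z)
        + p z / q z * ((m' v * n z - m z * n' v) / (n z * n z))) = exp (m z / n z) * (a / b * dot \<theta> v)"
      using frac[OF assms(8)[of v] assms(5,6)] by simp
    then show "p z / q z * (exp (m z / n z) * ((m' v * n z - m z * n' v) / (n z * n z)))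
        + (p' v * q z - p z * q' v) / (q z * q z) * exp (m z / n z)
        = exp (m z / n z) * (a / b) * dot \<theta> v"
      by (simp only: distrib_left mult_ac add_ac)
  qed
qed

text \<open>Up to a factor, each form is the differential of one of the listed functions; the factor removes denominators,
  powers and exponentials.\<close>

definition form1 :: "complex \<Rightarrow> complex \<Rightarrow> complex \<Rightarrow> complex \<Rightarrow> complex^4 \<Rightarrow> complex^4" where
  "form1 a0 a1 a2 a3 z = vec4
    (a0 * (z$1 * z$2 * z$3))
    (a1 * (z$0 * z$2 * z$3))
    (a2 * (z$0 * z$1 * z$3))
    (a3 * (z$0 * z$1 * z$2))"

definition form2 :: "complex^4 \<Rightarrow> complex^4" where
  "form2 z = vec4
    (z$3 * z$3 * z$1)
    (- (z$3 * z$3 * z$0))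
    (z$1 * z$1 * z$3)
    (- (z$1 * z$1 * z$2))"

definition form3 :: "complex^4 \<Rightarrow> complex^4" where
  "form3 z = vec4
    (z$3 * z$3 * z$1)
    (z$3 * z$3 * z$1 - z$3 * z$3 * z$0)
    (z$1 * z$1 * z$3)
    (- (z$1 * z$1 * z$2) - z$1 * z$1 * z$3)"

definition form4 :: "complex^4 \<Rightarrow> complex^4" where
  "form4 z = vec4
    (z$3 * z$3 * z$3)
    (- (z$0 * z$3 * z$3))
    (2 * z$0 * z$2 * z$3)
    (z$0 * z$1 * z$3 - z$0 * z$3 * z$3 - 2 * z$0 * z$2 * z$2)"

definition form5 :: "complex \<Rightarrow> complex^4 \<Rightarrow> complex^4" where
  "form5 \<kappa> z = vec4
    (- (\<kappa> * z$1 * z$3 * z$3))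
    (z$0 * z$3 * z$3)
    (z$0 * z$1 * z$3)
    ((\<kappa> - 1) * z$0 * z$1 * z$3 - z$0 * z$1 * z$2)"

definition form6 :: "complex^4 \<Rightarrow> complex^4" where
  "form6 z = vec4
    (z$3 * z$3 * z$3)
    (z$2 * z$3 * z$3)
    (z$1 * z$3 * z$3 + 3 * z$2 * z$2 * z$3)
    (- (z$0 * z$3 * z$3) - 2 * z$1 * z$2 * z$3 - 3 * z$2 * z$2 * z$2)"

definition form7 :: "complex^4 \<Rightarrow> complex^4" where
  "form7 z = vec4
    (2 * (z$1 * z$3 - z$2 * z$2 / 2) * (z$3 * z$3))
    (2 * (z$1 * z$3 - z$2 * z$2 / 2) * (- (z$2 * z$3)) - 3 * (z$0 * z$3 * z$3 - z$1 * z$2 * z$3 + z$2 * z$2 * z$2 / 3) * z$3)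
    (2 * (z$1 * z$3 - z$2 * z$2 / 2) * (z$2 * z$2 - z$1 * z$3) + 3 * (z$0 * z$3 * z$3 - z$1 * z$2 * z$3 + z$2 * z$2 * z$2 / 3) * z$2)
    (2 * (z$1 * z$3 - z$2 * z$2 / 2) * (2 * z$0 * z$3 - z$1 * z$2) - 3 * (z$0 * z$3 * z$3 - z$1 * z$2 * z$3 + z$2 * z$2 * z$2 / 3) * z$1)"

definition form8 :: "complex \<Rightarrow> complex^4 \<Rightarrow> complex^4" where
  "form8 \<kappa> z = vec4
    (2 * z$3 * (z$1 * z$3 - z$2 * z$2))
    (- (\<kappa> * z$0 * z$3 * z$3))
    (2 * \<kappa> * z$0 * z$3 * z$2)
    (2 * (\<kappa> - 1) * z$0 * (z$1 * z$3 - z$2 * z$2) - \<kappa> * z$0 * z$3 * z$1)"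

definition form9 :: "complex^4 \<Rightarrow> complex^4" where
  "form9 z = vec4
    ((z$1 * z$3 - z$2 * z$2) * z$3)
    (- (z$3 * z$3 * z$3))
    (2 * z$2 * z$3 * z$3)
    (2 * z$3 * (z$1 * z$3 - z$2 * z$2) - z$3 * z$3 * z$1 - (z$1 * z$3 - z$2 * z$2) * z$0)"

definition form10 :: "complex^4 \<Rightarrow> complex^4" where
  "form10 z = vec4
    (z$0 * z$3 * z$3 + (z$1 * z$3 - z$2 * z$2) * z$3)
    (- (z$0 * z$3 * z$3))
    (2 * z$0 * z$3 * z$2)
    ((z$1 * z$3 - z$2 * z$2) * z$0 - z$0 * z$0 * z$3 - z$0 * z$3 * z$1)"

definition form11 :: "complex^4 \<Rightarrow> complex^4" where
  "form11 z = vec4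
    (z$2 * z$3 * z$3)
    (- (z$2 * z$2 * z$3))
    (z$3 * z$3 * z$3 - z$1 * z$2 * z$3)
    (z$2 * z$3 * z$0 - z$2 * z$3 * z$3 - 2 * z$2 * (z$0 * z$3 - z$1 * z$2))"

definition form12 :: "complex \<Rightarrow> complex^4 \<Rightarrow> complex^4" where
  "form12 \<kappa> z = vec4
    (\<kappa> * z$2 * z$3 * z$3)
    (- (\<kappa> * z$2 * z$2 * z$3))
    (- (\<kappa> * z$1 * z$2 * z$3) - (\<kappa> + 1) * (z$0 * z$3 - z$1 * z$2) * z$3)
    (\<kappa> * z$0 * z$2 * z$3 - (\<kappa> - 1) * (z$0 * z$3 - z$1 * z$2) * z$2)"

definition form13 :: "complex^4 \<Rightarrow> complex^4" where
  "form13 z = vec4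
    (z$3 * z$3 * z$3)
    (- (z$2 * z$3 * z$3))
    (- (z$1 * z$3 * z$3) - (z$0 * z$3 - z$1 * z$2) * z$3)
    (z$0 * z$3 * z$3 - 2 * (z$0 * z$3 - z$1 * z$2) * z$3 + (z$0 * z$3 - z$1 * z$2) * z$2)"

lemmas form_defs = form1_def form2_def form3_def form4_def form5_def form6_def form7_def form8_def
  form9_def form10_def form11_def form12_def form13_def

lemmas branch_simps = mf_times_def mf_divide_def mf_single_def mf_exp_def

text \<open>The factors \<open>a\<close> and \<open>b\<close> relate \<open>\<Theta>\<close> to the numerator of the differential. They allow the hypothesis to be a
  polynomial identity without divisions.\<close>

lemma first_integral_quotient_exp:
  fixes p q m n :: "complex^4 \<Rightarrow> complex"
  assumes tan: "tangential \<Theta> A"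
    and der: "\<And>z. (p has_derivative p' z) (at z)" "\<And>z. (q has_derivative q' z) (at z)"
      "\<And>z. (m has_derivative m' z) (at z)" "\<And>z. (n has_derivative n' z) (at z)"
    and id: "\<And>z v. q z \<noteq> 0 \<Longrightarrow> n z \<noteq> 0 \<Longrightarrow> a z * (q z)\<^sup>2 * (n z)\<^sup>2 * dot (\<Theta> z) v =
      b z * ((p' z v * q z - p z * q' z v) * (n z)\<^sup>2 + p z * q z * (m' z v * n z - m z * n' z v))"
    and ab: "\<And>z. q z \<noteq> 0 \<Longrightarrow> n z \<noteq> 0 \<Longrightarrow> a z \<noteq> 0 \<and> b z \<noteq> 0"
    and wit: "p z0 \<noteq> 0" "q z0 \<noteq> 0" "n z0 \<noteq> 0" "dot (\<Theta> z0) v0 \<noteq> 0"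
  shows "first_integral A (mf_single p \<oslash> mf_single q \<odot> mf_exp (mf_single m \<oslash> mf_single n))"
proof (rule first_integralI[OF tan])
  fix V :: "(complex^4) set" and f z
  assume "open V" "f \<in> (mf_single p \<oslash> mf_single q \<odot> mf_exp (mf_single m \<oslash> mf_single n)) V" "z \<in> V"
  then have f: "f = (\<lambda>z. p z / q z * exp (m z / n z))" and nz: "q z \<noteq> 0" "n z \<noteq> 0"
    by (auto simp: branch_simps)
  have "b z \<noteq> 0" using ab[OF nz] by simp
  then have "(f has_derivative (\<lambda>v. exp (m z / n z) * (a z / b z) * dot (\<Theta> z) v)) (at z)"
    unfolding f by (rule quotient_exp_derivative[OF der nz _ id[OF nz]])
  then show "\<exists>c. (f has_derivative (\<lambda>v. c * dot (\<Theta> z) v)) (at z) \<and> (f z \<noteq> 0 \<longrightarrow> c \<noteq> 0)"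
    by (intro exI[of _ "exp (m z / n z) * (a z / b z)"] conjI impI) (use ab[OF nz] in simp_all)
next
  have cont: "isCont q w" "isCont n w" for w
    using has_derivative_continuous[OF der(2)] has_derivative_continuous[OF der(4)] by simp_all
  show "germ (mf_single p \<oslash> mf_single q \<odot> mf_exp (mf_single m \<oslash> mf_single n)) z0
      (\<lambda>z. p z / q z * exp (m z / n z))"
    by (intro germ_times germ_exp germ_divide germ_single wit cont)
  show "p z0 / q z0 * exp (m z0 / n z0) \<noteq> 0" using wit by simp
  show "dot (\<Theta> z0) v0 \<noteq> 0" by (rule wit)
qed

lemma first_integral_form3:
  assumes "tangential form3 A"
  shows "first_integral A
    (mf_single (\<lambda>z. z$1) \<oslash> mf_single (\<lambda>z. z$3) \<odot>
        mf_exp (mf_single (\<lambda>z. z$0 * z$3 + z$2 * z$1) \<oslash> mf_single (\<lambda>z. z$1 * z$3)))"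
  by (rule first_integral_quotient_exp[OF assms, where a = "\<lambda>z. 1" and b = "\<lambda>z. (z$1 * z$3 * z$3 * z$3)"
        and ?z0.0 = "vec4 1 2 1 1" and ?v0.0 = "vec4 1 0 0 0"], (rule rational_derivative)+)
     (simp add: form3_def dot4 power2_eq_square algebra_simps, simp_all add: form3_def dot4 power2_eq_square)

lemma first_integral_form4:
  assumes "tangential form4 A"
  shows "first_integral A
    (mf_single (\<lambda>z. z$0) \<oslash> mf_single (\<lambda>z. z$3) \<odot>
        mf_exp (mf_single (\<lambda>z. (z$2)^2 - z$1 * z$3) \<oslash> mf_single (\<lambda>z. (z$3)^2)))"
  by (rule first_integral_quotient_exp[OF assms, where a = "\<lambda>z. 1" and b = "\<lambda>z. (z$3 * z$3 * z$3 * z$3)"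
        and ?z0.0 = "vec4 1 2 1 1" and ?v0.0 = "vec4 1 0 0 0"], (rule rational_derivative)+)
     (simp add: form4_def dot4 power2_eq_square algebra_simps, simp_all add: form4_def dot4 power2_eq_square)

lemma first_integral_form9:
  assumes "tangential form9 A"
  shows "first_integral A
    (mf_single (\<lambda>z. (z$3)^2) \<oslash> mf_single (\<lambda>z. z$1 * z$3 - (z$2)^2) \<odot>
        mf_exp (mf_single (\<lambda>z. z$0) \<oslash> mf_single (\<lambda>z. z$3)))"
  by (rule first_integral_quotient_exp[OF assms, where a = "\<lambda>z. 1" and b = "\<lambda>z. (z$1 * z$3 - (z$2)^2)^2"
        and ?z0.0 = "vec4 1 2 1 1" and ?v0.0 = "vec4 1 0 0 0"], (rule rational_derivative)+)
     (simp add: form9_def dot4 power2_eq_square algebra_simps, simp_all add: form9_def dot4 power2_eq_square)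

lemma first_integral_form10:
  assumes "tangential form10 A"
  shows "first_integral A
    (mf_single (\<lambda>z. z$0) \<oslash> mf_single (\<lambda>z. z$3) \<odot>
        mf_exp (mf_single (\<lambda>z. (z$2)^2 - z$1 * z$3) \<oslash> mf_single (\<lambda>z. z$0 * z$3)))"
  by (rule first_integral_quotient_exp[OF assms, where a = "\<lambda>z. 1" and b = "\<lambda>z. (z$0 * z$3 * z$3 * z$3)"
        and ?z0.0 = "vec4 1 2 1 1" and ?v0.0 = "vec4 1 0 0 0"], (rule rational_derivative)+)
     (simp add: form10_def dot4 power2_eq_square algebra_simps, simp_all add: form10_def dot4 power2_eq_square)

lemma first_integral_form11:
  assumes "tangential form11 A"
  shows "first_integral A
    (mf_single (\<lambda>z. z$2) \<oslash> mf_single (\<lambda>z. z$3) \<odot>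
        mf_exp (mf_single (\<lambda>z. z$0 * z$3 - z$1 * z$2) \<oslash> mf_single (\<lambda>z. (z$3)^2)))"
  by (rule first_integral_quotient_exp[OF assms, where a = "\<lambda>z. 1" and b = "\<lambda>z. (z$3 * z$3 * z$3 * z$3)"
        and ?z0.0 = "vec4 1 2 1 1" and ?v0.0 = "vec4 1 0 0 0"], (rule rational_derivative)+)
     (simp add: form11_def dot4 power2_eq_square algebra_simps, simp_all add: form11_def dot4 power2_eq_square)

lemma first_integral_form13:
  assumes "tangential form13 A"
  shows "first_integral A
    (mf_single (\<lambda>z. z$0 * z$3 - z$1 * z$2) \<oslash> mf_single (\<lambda>z. (z$3)^2) \<odot>
        mf_exp (mf_single (\<lambda>z. - z$2) \<oslash> mf_single (\<lambda>z. z$3)))"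
  by (rule first_integral_quotient_exp[OF assms, where a = "\<lambda>z. 1" and b = "\<lambda>z. (z$3 * z$3 * z$3 * z$3)"
        and ?z0.0 = "vec4 1 2 1 1" and ?v0.0 = "vec4 1 0 0 0"], (rule rational_derivative)+)
     (simp add: form13_def dot4 power2_eq_square algebra_simps, simp_all add: form13_def dot4 power2_eq_square)

lemma first_integral_form2:
  assumes "tangential form2 A"
  shows "first_integral A
    (mf_single (\<lambda>z. z$1 * z$2 + z$0 * z$3) \<oslash> mf_single (\<lambda>z. z$1 * z$3))"
proof (rule first_integralI[OF assms])
  fix V :: "(complex^4) set" and f z assume "open V" "f \<in> (mf_single (\<lambda>z. z$1 * z$2 + z$0 * z$3) \<oslash> mf_single (\<lambda>z. z$1 * z$3)) V" "z \<in> V"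
  then have f: "f = (\<lambda>z. (z$1 * z$2 + z$0 * z$3) / (z$1 * z$3))" and nz: "z$1 * z$3 \<noteq> 0"
    by (auto simp: branch_simps)
  have "(f has_derivative (\<lambda>v. (1) / ((z$1 * z$3)^2) * dot (form2 z) v)) (at z)"
    unfolding f
    by (rule quotient_derivative, (rule rational_derivative nz power_not_zero numeral_neq_zero)+)
       (use nz in \<open>simp_all add: form2_def dot4 power_numeral_expand algebra_simps\<close>)
  then show "\<exists>c. (f has_derivative (\<lambda>v. c * dot (form2 z) v)) (at z) \<and> (f z \<noteq> 0 \<longrightarrow> c \<noteq> 0)"
    by (intro exI[of _ "(1) / ((z$1 * z$3)^2)"] conjI impI) (use nz in \<open>auto simp: f\<close>)
next
  let ?z = "vec4 1 2 1 1 :: complex^4"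
  show "germ (mf_single (\<lambda>z. z$1 * z$2 + z$0 * z$3) \<oslash> mf_single (\<lambda>z. z$1 * z$3)) ?z
      (\<lambda>z. (z$1 * z$2 + z$0 * z$3) / (z$1 * z$3))"
    by (intro germ_divide germ_single continuous_intros) (auto simp: power2_eq_square)
  show "dot (form2 ?z) (vec4 1 0 0 0) \<noteq> 0" by (simp add: form2_def dot4)
qed (simp add: power2_eq_square)

lemma first_integral_form6:
  assumes "tangential form6 A"
  shows "first_integral A
    (mf_single (\<lambda>z. z$0 * (z$3)^2 + z$1 * z$2 * z$3 + (z$2)^3) \<oslash> mf_single (\<lambda>z. (z$3)^3))"
proof (rule first_integralI[OF assms])
  fix V :: "(complex^4) set" and f z assume "open V" "f \<in> (mf_single (\<lambda>z. z$0 * (z$3)^2 + z$1 * z$2 * z$3 + (z$2)^3) \<oslash> mf_single (\<lambda>z. (z$3)^3)) V" "z \<in> V"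
  then have f: "f = (\<lambda>z. (z$0 * (z$3)^2 + z$1 * z$2 * z$3 + (z$2)^3) / ((z$3)^3))" and nz: "(z$3)^3 \<noteq> 0"
    by (auto simp: branch_simps)
  have "(f has_derivative (\<lambda>v. (1) / ((z$3)^4) * dot (form6 z) v)) (at z)"
    unfolding f
    by (rule quotient_derivative, (rule rational_derivative nz power_not_zero numeral_neq_zero)+)
       (use nz in \<open>simp_all add: form6_def dot4 power_numeral_expand algebra_simps\<close>)
  then show "\<exists>c. (f has_derivative (\<lambda>v. c * dot (form6 z) v)) (at z) \<and> (f z \<noteq> 0 \<longrightarrow> c \<noteq> 0)"
    by (intro exI[of _ "(1) / ((z$3)^4)"] conjI impI) (use nz in \<open>auto simp: f\<close>)
next
  let ?z = "vec4 1 2 1 1 :: complex^4"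
  show "germ (mf_single (\<lambda>z. z$0 * (z$3)^2 + z$1 * z$2 * z$3 + (z$2)^3) \<oslash> mf_single (\<lambda>z. (z$3)^3)) ?z
      (\<lambda>z. (z$0 * (z$3)^2 + z$1 * z$2 * z$3 + (z$2)^3) / ((z$3)^3))"
    by (intro germ_divide germ_single continuous_intros) (auto simp: power2_eq_square)
  show "dot (form6 ?z) (vec4 1 0 0 0) \<noteq> 0" by (simp add: form6_def dot4)
qed (simp add: power2_eq_square)

lemma first_integral_form7:
  assumes "tangential form7 A"
  shows "first_integral A
    (mf_single (\<lambda>z. (z$0 * (z$3)^2 - z$1 * z$2 * z$3 + (z$2)^3 / 3)^2) \<oslash>
        mf_single (\<lambda>z. (z$1 * z$3 - (z$2)^2 / 2)^3))"
proof (rule first_integralI[OF assms])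
  fix V :: "(complex^4) set" and f z assume "open V" "f \<in> (mf_single (\<lambda>z. (z$0 * (z$3)^2 - z$1 * z$2 * z$3 + (z$2)^3 / 3)^2) \<oslash>
        mf_single (\<lambda>z. (z$1 * z$3 - (z$2)^2 / 2)^3)) V" "z \<in> V"
  then have f: "f = (\<lambda>z. ((z$0 * (z$3)^2 - z$1 * z$2 * z$3 + (z$2)^3 / 3)^2) / ((z$1 * z$3 - (z$2)^2 / 2)^3))" and nz: "z$1 * z$3 - (z$2)^2 / 2 \<noteq> 0"
    by (auto simp: branch_simps)
  have "(f has_derivative (\<lambda>v. (z$0 * (z$3)^2 - z$1 * z$2 * z$3 + (z$2)^3 / 3) / ((z$1 * z$3 - (z$2)^2 / 2)^4) * dot (form7 z) v)) (at z)"
    unfolding f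
    by (rule square_by_cube_derivative, (rule rational_derivative nz power_not_zero numeral_neq_zero)+)
       (use nz in \<open>simp_all add: form7_def dot4 power_numeral_expand algebra_simps\<close>)
  then show "\<exists>c. (f has_derivative (\<lambda>v. c * dot (form7 z) v)) (at z) \<and> (f z \<noteq> 0 \<longrightarrow> c \<noteq> 0)"
    by (intro exI[of _ "(z$0 * (z$3)^2 - z$1 * z$2 * z$3 + (z$2)^3 / 3) / ((z$1 * z$3 - (z$2)^2 / 2)^4)"] conjI impI) (use nz in \<open>auto simp: f\<close>)
next
  let ?z = "vec4 1 2 1 1 :: complex^4"
  show "germ (mf_single (\<lambda>z. (z$0 * (z$3)^2 - z$1 * z$2 * z$3 + (z$2)^3 / 3)^2) \<oslash>
        mf_single (\<lambda>z. (z$1 * z$3 - (z$2)^2 / 2)^3)) ?z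
      (\<lambda>z. ((z$0 * (z$3)^2 - z$1 * z$2 * z$3 + (z$2)^3 / 3)^2) / ((z$1 * z$3 - (z$2)^2 / 2)^3))"
    by (intro germ_divide germ_single continuous_intros) (auto simp: power2_eq_square)
  show "dot (form7 ?z) (vec4 1 0 0 0) \<noteq> 0" by (simp add: form7_def dot4)
qed (simp add: power2_eq_square)

lemma log_mult:
  fixes f g :: "complex^4 \<Rightarrow> complex"
  assumes "(f has_derivative (\<lambda>v. f z * F v)) (at z)" "(g has_derivative (\<lambda>v. g z * G v)) (at z)"
  shows "((\<lambda>z. f z * g z) has_derivative (\<lambda>v. f z * g z * (F v + G v))) (at z)"
  by (rule has_derivative_eq_rhs[OF has_derivative_mult[OF assms]]) (simp add: fun_eq_iff algebra_simps)

lemma log_divide: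
  fixes f g :: "complex^4 \<Rightarrow> complex"
  assumes "(f has_derivative (\<lambda>v. f z * F v)) (at z)" "(g has_derivative (\<lambda>v. g z * G v)) (at z)" "g z \<noteq> 0"
  shows "((\<lambda>z. f z / g z) has_derivative (\<lambda>v. f z / g z * (F v - G v))) (at z)"
  by (rule has_derivative_eq_rhs[OF has_derivative_divide'[OF assms]])
     (use assms(3) in \<open>simp add: fun_eq_iff right_diff_distrib diff_divide_distrib\<close>)

lemma factor_mult:
  fixes p g :: "complex^4 \<Rightarrow> complex"
  assumes "(p has_derivative p') (at z)" "(g has_derivative (\<lambda>v. g z * G v)) (at z)"
  shows "((\<lambda>z. p z * g z) has_derivative (\<lambda>v. g z * (p' v + p z * G v))) (at z)"
  by (rule has_derivative_eq_rhs[OF has_derivative_mult[OF assms]]) (simp add: fun_eq_iff algebra_simps)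

lemmas polynomial_derivative = has_derivative_nth has_derivative_diff has_derivative_mult has_derivative_power

lemma coordinate_regular:
  "\<exists>p'. ((\<lambda>z::complex^4. z $ i) has_derivative p') (at w) \<and> (\<forall>c v. p' (c *s v) = c * p' v)"
  using has_derivative_nth by (intro exI[of _ "\<lambda>v. v $ i"]) auto

lemma quadric_regular:
  "\<exists>p'. ((\<lambda>z::complex^4. z $ i * z $ j - z $ k * z $ l) has_derivative p') (at w) \<and>
    (\<forall>c v. p' (c *s v) = c * p' v)"
  by (rule exI, rule conjI, (rule polynomial_derivative)+) (simp add: algebra_simps)

lemma branch_coefficientI:
  "(f has_derivative (\<lambda>v. c * dot \<theta> v)) (at z) \<Longrightarrow> (f z \<noteq> 0 \<Longrightarrow> c \<noteq> 0) \<Longrightarrow>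
    \<exists>c. (f has_derivative (\<lambda>v. c * dot \<theta> v)) (at z) \<and> (f z \<noteq> 0 \<longrightarrow> c \<noteq> 0)"
  by blast

lemma germ_divide_nonzero:
  assumes "germ F z f" "germ G z g" "\<And>w. g w \<noteq> 0"
  shows "germ (F \<oslash> G) z (\<lambda>z. f z / g z)"
proof -
  obtain U V where "open U" "z \<in> U" "\<And>W. W \<subseteq> U \<Longrightarrow> f \<in> F W" "open V" "z \<in> V" "\<And>W. W \<subseteq> V \<Longrightarrow> g \<in> G W"
    using assms unfolding germ_def by metis
  then show ?thesis
    using assms(3) unfolding germ_def mf_divide_def by (intro exI[of _ "U \<inter> V"]) blast
qed

lemma first_integral_form1:
  assumes "tangential (form1 a0 a1 a2 a3) A" and a: "a0 \<noteq> 0 \<or> a1 \<noteq> 0 \<or> a2 \<noteq> 0 \<or> a3 \<noteq> 0"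
  shows "first_integral A
    (mf_power (\<lambda>z. z$0) a0 \<odot> mf_power (\<lambda>z. z$1) a1 \<odot> mf_power (\<lambda>z. z$2) a2 \<odot> mf_power (\<lambda>z. z$3) a3)"
proof (rule first_integralI[OF assms(1)])
  fix V :: "(complex^4) set" and f z
  assume V: "open V" "z \<in> V" and "f \<in> (mf_power (\<lambda>z. z$0) a0 \<odot> mf_power (\<lambda>z. z$1) a1 \<odot>
    mf_power (\<lambda>z. z$2) a2 \<odot> mf_power (\<lambda>z. z$3) a3) V"
  then obtain f0 f1 f2 f3 where f: "f = (\<lambda>z. f0 z * f1 z * f2 z * f3 z)"
    and b: "f0 \<in> mf_power (\<lambda>z. z$0) a0 V" "f1 \<in> mf_power (\<lambda>z. z$1) a1 V"
      "f2 \<in> mf_power (\<lambda>z. z$2) a2 V" "f3 \<in> mf_power (\<lambda>z. z$3) a3 V"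
    by (auto simp: mf_times_def)
  note d = b[THEN power_branch_derivative[OF V(1) _ V(2) has_derivative_nth]]
  have nz: "z$0 \<noteq> 0" "z$1 \<noteq> 0" "z$2 \<noteq> 0" "z$3 \<noteq> 0" and f0: "f z \<noteq> 0" using d by (auto simp: f)
  have "(f has_derivative (\<lambda>v. f z * (a0 * (v$0 / z$0) + a1 * (v$1 / z$1) + a2 * (v$2 / z$2) + a3 * (v$3 / z$3)))) (at z)"
    unfolding f by (intro log_mult) (use d in auto)
  moreover have "a0 * (v$0 / z$0) + a1 * (v$1 / z$1) + a2 * (v$2 / z$2) + a3 * (v$3 / z$3)
      = 1 / (z$0 * z$1 * z$2 * z$3) * dot (form1 a0 a1 a2 a3 z) v" for v
    using nz by (simp add: form1_def dot4 add_divide_distrib)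
  ultimately have "(f has_derivative (\<lambda>v. f z * (1 / (z$0 * z$1 * z$2 * z$3)) * dot (form1 a0 a1 a2 a3 z) v)) (at z)"
    by (simp add: mult.assoc)
  then show "\<exists>c. (f has_derivative (\<lambda>v. c * dot (form1 a0 a1 a2 a3 z) v)) (at z) \<and> (f z \<noteq> 0 \<longrightarrow> c \<noteq> 0)"
    by (rule branch_coefficientI) (use nz f0 in auto)
next
  show "germ (mf_power (\<lambda>z. z$0) a0 \<odot> mf_power (\<lambda>z. z$1) a1 \<odot> mf_power (\<lambda>z. z$2) a2 \<odot> mf_power (\<lambda>z. z$3) a3)
    (vec4 1 1 1 1) (\<lambda>w. exp (a0 * Ln (w$0)) * exp (a1 * Ln (w$1)) * exp (a2 * Ln (w$2)) * exp (a3 * Ln (w$3)))"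
    by (intro germ_times germ_power coordinate_regular) auto
  show "dot (form1 a0 a1 a2 a3 (vec4 1 1 1 1)) (if a0 \<noteq> 0 then vec4 1 0 0 0 else if a1 \<noteq> 0 then vec4 0 1 0 0
      else if a2 \<noteq> 0 then vec4 0 0 1 0 else vec4 0 0 0 1) \<noteq> 0"
    using a by (auto simp: form1_def dot4)
qed auto

lemma first_integral_form5:
  assumes "tangential (form5 \<kappa>) A"
  shows "first_integral A
    ((mf_single (\<lambda>z. z$1) \<odot> mf_power (\<lambda>z. z$3) (\<kappa> - 1)) \<oslash> mf_power (\<lambda>z. z$0) \<kappa> \<odot>
        mf_exp (mf_single (\<lambda>z. z$2) \<oslash> mf_single (\<lambda>z. z$3)))"
proof (rule first_integralI[OF assms(1)])
  fix V :: "(complex^4) set" and f z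
  assume V: "open V" "z \<in> V" and "f \<in> ((mf_single (\<lambda>z. z$1) \<odot> mf_power (\<lambda>z. z$3) (\<kappa> - 1)) \<oslash> mf_power (\<lambda>z. z$0) \<kappa> \<odot>
        mf_exp (mf_single (\<lambda>z. z$2) \<oslash> mf_single (\<lambda>z. z$3))) V"
  then obtain g h where f': "f = (\<lambda>z. z$1 * g z / h z * exp (z$2 / z$3))"
    and b: "g \<in> mf_power (\<lambda>z. z$3) (\<kappa> - 1) V" "h \<in> mf_power (\<lambda>z. z$0) \<kappa> V"
    by (auto simp: branch_simps)
  have f: "f = (\<lambda>z. z$1 * (g z / h z * exp (z$2 / z$3)))"
    unfolding f' by (simp add: mult.assoc)
  note d = b[THEN power_branch_derivative[OF V(1) _ V(2) has_derivative_nth]]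
  have nz: "z$0 \<noteq> 0" "z$3 \<noteq> 0" and gh: "g z \<noteq> 0" "h z \<noteq> 0" using d by auto
  let ?E = "g z / h z * exp (z$2 / z$3)"
  have "(f has_derivative (\<lambda>v. ?E * (v$1 + z$1 * ((\<kappa> - 1) * (v$3 / z$3) - \<kappa> * (v$0 / z$0)
      + (v$2 * z$3 - z$2 * v$3) / (z$3 * z$3))))) (at z)"
    unfolding f
    by (intro factor_mult log_mult log_divide has_derivative_nth exp_derivative has_derivative_divide')
       (use d nz in auto)
  moreover have "v$1 + z$1 * ((\<kappa> - 1) * (v$3 / z$3) - \<kappa> * (v$0 / z$0) + (v$2 * z$3 - z$2 * v$3) / (z$3 * z$3))
      = 1 / (z$0 * z$3 * z$3) * dot (form5 \<kappa> z) v" for v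
    using nz by (simp add: form5_def dot4 add_divide_distrib diff_divide_distrib distrib_left right_diff_distrib
      left_diff_distrib mult_ac)
  ultimately have "(f has_derivative (\<lambda>v. ?E * (1 / (z$0 * z$3 * z$3)) * dot (form5 \<kappa> z) v)) (at z)"
    by (simp only: mult.assoc)
  then show "\<exists>c. (f has_derivative (\<lambda>v. c * dot (form5 \<kappa> z) v)) (at z) \<and> (f z \<noteq> 0 \<longrightarrow> c \<noteq> 0)"
    by (rule branch_coefficientI) (use nz gh f in auto)
next
  show "germ ((mf_single (\<lambda>z. z$1) \<odot> mf_power (\<lambda>z. z$3) (\<kappa> - 1)) \<oslash> mf_power (\<lambda>z. z$0) \<kappa> \<odot>
        mf_exp (mf_single (\<lambda>z. z$2) \<oslash> mf_single (\<lambda>z. z$3)))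
    (vec4 1 1 1 1) (\<lambda>w. w$1 * exp ((\<kappa> - 1) * Ln (w$3)) / exp (\<kappa> * Ln (w$0)) * exp (w$2 / w$3))"
    by (rule germ_times[OF germ_divide_nonzero germ_exp[OF germ_divide]])
       (auto intro!: germ_times germ_single germ_power coordinate_regular continuous_intros)
  show "dot (form5 \<kappa> (vec4 1 1 1 1)) (vec4 0 1 0 0) \<noteq> 0"
    by (simp add: form5_def dot4)
qed auto

lemma first_integral_form8:
  assumes "tangential (form8 \<kappa>) A"
  shows "first_integral A
    ((mf_single (\<lambda>z. (z$0)^2) \<odot> mf_power (\<lambda>z. z$3) (2 * (\<kappa> - 1))) \<oslash>
        mf_power (\<lambda>z. z$1 * z$3 - (z$2)^2) \<kappa>)"
proof (rule first_integralI[OF assms(1)])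
  fix V :: "(complex^4) set" and f z
  assume V: "open V" "z \<in> V" and "f \<in> ((mf_single (\<lambda>z. (z$0)^2) \<odot> mf_power (\<lambda>z. z$3) (2 * (\<kappa> - 1))) \<oslash>
        mf_power (\<lambda>z. z$1 * z$3 - (z$2)^2) \<kappa>) V"
  then obtain g h where f: "f = (\<lambda>z. z$0 * z$0 * (g z / h z))"
    and b: "g \<in> mf_power (\<lambda>z. z$3) (2 * (\<kappa> - 1)) V" "h \<in> mf_power (\<lambda>z. z$1 * z$3 - z$2 * z$2) \<kappa> V"
    by (auto simp: branch_simps power2_eq_square)
  note dg = power_branch_derivative[OF V(1) b(1) V(2) has_derivative_nth]
    and dh = power_branch_derivative[OF V(1) b(2) V(2) has_derivative_diff[OF
      has_derivative_mult[OF has_derivative_nth has_derivative_nth]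
      has_derivative_mult[OF has_derivative_nth has_derivative_nth]]]
  define Q where "Q = z$1 * z$3 - z$2 * z$2"
  have nz: "z$3 \<noteq> 0" "Q \<noteq> 0" and gh: "g z \<noteq> 0" "h z \<noteq> 0" using dg dh by (auto simp: Q_def)
  let ?E = "g z / h z" and ?Q' = "\<lambda>v. z$1 * v$3 + v$1 * z$3 - (z$2 * v$2 + v$2 * z$2)"
  have "(f has_derivative (\<lambda>v. ?E * (z$0 * v$0 + v$0 * z$0 + z$0 * z$0 * (2 * (\<kappa> - 1) * (v$3 / z$3) - \<kappa> * (?Q' v / Q))))) (at z)"
    unfolding f Q_def
    by (intro factor_mult log_divide has_derivative_mult has_derivative_nth) (use dg dh in auto)
  moreover have "z$0 * v$0 + v$0 * z$0 + z$0 * z$0 * (2 * (\<kappa> - 1) * (v$3 / z$3) - \<kappa> * (?Q' v / Q))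
      = z$0 / (z$3 * Q) * dot (form8 \<kappa> z) v" for v
  proof -
    have "dot (form8 \<kappa> z) v = 2 * z$3 * Q * v$0 + 2 * (\<kappa> - 1) * z$0 * Q * v$3 - \<kappa> * z$0 * z$3 * ?Q' v"
      by (simp add: form8_def dot4 Q_def algebra_simps)
    then show ?thesis
      using nz by (simp add: add_divide_distrib diff_divide_distrib distrib_left right_diff_distrib mult_ac)
  qed
  ultimately have "(f has_derivative (\<lambda>v. ?E * (z$0 / (z$3 * Q)) * dot (form8 \<kappa> z) v)) (at z)"
    by (simp only: mult.assoc)
  then show "\<exists>c. (f has_derivative (\<lambda>v. c * dot (form8 \<kappa> z) v)) (at z) \<and> (f z \<noteq> 0 \<longrightarrow> c \<noteq> 0)"
    by (rule branch_coefficientI) (use nz gh f in auto)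
next
  show "germ ((mf_single (\<lambda>z. (z$0)^2) \<odot> mf_power (\<lambda>z. z$3) (2 * (\<kappa> - 1))) \<oslash>
        mf_power (\<lambda>z. z$1 * z$3 - (z$2)^2) \<kappa>)
    (vec4 1 2 1 1) (\<lambda>w. (w$0)^2 * exp (2 * (\<kappa> - 1) * Ln (w$3)) / exp (\<kappa> * Ln (w$1 * w$3 - w$2 * w$2)))"
    unfolding power2_eq_square
    by (intro germ_times germ_divide_nonzero germ_single germ_power coordinate_regular quadric_regular) auto
  show "dot (form8 \<kappa> (vec4 1 2 1 1)) (vec4 1 0 0 0) \<noteq> 0"
    by (simp add: form8_def dot4)
qed auto

lemma first_integral_form12:
  assumes "tangential (form12 \<kappa>) A"
  shows "first_integral A
    (mf_power (\<lambda>z. z$0 * z$3 - z$1 * z$2) \<kappa> \<oslash>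
        (mf_power (\<lambda>z. z$2) (\<kappa> + 1) \<odot> mf_power (\<lambda>z. z$3) (\<kappa> - 1)))"
proof (rule first_integralI[OF assms(1)])
  fix V :: "(complex^4) set" and f z
  assume V: "open V" "z \<in> V" and "f \<in> (mf_power (\<lambda>z. z$0 * z$3 - z$1 * z$2) \<kappa> \<oslash>
        (mf_power (\<lambda>z. z$2) (\<kappa> + 1) \<odot> mf_power (\<lambda>z. z$3) (\<kappa> - 1))) V"
  then obtain g h k where f: "f = (\<lambda>z. h z / (g z * k z))"
    and b: "g \<in> mf_power (\<lambda>z. z$2) (\<kappa> + 1) V" "k \<in> mf_power (\<lambda>z. z$3) (\<kappa> - 1) V"
      "h \<in> mf_power (\<lambda>z. z$0 * z$3 - z$1 * z$2) \<kappa> V"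
    by (auto simp: branch_simps)
  note dg = b(1,2)[THEN power_branch_derivative[OF V(1) _ V(2) has_derivative_nth]]
    and dh = power_branch_derivative[OF V(1) b(3) V(2) has_derivative_diff[OF
      has_derivative_mult[OF has_derivative_nth has_derivative_nth]
      has_derivative_mult[OF has_derivative_nth has_derivative_nth]]]
  define Q where "Q = z$0 * z$3 - z$1 * z$2"
  have nz: "z$2 \<noteq> 0" "z$3 \<noteq> 0" "Q \<noteq> 0" and gh: "g z \<noteq> 0" "h z \<noteq> 0" "k z \<noteq> 0" using dg dh by (auto simp: Q_def)
  let ?Q' = "\<lambda>v. z$0 * v$3 + v$0 * z$3 - (z$1 * v$2 + v$1 * z$2)"
  have "(f has_derivative (\<lambda>v. f z * (\<kappa> * (?Q' v / Q) - ((\<kappa> + 1) * (v$2 / z$2) + (\<kappa> - 1) * (v$3 / z$3))))) (at z)"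
    unfolding f Q_def
    by (intro log_mult log_divide) (use dg dh in auto)
  moreover have "\<kappa> * (?Q' v / Q) - ((\<kappa> + 1) * (v$2 / z$2) + (\<kappa> - 1) * (v$3 / z$3))
      = 1 / (Q * z$2 * z$3) * dot (form12 \<kappa> z) v" for v
  proof -
    have "dot (form12 \<kappa> z) v = \<kappa> * z$2 * z$3 * ?Q' v - (\<kappa> + 1) * Q * z$3 * v$2 - (\<kappa> - 1) * Q * z$2 * v$3"
      by (simp add: form12_def dot4 Q_def algebra_simps)
    then show ?thesis
      using nz by (simp add: add_divide_distrib diff_divide_distrib distrib_left right_diff_distrib)
  qed
  ultimately have "(f has_derivative (\<lambda>v. f z * (1 / (Q * z$2 * z$3)) * dot (form12 \<kappa> z) v)) (at z)"
    by (simp only: mult.assoc)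
  then show "\<exists>c. (f has_derivative (\<lambda>v. c * dot (form12 \<kappa> z) v)) (at z) \<and> (f z \<noteq> 0 \<longrightarrow> c \<noteq> 0)"
    by (rule branch_coefficientI) (use nz gh f in auto)
next
  show "germ (mf_power (\<lambda>z. z$0 * z$3 - z$1 * z$2) \<kappa> \<oslash>
        (mf_power (\<lambda>z. z$2) (\<kappa> + 1) \<odot> mf_power (\<lambda>z. z$3) (\<kappa> - 1)))
    (vec4 3 1 1 1) (\<lambda>w. exp (\<kappa> * Ln (w$0 * w$3 - w$1 * w$2)) / (exp ((\<kappa> + 1) * Ln (w$2)) * exp ((\<kappa> - 1) * Ln (w$3))))"
    by (intro germ_times germ_divide_nonzero germ_single germ_power coordinate_regular quadric_regular) auto
  show "dot (form12 \<kappa> (vec4 3 1 1 1)) (if \<kappa> = 0 then vec4 0 0 1 0 else vec4 1 0 0 0) \<noteq> 0"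
    by (simp add: form12_def dot4)
qed auto

section \<open>Linear algebra in dimension four\<close>

definition basis4 :: "complex^4 \<Rightarrow> complex^4 \<Rightarrow> complex^4 \<Rightarrow> complex^4 \<Rightarrow> bool" where
  "basis4 b0 b1 b2 b3 \<longleftrightarrow> (\<forall>x0 x1 x2 x3. x0 *s b0 + x1 *s b1 + x2 *s b2 + x3 *s b3 = 0 \<longrightarrow>
     x0 = 0 \<and> x1 = 0 \<and> x2 = 0 \<and> x3 = 0)"

definition cols :: "complex^4 \<Rightarrow> complex^4 \<Rightarrow> complex^4 \<Rightarrow> complex^4 \<Rightarrow> complex^4^4" where
  "cols b0 b1 b2 b3 = (\<chi> i. vec4 (b0$i) (b1$i) (b2$i) (b3$i))"

lemma cols_mult: "cols b0 b1 b2 b3 *v x = x$0 *s b0 + x$1 *s b1 + x$2 *s b2 + x$3 *s b3"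
  unfolding vec_eq_iff
  by (intro allI) (simp add: matrix_vector_mult_def cols_def sum4 mult.commute[of "x $ _"])

lemma invertible_cols:
  assumes "basis4 b0 b1 b2 b3" shows "invertible (cols b0 b1 b2 b3)"
proof -
  have "x = 0" if "cols b0 b1 b2 b3 *v x = 0" for x
  proof -
    have "x$0 = 0 \<and> x$1 = 0 \<and> x$2 = 0 \<and> x$3 = 0"
      using assms that unfolding basis4_def cols_mult by blast
    then show ?thesis by (simp add: vec4_eq_iff)
  qed
  then have "\<exists>B. B ** cols b0 b1 b2 b3 = mat 1"
    unfolding matrix_left_invertible_ker by blast
  then show ?thesis using invertible_left_inverse by blast
qed

lemma invertible_inverse:
  assumes "invertible (g :: complex^4^4)"
  shows "\<exists>h. (\<forall>x. g *v (h *v x) = x) \<and> (\<forall>x. h *v (g *v x) = x)"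
proof -
  obtain h where "g ** h = mat 1" "h ** g = mat 1" using assms unfolding invertible_def by blast
  then show ?thesis by (intro exI[of _ h]) (simp add: matrix_vector_mul_assoc)
qed

lemma cols_inject:
  assumes "basis4 b0 b1 b2 b3" and "cols b0 b1 b2 b3 *v x = cols b0 b1 b2 b3 *v y"
  shows "x = y"
proof -
  obtain h where h: "(\<forall>x. cols b0 b1 b2 b3 *v (h *v x) = x) \<and> (\<forall>x. h *v (cols b0 b1 b2 b3 *v x) = x)"
    using invertible_inverse[OF invertible_cols[OF assms(1)]] by (elim exE)
  show ?thesis using arg_cong[OF assms(2), of "(*v) h"] h by simp
qed

lemma basis4_expand:
  assumes "basis4 b0 b1 b2 b3"
  obtains x0 x1 x2 x3 where "v = x0 *s b0 + x1 *s b1 + x2 *s b2 + x3 *s b3"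
proof -
  obtain h where "(\<forall>x. cols b0 b1 b2 b3 *v (h *v x) = x) \<and> (\<forall>x. h *v (cols b0 b1 b2 b3 *v x) = x)"
    using invertible_inverse[OF invertible_cols[OF assms]] by (elim exE)
  then have h: "\<And>x. cols b0 b1 b2 b3 *v (h *v x) = x" "\<And>x. h *v (cols b0 b1 b2 b3 *v x) = x" by simp_all
  from h(1)[of v] have "v = (h *v v)$0 *s b0 + (h *v v)$1 *s b1 + (h *v v)$2 *s b2 + (h *v v)$3 *s b3"
    unfolding cols_mult by simp
  then show ?thesis by (rule that)
qed

lemma dot_transpose: "dot l (M *v z) = dot (transpose M *v l) z"
  by (simp add: dot4 matrix_vector_mult_def transpose_def sum4 algebra_simps
      del: transpose_matrix_vector)

lemma dot_eq_zeroD: "(\<And>z. dot l z = 0) \<Longrightarrow> l = 0"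
  using dot4[of l "vec4 1 0 0 0"] dot4[of l "vec4 0 1 0 0"] dot4[of l "vec4 0 0 1 0"] dot4[of l "vec4 0 0 0 1"]
  by (simp add: vec4_eq_iff)

text \<open>The codimension of the singular set enters the classification only in this form.\<close>

definition indep3 :: "complex^4 \<Rightarrow> complex^4 \<Rightarrow> complex^4 \<Rightarrow> bool" where
  "indep3 u v w \<longleftrightarrow> (\<forall>a b c. a *s u + b *s v + c *s w = 0 \<longrightarrow> a = 0 \<and> b = 0 \<and> c = 0)"

definition nondeg :: "complex^4^4 \<Rightarrow> complex^4^4 \<Rightarrow> bool" where
  "nondeg M N \<longleftrightarrow> (\<forall>l. l \<noteq> 0 \<longrightarrow> (\<exists>z. dot l z = 0 \<and> indep3 z (M *v z) (N *v z)))"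

lemma sat_lin_nondeg: "sat_lin M N \<Longrightarrow> nondeg M N"
  unfolding sat_lin_def nondeg_def indep3_def using cross4_dependent by metis

definition listed_form :: "(complex^4 \<Rightarrow> complex^4) \<Rightarrow> bool" where
  "listed_form \<Theta> \<longleftrightarrow>
     (\<exists>a0 a1 a2 a3. \<Theta> = form1 a0 a1 a2 a3 \<and> a0 + a1 + a2 + a3 = 0 \<and> (a0 \<noteq> 0 \<or> a1 \<noteq> 0 \<or> a2 \<noteq> 0 \<or> a3 \<noteq> 0)) \<or>
     (\<exists>\<kappa>. \<Theta> \<in> {form2, form3, form4, form5 \<kappa>, form6, form7, form8 \<kappa>, form9, form10, form11, form12 \<kappa>, form13})"

lemma listed_form_euler:
  assumes "listed_form \<Theta>" shows "dot (\<Theta> w) w = 0"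
proof -
  consider (logarithmic) a0 a1 a2 a3 where "\<Theta> = form1 a0 a1 a2 a3" "a0 + a1 + a2 + a3 = 0"
    | (other) \<kappa> where
      "\<Theta> \<in> {form2, form3, form4, form5 \<kappa>, form6, form7, form8 \<kappa>, form9, form10, form11, form12 \<kappa>, form13}"
    using assms unfolding listed_form_def by blast
  then show ?thesis
  proof cases
    case logarithmic
    moreover have "dot (form1 a0 a1 a2 a3 w) w = (a0 + a1 + a2 + a3) * (w$0 * w$1 * w$2 * w$3)"
      by (simp add: form1_def dot4 algebra_simps)
    ultimately show ?thesis by simp
  next
    case other
    then show ?thesis
      by (elim insertE emptyE; simp add: form_defs dot4; simp add: algebra_simps)
  qed
qed

text \<open>The linear field \<open>T\<close>, expressed in the coordinates \<open>g\<close>, is tangent to \<open>\<Theta>\<close>. The condition on \<open>u\<close> stands for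
  \<open>u = g\<^sup>-\<^sup>1 T g w\<close>.\<close>

definition kills :: "complex^4^4 \<Rightarrow> (complex^4 \<Rightarrow> complex^4) \<Rightarrow> complex^4^4 \<Rightarrow> bool" where
  "kills g \<Theta> T \<longleftrightarrow> (\<forall>w u. g *v u = T *v (g *v w) \<longrightarrow> dot (\<Theta> w) u = 0)"

definition has_listed_form :: "complex^4^4 \<Rightarrow> complex^4^4 \<Rightarrow> bool" where
  "has_listed_form M N \<longleftrightarrow> (\<exists>g \<Theta>. invertible g \<and> listed_form \<Theta> \<and> kills g \<Theta> M \<and> kills g \<Theta> N)"

text \<open>The scalar term is harmless because the listed forms vanish on the radial field.\<close>

definition lc :: "complex \<Rightarrow> complex \<Rightarrow> complex \<Rightarrow> complex^4^4 \<Rightarrow> complex^4^4 \<Rightarrow> complex^4^4" where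
  "lc a b c M N = mat a + (\<chi> i. b *s M $ i) + (\<chi> i. c *s N $ i)"

lemma lc_mult: "lc a b c M N *v z = a *s z + b *s (M *v z) + c *s (N *v z)"
proof -
  have "mat a *v z = a *s z"
    by (simp add: vec_eq_iff matrix_vector_mult_def mat_def if_distrib[of "\<lambda>x. x * _"] cong: if_cong)
  moreover have "(\<chi> i. k *s S $ i) *v z = k *s (S *v z)" for k and S :: "complex^4^4"
    by (simp add: vec_eq_iff matrix_vector_mult_def sum_distrib_left mult.assoc)
  ultimately show ?thesis
    by (simp add: lc_def matrix_vector_mult_add_rdistrib)
qed

lemma matrix_eqI: "(\<And>z. M *v z = (N :: complex^4^4) *v z) \<Longrightarrow> M = N"
  using matrix_eq by blast

lemma mv_linear:
  "(M::complex^4^4) *v (u + v) = M *v u + M *v v" "M *v (k *s u) = k *s (M *v u)" "M *v (u - v) = M *v u - M *v v"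
  "M *v 0 = 0" "M *v (- u) = - (M *v u)"
  by (simp_all add: matrix_vector_right_distrib vector_scalar_commute matrix_vector_mult_diff_distrib)
    (simp add: vec_eq_iff matrix_vector_mult_def sum_negf)

text \<open>Other generators of the same Lie algebra modulo scalars.\<close>

lemma nondeg_change:
  assumes "nondeg M N" "b * c' - b' * c \<noteq> 0"
  shows "nondeg (lc a b c M N) (lc a' b' c' M N)"
  unfolding nondeg_def
proof (intro allI impI)
  fix l :: "complex^4" assume "l \<noteq> 0"
  then obtain z where z: "dot l z = 0" "indep3 z (M *v z) (N *v z)"
    using assms(1) unfolding nondeg_def by blast
  have "x = 0 \<and> y = 0 \<and> w = 0"
    if "x *s z + y *s (lc a b c M N *v z) + w *s (lc a' b' c' M N *v z) = 0" for x y w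
  proof -
    have "(x + y * a + w * a') *s z + (y * b + w * b') *s (M *v z) + (y * c + w * c') *s (N *v z) = 0"
      using that unfolding lc_mult by (simp add: vec_eq_iff algebra_simps)
    then have e: "x + y * a + w * a' = 0" "y * b + w * b' = 0" "y * c + w * c' = 0"
      using z(2) unfolding indep3_def by blast+
    have "(b * c' - b' * c) * y = 0" "(b * c' - b' * c) * w = 0"
      using e(2,3) by algebra+
    then have "y = 0" "w = 0" using assms(2) by simp_all
    then show ?thesis using e(1) by simp
  qed
  then show "\<exists>z. dot l z = 0 \<and> indep3 z (lc a b c M N *v z) (lc a' b' c' M N *v z)"
    using z(1) unfolding indep3_def by blast
qed

lemma kills_lc:
  assumes g: "invertible g" and \<Theta>: "listed_form \<Theta>" and "kills g \<Theta> M" "kills g \<Theta> N"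
    "\<And>z. T *v z = a *s z + b *s (M *v z) + c *s (N *v z)"
  shows "kills g \<Theta> T"
  unfolding kills_def
proof (intro allI impI)
  fix w u assume u: "g *v u = T *v (g *v w)"
  obtain h where "(\<forall>x. g *v (h *v x) = x) \<and> (\<forall>x. h *v (g *v x) = x)"
    using invertible_inverse[OF g] by (elim exE)
  then have h: "\<And>x. g *v (h *v x) = x" "\<And>x. h *v (g *v x) = x" by simp_all
  let ?m = "h *v (M *v (g *v w))" and ?n = "h *v (N *v (g *v w))"
  have "g *v u = g *v (a *s w + b *s ?m + c *s ?n)"
    unfolding u assms(5) by (simp add: mv_linear h)
  then have "h *v (g *v u) = h *v (g *v (a *s w + b *s ?m + c *s ?n))" by (rule arg_cong)
  then have "u = a *s w + b *s ?m + c *s ?n" unfolding h(2) .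
  moreover have "dot (\<Theta> w) ?m = 0" "dot (\<Theta> w) ?n = 0"
    using assms(3,4) h(1) unfolding kills_def by blast+
  ultimately show "dot (\<Theta> w) u = 0"
    using listed_form_euler[OF \<Theta>, of w] by (simp add: dot_add dot_smult)
qed

lemma has_listed_form_change:
  assumes "has_listed_form (lc a b c M N) (lc a' b' c' M N)" and d: "b * c' - b' * c \<noteq> 0"
  shows "has_listed_form M N"
proof -
  define d where "d = b * c' - b' * c"
  let ?M = "lc a b c M N" and ?N = "lc a' b' c' M N"
  obtain g \<Theta> where g: "invertible g" "listed_form \<Theta>" "kills g \<Theta> ?M" "kills g \<Theta> ?N"
    using assms(1) unfolding has_listed_form_def by blast
  have d0: "d \<noteq> 0" using d by (simp add: d_def)
  have cancel: "u = (x / d) *s z + (y / d) *s v + (w / d) *s v'"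
    if "d *s u = x *s z + y *s v + w *s v'" for u v v' z :: "complex^4" and x y w
  proof -
    have "d * u $ i = x * z $ i + y * v $ i + w * v' $ i" for i
      using arg_cong[OF that, of "\<lambda>t. t $ i"] by simp
    then have "u $ i = (x * z $ i + y * v $ i + w * v' $ i) / d" for i
      using d0 by (metis nonzero_mult_div_cancel_left)
    then show ?thesis by (simp add: vec_eq_iff add_divide_distrib)
  qed
  have "M *v z = ((a' * c - a * c') / d) *s z + (c' / d) *s (?M *v z) + (- c / d) *s (?N *v z)" for z
    by (rule cancel) (simp add: d_def lc_mult vec_eq_iff algebra_simps)
  moreover have "N *v z = ((a * b' - a' * b) / d) *s z + (- b' / d) *s (?M *v z) + (b / d) *s (?N *v z)" for z
    by (rule cancel) (simp add: d_def lc_mult vec_eq_iff algebra_simps)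
  ultimately have "kills g \<Theta> M" "kills g \<Theta> N"
    using kills_lc[OF g] by blast+
  then show ?thesis
    unfolding has_listed_form_def using g(1,2) by blast
qed

lemma kills_basis:
  assumes b: "basis4 b0 b1 b2 b3"
    and T: "T *v b0 = cols b0 b1 b2 b3 *v c0" "T *v b1 = cols b0 b1 b2 b3 *v c1"
      "T *v b2 = cols b0 b1 b2 b3 *v c2" "T *v b3 = cols b0 b1 b2 b3 *v c3"
    and \<Theta>: "\<And>w. dot (\<Theta> w) (w$0 *s c0 + w$1 *s c1 + w$2 *s c2 + w$3 *s c3) = 0"
  shows "kills (cols b0 b1 b2 b3) \<Theta> T"
  unfolding kills_def
proof (intro allI impI)
  fix w u assume "cols b0 b1 b2 b3 *v u = T *v (cols b0 b1 b2 b3 *v w)"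
  also have "\<dots> = cols b0 b1 b2 b3 *v (w$0 *s c0 + w$1 *s c1 + w$2 *s c2 + w$3 *s c3)"
    unfolding cols_mult[of _ _ _ _ w] mv_linear T ..
  finally have e: "cols b0 b1 b2 b3 *v u = cols b0 b1 b2 b3 *v (w$0 *s c0 + w$1 *s c1 + w$2 *s c2 + w$3 *s c3)" .
  have "u = w$0 *s c0 + w$1 *s c1 + w$2 *s c2 + w$3 *s c3" by (rule cols_inject[OF b e])
  then show "dot (\<Theta> w) u = 0" using \<Theta>[of w] by simp
qed

text \<open>The form in which \<open>nondeg\<close> excludes pairs: the hyperplane with the coordinate functional \<open>k\<close> consists of points
  where some combination of \<open>M z\<close> and \<open>N z\<close> is a multiple of \<open>z\<close>.\<close>

lemma nondegD:
  assumes nd: "nondeg M N" and b: "basis4 b0 b1 b2 b3" and k: "k \<noteq> 0"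
    and dep: "\<And>x z. dot k x = 0 \<Longrightarrow> z = x$0 *s b0 + x$1 *s b1 + x$2 *s b2 + x$3 *s b3 \<Longrightarrow>
      \<exists>p q r. (q \<noteq> 0 \<or> r \<noteq> 0) \<and> p *s z + q *s (M *v z) + r *s (N *v z) = 0"
  shows False
proof -
  obtain h where "(\<forall>x. cols b0 b1 b2 b3 *v (h *v x) = x) \<and> (\<forall>x. h *v (cols b0 b1 b2 b3 *v x) = x)"
    using invertible_inverse[OF invertible_cols[OF b]] by (elim exE)
  then have h: "\<And>x. cols b0 b1 b2 b3 *v (h *v x) = x" "\<And>x. h *v (cols b0 b1 b2 b3 *v x) = x" by simp_all
  have "transpose h *v k \<noteq> 0"
  proof
    assume "transpose h *v k = 0"
    have "dot k (h *v z) = 0" for z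
      unfolding dot_transpose \<open>transpose h *v k = 0\<close> by (simp add: dot_def)
    from this[of "cols b0 b1 b2 b3 *v z" for z] have "dot k z = 0" for z unfolding h(2) .
    then show False using k dot_eq_zeroD by blast
  qed
  then obtain z where z: "dot (transpose h *v k) z = 0" "indep3 z (M *v z) (N *v z)"
    using nd unfolding nondeg_def by blast
  have "dot k (h *v z) = 0" using z(1) by (simp add: dot_transpose)
  moreover have "z = (h *v z)$0 *s b0 + (h *v z)$1 *s b1 + (h *v z)$2 *s b2 + (h *v z)$3 *s b3"
    using h(1)[of z] unfolding cols_mult by simp
  ultimately obtain p q r where "q \<noteq> 0 \<or> r \<noteq> 0" "p *s z + q *s (M *v z) + r *s (N *v z) = 0"
    using dep by blast
  then show False using z(2) unfolding indep3_def by blast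
qed

section \<open>Normal forms\<close>

lemma cols_vec4: "cols b0 b1 b2 b3 *v vec4 x0 x1 x2 x3 = x0 *s b0 + x1 *s b1 + x2 *s b2 + x3 *s b3"
  by (simp add: cols_mult)

lemma has_listed_formI:
  assumes b: "basis4 b0 b1 b2 b3" and "listed_form \<Theta>"
    and M: "M *v b0 = cols b0 b1 b2 b3 *v c0" "M *v b1 = cols b0 b1 b2 b3 *v c1"
      "M *v b2 = cols b0 b1 b2 b3 *v c2" "M *v b3 = cols b0 b1 b2 b3 *v c3"
    and N: "N *v b0 = cols b0 b1 b2 b3 *v d0" "N *v b1 = cols b0 b1 b2 b3 *v d1"
      "N *v b2 = cols b0 b1 b2 b3 *v d2" "N *v b3 = cols b0 b1 b2 b3 *v d3"
    and \<Theta>: "\<And>w. dot (\<Theta> w) (w$0 *s c0 + w$1 *s c1 + w$2 *s c2 + w$3 *s c3) = 0"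
      "\<And>w. dot (\<Theta> w) (w$0 *s d0 + w$1 *s d1 + w$2 *s d2 + w$3 *s d3) = 0"
  shows "has_listed_form M N"
  unfolding has_listed_form_def
  using invertible_cols[OF b] kills_basis[OF b M \<Theta>(1)] kills_basis[OF b N \<Theta>(2)] assms(2) by blast

lemma listed_forms:
  "listed_form form2" "listed_form form3" "listed_form form4" "listed_form (form5 \<kappa>)"
  "listed_form form6" "listed_form form7" "listed_form (form8 \<kappa>)" "listed_form form9"
  "listed_form form10" "listed_form form11" "listed_form (form12 \<kappa>)" "listed_form form13"
  unfolding listed_form_def by blast+

lemma listed_form1:
  "a0 + a1 + a2 + a3 = 0 \<Longrightarrow> a0 \<noteq> 0 \<or> a1 \<noteq> 0 \<or> a2 \<noteq> 0 \<or> a3 \<noteq> 0 \<Longrightarrow> listed_form (form1 a0 a1 a2 a3)"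
  unfolding listed_form_def by blast

text \<open>The unknowns will be the coefficients of a closed logarithmic form. There is one equation for each of the
  two matrices.\<close>

lemma two_equations:
  fixes p q r p' q' r' :: complex
  shows "\<exists>x y z. (x \<noteq> 0 \<or> y \<noteq> 0 \<or> z \<noteq> 0) \<and> p * x + q * y + r * z = 0 \<and> p' * x + q' * y + r' * z = 0"
proof (cases "q * r' - r * q' = 0 \<and> r * p' - p * r' = 0 \<and> p * q' - q * p' = 0")
  case False
  then show ?thesis
    by (intro exI[of _ "q * r' - r * q'"] exI[of _ "r * p' - p * r'"] exI[of _ "p * q' - q * p'"])
       (auto simp: algebra_simps)
next
  case True
  show ?thesis
  proof (cases "p = 0 \<and> q = 0 \<and> r = 0")
    case True
    show ?thesis
    proof (cases "p' = 0")
      case True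
      then show ?thesis using \<open>p = 0 \<and> q = 0 \<and> r = 0\<close> by (intro exI[of _ 1] exI[of _ 0]) simp
    next
      case False
      then show ?thesis using \<open>p = 0 \<and> q = 0 \<and> r = 0\<close>
        by (intro exI[of _ q'] exI[of _ "- p'"] exI[of _ 0]) simp
    qed
  next
    case pqr: False
    then consider "p \<noteq> 0" | "p = 0" "q \<noteq> 0" | "p = 0" "q = 0" "r \<noteq> 0" by blast
    then show ?thesis
    proof cases
      case 1
      have "p' * q = q' * p" using True by (simp add: mult.commute)
      then show ?thesis using 1
        by (intro exI[of _ q] exI[of _ "- p"] exI[of _ 0]) (simp add: mult.commute)
    next
      case 2
      have "q' * r = r' * q" using True by (simp add: mult.commute)
      then show ?thesis using 2
        by (intro exI[of _ 0] exI[of _ r] exI[of _ "- q"]) (simp add: mult.commute)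
    next
      case 3
      then have "p' = 0" "q' = 0" using True by auto
      then show ?thesis using 3 by (intro exI[of _ 1] exI[of _ 0]) simp
    qed
  qed
qed

lemma nf_diagonal:
  assumes b: "basis4 e0 e1 e2 e3"
    and M: "M *v e0 = t0 *s e0" "M *v e1 = t1 *s e1" "M *v e2 = t2 *s e2" "M *v e3 = t3 *s e3"
    and N: "N *v e0 = n0 *s e0" "N *v e1 = n1 *s e1" "N *v e2 = n2 *s e2" "N *v e3 = n3 *s e3"
  shows "has_listed_form M N"
proof -
  obtain x y z where a: "x \<noteq> 0 \<or> y \<noteq> 0 \<or> z \<noteq> 0"
    "(t1 - t0) * x + (t2 - t0) * y + (t3 - t0) * z = 0" "(n1 - n0) * x + (n2 - n0) * y + (n3 - n0) * z = 0"
    using two_equations[of "t1 - t0" "t2 - t0" "t3 - t0" "n1 - n0" "n2 - n0" "n3 - n0"] by blast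
  have id: "dot (form1 (-(x + y + z)) x y z w) (w$0 *s vec4 s0 0 0 0 + w$1 *s vec4 0 s1 0 0
      + w$2 *s vec4 0 0 s2 0 + w$3 *s vec4 0 0 0 s3)
    = ((s1 - s0) * x + (s2 - s0) * y + (s3 - s0) * z) * (w$0 * w$1 * w$2 * w$3)" for s0 s1 s2 s3 w
    by (simp add: form1_def dot4 algebra_simps)
  show ?thesis
  proof (rule has_listed_formI[OF b])
    show "listed_form (form1 (-(x + y + z)) x y z)" by (rule listed_form1) (use a in auto)
    show "M *v e0 = cols e0 e1 e2 e3 *v vec4 t0 0 0 0" "M *v e1 = cols e0 e1 e2 e3 *v vec4 0 t1 0 0"
      "M *v e2 = cols e0 e1 e2 e3 *v vec4 0 0 t2 0" "M *v e3 = cols e0 e1 e2 e3 *v vec4 0 0 0 t3"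
      by (simp_all add: M cols_vec4)
    show "N *v e0 = cols e0 e1 e2 e3 *v vec4 n0 0 0 0" "N *v e1 = cols e0 e1 e2 e3 *v vec4 0 n1 0 0"
      "N *v e2 = cols e0 e1 e2 e3 *v vec4 0 0 n2 0" "N *v e3 = cols e0 e1 e2 e3 *v vec4 0 0 0 n3"
      by (simp_all add: N cols_vec4)
  qed (simp_all only: id a mult_zero_left)
qed

text \<open>Both matrices preserve the plane spanned by \<open>e0\<close> and \<open>e1\<close> and are scalar modulo it, so the ratio of the other two
  coordinates is a first integral.\<close>

lemma nf_ratio:
  assumes b: "basis4 e0 e1 e2 e3"
    and M: "M *v e0 = (q0) *s e1 + (p0) *s e0" "M *v e1 = (q1) *s e1 + (p1) *s e0" "M *v e2 = (t) *s e2 + (q2) *s e1 + (p2) *s e0" "M *v e3 = (t) *s e3 + (q3) *s e1 + (p3) *s e0"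
    and N: "N *v e0 = (q0') *s e1 + (p0') *s e0" "N *v e1 = (q1') *s e1 + (p1') *s e0" "N *v e2 = (t') *s e2 + (q2') *s e1 + (p2') *s e0" "N *v e3 = (t') *s e3 + (q3') *s e1 + (p3') *s e0"
  shows "has_listed_form M N"
proof (rule has_listed_formI[OF b])
  show "listed_form (form1 0 0 1 (- 1))" by (rule listed_form1) simp_all
  show "M *v e0 = cols e0 e1 e2 e3 *v vec4 (p0) (q0) (0) (0)"
    "M *v e1 = cols e0 e1 e2 e3 *v vec4 (p1) (q1) (0) (0)"
    "M *v e2 = cols e0 e1 e2 e3 *v vec4 (p2) (q2) (t) (0)"
    "M *v e3 = cols e0 e1 e2 e3 *v vec4 (p3) (q3) (0) (t)"
    by (simp_all add: M cols_vec4)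
  show "N *v e0 = cols e0 e1 e2 e3 *v vec4 (p0') (q0') (0) (0)"
    "N *v e1 = cols e0 e1 e2 e3 *v vec4 (p1') (q1') (0) (0)"
    "N *v e2 = cols e0 e1 e2 e3 *v vec4 (p2') (q2') (t') (0)"
    "N *v e3 = cols e0 e1 e2 e3 *v vec4 (p3') (q3') (0) (t')"
    by (simp_all add: N cols_vec4)
qed (simp_all add: form1_def dot4 algebra_simps)

text \<open>The pairs below are obtained by solving for the linear fields that a given form of the list annihilates. Hence the
  verification is an identity of polynomials.\<close>

lemma nf5:
  assumes b: "basis4 e0 e1 e2 e3"
    and M: "M *v e0 = t0 *s e0" "M *v e1 = t1 *s e1"
      "M *v e2 = t3 *s e2" "M *v e3 = t3 *s e3 + (\<kappa> * t0 - t1 - (\<kappa> - 1) * t3) *s e2"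
    and N: "N *v e0 = t0' *s e0" "N *v e1 = t1' *s e1"
      "N *v e2 = t3' *s e2" "N *v e3 = t3' *s e3 + (\<kappa> * t0' - t1' - (\<kappa> - 1) * t3') *s e2"
  shows "has_listed_form M N"
  by (rule has_listed_formI[OF b listed_forms(4)[of \<kappa>], of M "vec4 t0 0 0 0" "vec4 0 t1 0 0"
        "vec4 0 0 t3 0" "vec4 0 0 (\<kappa> * t0 - t1 - (\<kappa> - 1) * t3) t3"
        N "vec4 t0' 0 0 0" "vec4 0 t1' 0 0"
        "vec4 0 0 t3' 0" "vec4 0 0 (\<kappa> * t0' - t1' - (\<kappa> - 1) * t3') t3'"])
     (simp_all add: M N cols_vec4, simp_all add: form5_def dot4 algebra_simps)

lemma nf5_zero:
  assumes b: "basis4 e0 e1 e2 e3"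
    and M: "M *v e0 = p *s e0" "M *v e1 = t *s e1 + r *s e0"
      "M *v e2 = u *s e2 + x *s e0" "M *v e3 = u *s e3 + (u - t) *s e2 + y *s e0"
    and N: "N *v e0 = p' *s e0" "N *v e1 = t' *s e1 + r' *s e0"
      "N *v e2 = u' *s e2 + x' *s e0" "N *v e3 = u' *s e3 + (u' - t') *s e2 + y' *s e0"
  shows "has_listed_form M N"
  by (rule has_listed_formI[OF b listed_forms(4)[of 0], of M "vec4 p 0 0 0" "vec4 r t 0 0"
        "vec4 x 0 u 0" "vec4 y 0 (u - t) u"
        N "vec4 p' 0 0 0" "vec4 r' t' 0 0"
        "vec4 x' 0 u' 0" "vec4 y' 0 (u' - t') u'"])
     (simp_all add: M N cols_vec4, simp_all add: form5_def dot4 algebra_simps)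

lemma nf2:
  assumes b: "basis4 e0 e1 e2 e3"
    and M: "M *v e0 = t1 *s e0" "M *v e1 = t1 *s e1 + s *s e0"
      "M *v e2 = t3 *s e2" "M *v e3 = t3 *s e3 + (- s) *s e2"
    and N: "N *v e0 = t1' *s e0" "N *v e1 = t1' *s e1 + s' *s e0"
      "N *v e2 = t3' *s e2" "N *v e3 = t3' *s e3 + (- s') *s e2"
  shows "has_listed_form M N"
  by (rule has_listed_formI[OF b listed_forms(1), of M "vec4 t1 0 0 0" "vec4 s t1 0 0"
        "vec4 0 0 t3 0" "vec4 0 0 (- s) t3"
        N "vec4 t1' 0 0 0" "vec4 s' t1' 0 0"
        "vec4 0 0 t3' 0" "vec4 0 0 (- s') t3'"])
     (simp_all add: M N cols_vec4, simp_all add: form2_def dot4 algebra_simps)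

lemma nf3:
  assumes b: "basis4 e0 e1 e2 e3"
    and M: "M *v e0 = t1 *s e0" "M *v e1 = t1 *s e1 + s *s e0"
      "M *v e2 = t3 *s e2" "M *v e3 = t3 *s e3 + (t3 - t1 - s) *s e2"
    and N: "N *v e0 = t1' *s e0" "N *v e1 = t1' *s e1 + s' *s e0"
      "N *v e2 = t3' *s e2" "N *v e3 = t3' *s e3 + (t3' - t1' - s') *s e2"
  shows "has_listed_form M N"
  by (rule has_listed_formI[OF b listed_forms(2), of M "vec4 t1 0 0 0" "vec4 s t1 0 0"
        "vec4 0 0 t3 0" "vec4 0 0 (t3 - t1 - s) t3"
        N "vec4 t1' 0 0 0" "vec4 s' t1' 0 0"
        "vec4 0 0 t3' 0" "vec4 0 0 (t3' - t1' - s') t3'"])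
     (simp_all add: M N cols_vec4, simp_all add: form3_def dot4 algebra_simps)

lemma nf4:
  assumes b: "basis4 e0 e1 e2 e3"
    and M: "M *v e0 = t0 *s e0" "M *v e1 = t3 *s e1"
      "M *v e2 = t3 *s e2 + (2 * q) *s e1" "M *v e3 = t3 *s e3 + q *s e2 + (t0 - t3) *s e1"
    and N: "N *v e0 = t0' *s e0" "N *v e1 = t3' *s e1"
      "N *v e2 = t3' *s e2 + (2 * q') *s e1" "N *v e3 = t3' *s e3 + q' *s e2 + (t0' - t3') *s e1"
  shows "has_listed_form M N"
  by (rule has_listed_formI[OF b listed_forms(3), of M "vec4 t0 0 0 0" "vec4 0 t3 0 0"
        "vec4 0 (2 * q) t3 0" "vec4 0 (t0 - t3) q t3"
        N "vec4 t0' 0 0 0" "vec4 0 t3' 0 0"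
        "vec4 0 (2 * q') t3' 0" "vec4 0 (t0' - t3') q' t3'"])
     (simp_all add: M N cols_vec4, simp_all add: form4_def dot4 algebra_simps)

lemma nf6:
  assumes b: "basis4 e0 e1 e2 e3"
    and M: "M *v e0 = t *s e0" "M *v e1 = t *s e1 + (- x) *s e0"
      "M *v e2 = t *s e2 + (- 3 * x) *s e1 + y *s e0" "M *v e3 = t *s e3 + x *s e2 + (- y) *s e1"
    and N: "N *v e0 = t' *s e0" "N *v e1 = t' *s e1 + (- x') *s e0"
      "N *v e2 = t' *s e2 + (- 3 * x') *s e1 + y' *s e0" "N *v e3 = t' *s e3 + x' *s e2 + (- y') *s e1"
  shows "has_listed_form M N"
  by (rule has_listed_formI[OF b listed_forms(5), of M "vec4 t 0 0 0" "vec4 (- x) t 0 0"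
        "vec4 y (- 3 * x) t 0" "vec4 0 (- y) x t"
        N "vec4 t' 0 0 0" "vec4 (- x') t' 0 0"
        "vec4 y' (- 3 * x') t' 0" "vec4 0 (- y') x' t'"])
     (simp_all add: M N cols_vec4, simp_all add: form6_def dot4 algebra_simps)

lemma nf7:
  assumes b: "basis4 e0 e1 e2 e3"
    and M: "M *v e0 = (a + 3) *s e0" "M *v e1 = (a + 2) *s e1"
      "M *v e2 = (a + 1) *s e2" "M *v e3 = a *s e3"
    and N: "N *v e0 = 0" "N *v e1 = e0"
      "N *v e2 = e1" "N *v e3 = e2"
  shows "has_listed_form M N"
  by (rule has_listed_formI[OF b listed_forms(6), of M "vec4 (a + 3) 0 0 0" "vec4 0 (a + 2) 0 0"
        "vec4 0 0 (a + 1) 0" "vec4 0 0 0 a"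
        N "vec4 0 0 0 0" "vec4 1 0 0 0"
        "vec4 0 1 0 0" "vec4 0 0 1 0"])
     (simp_all add: M N cols_vec4, simp_all add: form7_def dot4 algebra_simps)

lemma nf8:
  assumes b: "basis4 e0 e1 e2 e3"
    and M: "M *v e0 = b *s e0" "M *v e1 = (a + 2) *s e1"
      "M *v e2 = (a + 1) *s e2" "M *v e3 = a *s e3"
    and N: "N *v e0 = 0" "N *v e1 = 0"
      "N *v e2 = 2 *s e1" "N *v e3 = e2"
  shows "has_listed_form M N"
  by (rule has_listed_formI[OF b listed_forms(7)[of "b - a"], of M "vec4 b 0 0 0" "vec4 0 (a + 2) 0 0"
        "vec4 0 0 (a + 1) 0" "vec4 0 0 0 a"
        N "vec4 0 0 0 0" "vec4 0 0 0 0"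
        "vec4 0 2 0 0" "vec4 0 0 1 0"])
     (simp_all add: M N cols_vec4, simp_all add: form8_def dot4 algebra_simps)

lemma nf9:
  assumes b: "basis4 e0 e1 e2 e3"
    and M: "M *v e0 = a *s e0" "M *v e1 = (a + 2) *s e1"
      "M *v e2 = (a + 1) *s e2" "M *v e3 = a *s e3 + 2 *s e0"
    and N: "N *v e0 = 0" "N *v e1 = 0"
      "N *v e2 = 2 *s e1" "N *v e3 = e2"
  shows "has_listed_form M N"
  by (rule has_listed_formI[OF b listed_forms(8), of M "vec4 a 0 0 0" "vec4 0 (a + 2) 0 0"
        "vec4 0 0 (a + 1) 0" "vec4 2 0 0 a"
        N "vec4 0 0 0 0" "vec4 0 0 0 0"
        "vec4 0 2 0 0" "vec4 0 0 1 0"])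
     (simp_all add: M N cols_vec4, simp_all add: form9_def dot4 algebra_simps)

lemma nf10:
  assumes b: "basis4 e0 e1 e2 e3"
    and M: "M *v e0 = 2 *s e1 + (a + 2) *s e0" "M *v e1 = (a + 2) *s e1"
      "M *v e2 = (a + 1) *s e2" "M *v e3 = a *s e3"
    and N: "N *v e0 = 0" "N *v e1 = 0"
      "N *v e2 = 2 *s e1" "N *v e3 = e2"
  shows "has_listed_form M N"
  by (rule has_listed_formI[OF b listed_forms(9), of M "vec4 (a + 2) 2 0 0" "vec4 0 (a + 2) 0 0"
        "vec4 0 0 (a + 1) 0" "vec4 0 0 0 a"
        N "vec4 0 0 0 0" "vec4 0 0 0 0"
        "vec4 0 2 0 0" "vec4 0 0 1 0"])
     (simp_all add: M N cols_vec4, simp_all add: form10_def dot4 algebra_simps)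

lemma nf11:
  assumes b: "basis4 e0 e1 e2 e3"
    and M: "M *v e0 = (a + 1) *s e0" "M *v e1 = (a + 2) *s e1"
      "M *v e2 = a *s e2" "M *v e3 = (a + 1) *s e3 + e0"
    and N: "N *v e0 = 0" "N *v e1 = 0"
      "N *v e2 = e0" "N *v e3 = e1"
  shows "has_listed_form M N"
  by (rule has_listed_formI[OF b listed_forms(10), of M "vec4 (a + 1) 0 0 0" "vec4 0 (a + 2) 0 0"
        "vec4 0 0 a 0" "vec4 1 0 0 (a + 1)"
        N "vec4 0 0 0 0" "vec4 0 0 0 0"
        "vec4 1 0 0 0" "vec4 0 1 0 0"])
     (simp_all add: M N cols_vec4, simp_all add: form11_def dot4 algebra_simps)

lemma nf12:
  assumes b: "basis4 e0 e1 e2 e3"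
    and M: "M *v e0 = (a + 1) *s e0" "M *v e1 = (b + 1) *s e1"
      "M *v e2 = a *s e2" "M *v e3 = b *s e3"
    and N: "N *v e0 = 0" "N *v e1 = 0"
      "N *v e2 = e0" "N *v e3 = e1"
  shows "has_listed_form M N"
  by (rule has_listed_formI[OF b listed_forms(11)[of "a - b"], of M "vec4 (a + 1) 0 0 0" "vec4 0 (b + 1) 0 0"
        "vec4 0 0 a 0" "vec4 0 0 0 b"
        N "vec4 0 0 0 0" "vec4 0 0 0 0"
        "vec4 1 0 0 0" "vec4 0 1 0 0"])
     (simp_all add: M N cols_vec4, simp_all add: form12_def dot4 algebra_simps)

lemma nf13:
  assumes b: "basis4 e0 e1 e2 e3"
    and M: "M *v e0 = (a + 1) *s e0" "M *v e1 = (a + 1) *s e1 + e0"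
      "M *v e2 = a *s e2" "M *v e3 = a *s e3 + e2"
    and N: "N *v e0 = 0" "N *v e1 = 0"
      "N *v e2 = e0" "N *v e3 = e1"
  shows "has_listed_form M N"
  by (rule has_listed_formI[OF b listed_forms(12), of M "vec4 (a + 1) 0 0 0" "vec4 1 (a + 1) 0 0"
        "vec4 0 0 a 0" "vec4 0 0 1 a"
        N "vec4 0 0 0 0" "vec4 0 0 0 0"
        "vec4 1 0 0 0" "vec4 0 1 0 0"])
     (simp_all add: M N cols_vec4, simp_all add: form13_def dot4 algebra_simps)

section \<open>Eigenvectors and nilpotency\<close>

text \<open>The vector \<open>p(T) v\<close>.\<close>

definition papp :: "complex poly \<Rightarrow> complex^4^4 \<Rightarrow> complex^4 \<Rightarrow> complex^4" where
  "papp p T v = fold_coeffs (\<lambda>a w. a *s v + T *v w) p 0"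

lemma papp_0 [simp]: "papp 0 T v = 0"
  by (simp add: papp_def)

lemma papp_pCons [simp]: "papp (pCons a p) T v = a *s v + T *v papp p T v"
  by (cases "a = 0 \<and> p = 0") (auto simp: papp_def mv_linear)

lemma papp_add: "papp (p + q) T v = papp p T v + papp q T v"
proof (induction p arbitrary: q)
  case (pCons a p)
  obtain b q' where q: "q = pCons b q'" by (cases q)
  show ?case unfolding q add_pCons papp_pCons pCons.IH mv_linear
    by (simp add: vec_eq_iff algebra_simps)
qed simp

lemma papp_smult: "papp (smult c p) T v = c *s papp p T v"
  by (induction p) (simp_all add: mv_linear vector_add_ldistrib)

lemma papp_mult: "papp (p * q) T v = papp p T (papp q T v)"
  by (induction p) (simp_all add: papp_add papp_smult)

lemma papp_linear: "papp p T (u + v) = papp p T u + papp p T v" "papp p T (c *s u) = c *s papp p T u"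
proof -
  show "papp p T (u + v) = papp p T u + papp p T v"
  proof (induction p)
    case (pCons a p)
    show ?case unfolding papp_pCons pCons.IH mv_linear by (simp add: vec_eq_iff algebra_simps)
  qed simp
  show "papp p T (c *s u) = c *s papp p T u"
  proof (induction p)
    case (pCons a p)
    show ?case unfolding papp_pCons pCons.IH mv_linear by (simp add: vec_eq_iff algebra_simps)
  qed simp
qed

text \<open>Five vectors \<open>v, T v, \<dots>, T\<^sup>4 v\<close> in dimension four are dependent.\<close>

lemma papp_annihilator: "\<exists>p. p \<noteq> 0 \<and> papp p T v = 0"
proof (cases "basis4 v (T *v v) (T *v (T *v v)) (T *v (T *v (T *v v)))")
  case True
  obtain x0 x1 x2 x3 where x: "T *v (T *v (T *v (T *v v))) = x0 *s v + x1 *s (T *v v)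
      + x2 *s (T *v (T *v v)) + x3 *s (T *v (T *v (T *v v)))"
    using basis4_expand[OF True, of "T *v (T *v (T *v (T *v v)))"] .
  have "papp [:- x0, - x1, - x2, - x3, 1:] T v = 0"
    by (simp add: mv_linear x vec_eq_iff)
  then show ?thesis by (intro exI[of _ "[:- x0, - x1, - x2, - x3, 1:]"]) simp
next
  case False
  then obtain x0 x1 x2 x3 where x: "x0 *s v + x1 *s (T *v v) + x2 *s (T *v (T *v v))
      + x3 *s (T *v (T *v (T *v v))) = 0" "\<not> (x0 = 0 \<and> x1 = 0 \<and> x2 = 0 \<and> x3 = 0)"
    unfolding basis4_def by blast
  have "papp [:x0, x1, x2, x3:] T v = 0"
    using x(1) by (simp add: mv_linear add.assoc)
  then show ?thesis using x(2) by (intro exI[of _ "[:x0, x1, x2, x3:]"]) auto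
qed

text \<open>Remove a linear factor from the minimal polynomial that annihilates \<open>v\<close>.\<close>

lemma eigenvector_in_subspace:
  fixes T :: "complex^4^4"
  assumes S: "0 \<in> S" "\<And>u v. u \<in> S \<Longrightarrow> v \<in> S \<Longrightarrow> u + v \<in> S" "\<And>c u. u \<in> S \<Longrightarrow> c *s u \<in> S"
    "\<And>u. u \<in> S \<Longrightarrow> T *v u \<in> S" and v: "v \<in> S" "v \<noteq> 0"
  shows "\<exists>r u. u \<in> S \<and> u \<noteq> 0 \<and> T *v u = r *s u"
proof -
  obtain p0 where p0: "p0 \<noteq> 0 \<and> papp p0 T v = 0" using papp_annihilator by blast
  obtain p where p: "p \<noteq> 0" "papp p T v = 0" and min: "\<And>q. q \<noteq> 0 \<Longrightarrow> papp q T v = 0 \<Longrightarrow> degree p \<le> degree q"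
    using ex_has_least_nat[of "\<lambda>p. p \<noteq> 0 \<and> papp p T v = 0" p0 degree, OF p0] by (elim exE conjE) simp
  have "degree p \<noteq> 0"
  proof
    assume "degree p = 0"
    then obtain c where c: "p = [:c:]" by (metis degree_eq_zeroE)
    then have "c *s v = 0" using p(2) by (simp add: mv_linear)
    then show False using p(1) v(2) c by (auto simp: vec_eq_iff)
  qed
  then obtain r where "poly p r = 0"
    using alg_closed_imp_poly_has_root[of p] by auto
  then obtain q where q: "p = [:- r, 1:] * q" by (auto simp: poly_eq_0_iff_dvd)
  then have "q \<noteq> 0" using p(1) by auto
  moreover have "degree q < degree p"
    using \<open>q \<noteq> 0\<close> unfolding q by (subst degree_mult_eq) auto
  ultimately have qv: "papp q T v \<noteq> 0" using min by fastforce
  have "papp p T v = T *v papp q T v - r *s papp q T v"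
    unfolding q papp_mult by (simp add: mv_linear vec_eq_iff)
  then have "T *v papp q T v = r *s papp q T v" using p(2) by simp
  moreover have "papp q T v \<in> S"
    by (induction q) (auto simp: S v(1))
  ultimately show ?thesis using qv by blast
qed

lemma common_eigenvector:
  fixes P Q :: "complex^4^4"
  assumes comm: "\<And>l. P *v (Q *v l) = Q *v (P *v l)"
  shows "\<exists>l m n. l \<noteq> 0 \<and> P *v l = m *s l \<and> Q *v l = n *s l"
proof -
  have "axis 0 1 \<noteq> (0 :: complex^4)" by (simp add: vec_eq_iff axis_def)
  then obtain m l0 where l0: "l0 \<noteq> 0" "P *v l0 = m *s l0"
    using eigenvector_in_subspace[of UNIV P "axis 0 1"] by auto
  have "\<exists>n l. l \<in> {l. P *v l = m *s l} \<and> l \<noteq> 0 \<and> Q *v l = n *s l"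
  proof (rule eigenvector_in_subspace[where v = l0])
    fix u v assume "u \<in> {l. P *v l = m *s l}" "v \<in> {l. P *v l = m *s l}"
    then show "u + v \<in> {l. P *v l = m *s l}" by (simp add: mv_linear vector_add_ldistrib)
  next
    fix c u assume "u \<in> {l. P *v l = m *s l}"
    then show "c *s u \<in> {l. P *v l = m *s l}" by (simp add: mv_linear mult.commute)
  next
    fix u assume "u \<in> {l. P *v l = m *s l}"
    then show "Q *v u \<in> {l. P *v l = m *s l}" by (simp add: comm mv_linear)
  qed (use l0 in \<open>simp_all add: mv_linear\<close>)
  then show ?thesis by blast
qed

lemma common_left_eigenvector:
  fixes M N :: "complex^4^4"
  assumes comm: "M ** N = N ** M"
  shows "\<exists>l m n. l \<noteq> 0 \<and> (\<forall>z. dot l (M *v z) = m * dot l z) \<and> (\<forall>z. dot l (N *v z) = n * dot l z)"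
proof -
  have c: "transpose M ** transpose N = transpose N ** transpose M"
    using arg_cong[OF comm, of transpose] by (simp add: matrix_transpose_mul)
  obtain l m n where l: "l \<noteq> 0" "transpose M *v l = m *s l" "transpose N *v l = n *s l"
    using common_eigenvector[of "transpose M" "transpose N"] unfolding matrix_vector_mul_assoc c by blast
  have "dot l (M *v z) = m * dot l z" "dot l (N *v z) = n * dot l z" for z
    unfolding dot_transpose l smult_dot by simp_all
  then show ?thesis using l(1) by blast
qed

lemma papp_monom: "papp (monom c k) T v = c *s ((*v) T ^^ k) v"
  by (induction k) (simp_all add: monom_0 monom_Suc mv_linear)

text \<open>On polynomials in \<open>N\<close> the commutator with \<open>M\<close> is the derivation \<open>x d/dx\<close>. It preserves the
  polynomials that annihilate \<open>N\<close>, so the minimal one is a power of \<open>x\<close>.\<close>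

lemma papp_commutator:
  assumes "\<And>v. M *v (N *v v) = N *v (M *v v) + N *v v"
  shows "M *v papp p N v = papp p N (M *v v) + papp (pCons 0 (pderiv p)) N v"
proof (induction p)
  case (pCons a p)
  show ?case
    unfolding papp_pCons mv_linear assms pCons.IH pderiv_pCons papp_add
    by (simp add: mv_linear vec_eq_iff)
qed (simp add: mv_linear)

lemma commutator_nilpotent:
  fixes M N :: "complex^4^4"
  assumes comm: "\<And>v. M *v (N *v v) = N *v (M *v v) + N *v v"
  shows "\<exists>d. \<forall>v. ((*v) N ^^ d) v = 0"
proof -
  have "\<forall>j. \<exists>p. p \<noteq> 0 \<and> papp p N (axis j 1) = 0" using papp_annihilator by blast
  then obtain p where p: "\<And>j. p j \<noteq> 0" "\<And>j. papp (p j) N (axis j 1) = 0" by metis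
  let ?P = "p 0 * p 1 * p 2 * p 3"
  have z: "papp q N 0 = 0" for q
    using papp_linear(2)[of q N 0 0] by simp
  have P: "?P = (p 1 * p 2 * p 3) * p 0" "?P = (p 0 * p 2 * p 3) * p 1" "?P = (p 0 * p 1 * p 3) * p 2"
    by (simp_all only: mult_ac)
  have "papp ?P N (axis 0 1) = 0" unfolding P(1) papp_mult p z ..
  moreover have "papp ?P N (axis 1 1) = 0" unfolding P(2) papp_mult p z ..
  moreover have "papp ?P N (axis 2 1) = 0" unfolding P(3) papp_mult p z ..
  moreover have "papp ?P N (axis 3 1) = 0" unfolding papp_mult p z ..
  moreover have decomp: "v$0 *s axis 0 1 + v$1 *s axis 1 1 + v$2 *s axis 2 1 + v$3 *s axis 3 1 = v" for v :: "complex^4"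
    by (simp add: vec4_eq_iff axis_def)
  ultimately have Pz: "papp ?P N (v$0 *s axis 0 1 + v$1 *s axis 1 1 + v$2 *s axis 2 1 + v$3 *s axis 3 1) = 0" for v
    by (simp only: papp_linear) simp
  have "papp ?P N v = 0" for v
    by (subst decomp[of v, symmetric]) (rule Pz)
  then have ex: "?P \<noteq> 0 \<and> (\<forall>v. papp ?P N v = 0)" using p(1) by simp
  obtain m where "(m \<noteq> 0 \<and> (\<forall>v. papp m N v = 0)) \<and>
      (\<forall>q. q \<noteq> 0 \<and> (\<forall>v. papp q N v = 0) \<longrightarrow> degree m \<le> degree q)"
    using ex_has_least_nat[of "\<lambda>p. p \<noteq> 0 \<and> (\<forall>v. papp p N v = 0)" ?P degree, OF ex] by (elim exE)
  then have m: "m \<noteq> 0" "\<And>v. papp m N v = 0"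
    and min: "\<And>q. q \<noteq> 0 \<Longrightarrow> (\<forall>v. papp q N v = 0) \<Longrightarrow> degree m \<le> degree q" by simp_all
  define q where "q = pCons 0 (pderiv m) - smult (of_nat (degree m)) m"
  have cq: "coeff q k = (of_nat k - of_nat (degree m)) * coeff m k" for k
    by (cases k) (simp_all add: q_def coeff_pderiv algebra_simps)
  have "papp (pCons 0 (pderiv m)) N v = 0" for v
    using papp_commutator[OF comm, of m v] by (simp add: m(2) mv_linear)
  moreover have "papp q N v = papp (pCons 0 (pderiv m)) N v - of_nat (degree m) *s papp m N v" for v
    using papp_add[of "pCons 0 (pderiv m)" "smult (- of_nat (degree m)) m" N v]
    unfolding q_def papp_smult by (simp add: vec_eq_iff)
  ultimately have qz: "papp q N v = 0" for v by (simp add: m(2))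
  have "q = 0"
  proof (rule ccontr)
    assume "q \<noteq> 0"
    then have "degree m \<le> degree q" using min qz by blast
    moreover have "coeff q k = 0" if "k \<ge> degree m" for k
      using cq[of k] that by (cases "k = degree m") (auto simp: coeff_eq_0)
    ultimately show False using \<open>q \<noteq> 0\<close> leading_coeff_0_iff by blast
  qed
  then have coeff0: "(of_nat k - of_nat (degree m)) * coeff m k = 0" for k using cq[of k] by simp
  have "m = monom (lead_coeff m) (degree m)"
  proof (rule poly_eqI)
    fix n show "coeff m n = coeff (monom (lead_coeff m) (degree m)) n"
      using coeff0[of n] by (cases "n = degree m") simp_all
  qed
  then have "lead_coeff m *s ((*v) N ^^ degree m) v = 0" for v
    using m(2)[of v] papp_monom by metis
  then have "((*v) N ^^ degree m) v = 0" for v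
    using m(1) by (simp add: vec_eq_iff)
  then show ?thesis by blast
qed

text \<open>If \<open>N\<^sup>5 w = 0\<close> but \<open>N\<^sup>4 w \<noteq> 0\<close>, the five vectors \<open>w, N w, \<dots>, N\<^sup>4 w\<close> are independent.\<close>

lemma nilpotent_power4:
  fixes N :: "complex^4^4"
  assumes "\<forall>v. ((*v) N ^^ d) v = 0"
  shows "N *v (N *v (N *v (N *v v))) = 0"
proof (rule ccontr)
  assume nz: "N *v (N *v (N *v (N *v v))) \<noteq> 0"
  define k where "k = (LEAST k. ((*v) N ^^ k) v = 0)"
  have k: "((*v) N ^^ k) v = 0" unfolding k_def by (rule LeastI[of _ d]) (use assms in blast)
  have k': "((*v) N ^^ j) v \<noteq> 0" if "j < k" for j using not_less_Least[of j] that unfolding k_def by blast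
  have "k > 4"
  proof (rule ccontr)
    assume "\<not> k > 4"
    then obtain j where "4 = j + k" by (metis add.commute le_Suc_ex linorder_not_less)
    moreover have "((*v) N ^^ (j + k)) v = ((*v) N ^^ j) 0" by (simp add: funpow_add k)
    ultimately have "((*v) N ^^ 4) v = ((*v) N ^^ j) 0" by (simp only:)
    also have "\<dots> = 0" by (induction j) (simp_all add: mv_linear)
    finally show False using nz by (simp add: numeral_eq_Suc)
  qed
  define j where "j = k - 5"
  have j: "k = Suc (Suc (Suc (Suc (Suc j))))" using \<open>k > 4\<close> unfolding j_def by arith
  define w where "w = ((*v) N ^^ j) v"
  have w5: "N *v (N *v (N *v (N *v (N *v w)))) = 0" using k unfolding j w_def by simp
  have w4: "N *v (N *v (N *v (N *v w))) \<noteq> 0"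
    using k'[of "Suc (Suc (Suc (Suc j)))"] unfolding j w_def by simp
  let ?w1 = "N *v w" and ?w2 = "N *v (N *v w)" and ?w3 = "N *v (N *v (N *v w))"
    and ?w4 = "N *v (N *v (N *v (N *v w)))"
  have sc: "c = 0" if "c *s ?w4 = 0" for c using that w4 by (auto simp: vec_eq_iff)
  have ind: "x0 = 0 \<and> x1 = 0 \<and> x2 = 0 \<and> x3 = 0"
    if e: "x0 *s w + x1 *s ?w1 + x2 *s ?w2 + x3 *s ?w3 + x4 *s ?w4 = 0" for x0 x1 x2 x3 x4
  proof -
    have s1: "x0 *s ?w1 + x1 *s ?w2 + x2 *s ?w3 + x3 *s ?w4 = 0"
      using arg_cong[OF e, of "(*v) N"] by (simp add: mv_linear w5)
    have s2: "x0 *s ?w2 + x1 *s ?w3 + x2 *s ?w4 = 0"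
      using arg_cong[OF s1, of "(*v) N"] by (simp add: mv_linear w5)
    have s3: "x0 *s ?w3 + x1 *s ?w4 = 0"
      using arg_cong[OF s2, of "(*v) N"] by (simp add: mv_linear w5)
    have s4: "x0 *s ?w4 = 0"
      using arg_cong[OF s3, of "(*v) N"] by (simp add: mv_linear w5)
    have x0: "x0 = 0" by (rule sc[OF s4])
    have x1: "x1 = 0" by (rule sc) (use s3 x0 in simp)
    have x2: "x2 = 0" by (rule sc) (use s2 x0 x1 in simp)
    have x3: "x3 = 0" by (rule sc) (use s1 x0 x1 x2 in simp)
    show ?thesis using x0 x1 x2 x3 by simp
  qed
  have bas: "basis4 w ?w1 ?w2 ?w3"
    unfolding basis4_def
  proof (intro allI impI)
    fix x0 x1 x2 x3 assume "x0 *s w + x1 *s ?w1 + x2 *s ?w2 + x3 *s ?w3 = 0"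
    then show "x0 = 0 \<and> x1 = 0 \<and> x2 = 0 \<and> x3 = 0" by (intro ind[of x0 x1 x2 x3 0]) simp
  qed
  obtain y0 y1 y2 y3 where y: "?w4 = y0 *s w + y1 *s ?w1 + y2 *s ?w2 + y3 *s ?w3"
    using basis4_expand[OF bas, of ?w4] .
  then have "y0 *s w + y1 *s ?w1 + y2 *s ?w2 + y3 *s ?w3 + (-1) *s ?w4 = 0" by simp
  then have "y0 = 0 \<and> y1 = 0 \<and> y2 = 0 \<and> y3 = 0" by (rule ind)
  then show False using y w4 by simp
qed

section \<open>Commuting pairs with a given block structure\<close>

lemma basis4_transform:
  assumes b: "basis4 b0 b1 b2 b3" and P: "basis4 P0 P1 P2 P3"
    and n: "n0 = cols b0 b1 b2 b3 *v P0" "n1 = cols b0 b1 b2 b3 *v P1"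
      "n2 = cols b0 b1 b2 b3 *v P2" "n3 = cols b0 b1 b2 b3 *v P3"
  shows "basis4 n0 n1 n2 n3"
  unfolding basis4_def
proof (intro allI impI)
  fix x0 x1 x2 x3 assume e: "x0 *s n0 + x1 *s n1 + x2 *s n2 + x3 *s n3 = 0"
  have "cols b0 b1 b2 b3 *v (x0 *s P0 + x1 *s P1 + x2 *s P2 + x3 *s P3) = cols b0 b1 b2 b3 *v 0"
    using e unfolding n mv_linear .
  then have "x0 *s P0 + x1 *s P1 + x2 *s P2 + x3 *s P3 = 0" by (rule cols_inject[OF b])
  then show "x0 = 0 \<and> x1 = 0 \<and> x2 = 0 \<and> x3 = 0" using P unfolding basis4_def by blast
qed

lemma basis4_scale:
  assumes "basis4 b0 b1 b2 b3" "k0 \<noteq> 0" "k1 \<noteq> 0" "k2 \<noteq> 0" "k3 \<noteq> 0"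
  shows "basis4 (k0 *s b0) (k1 *s b1) (k2 *s b2) (k3 *s b3)"
  by (rule basis4_transform[OF assms(1), of "vec4 k0 0 0 0" "vec4 0 k1 0 0" "vec4 0 0 k2 0" "vec4 0 0 0 k3"])
     (use assms(2-5) in \<open>simp_all add: basis4_def vec4_eq_iff cols_vec4\<close>)

lemma basis4_swap:
  assumes "basis4 b0 b1 b2 b3"
  shows "basis4 b1 b0 b2 b3" "basis4 b0 b2 b1 b3" "basis4 b0 b1 b3 b2"
proof -
  show "basis4 b1 b0 b2 b3"
    by (rule basis4_transform[OF assms, of "vec4 0 1 0 0" "vec4 1 0 0 0" "vec4 0 0 1 0" "vec4 0 0 0 1"])
       (simp_all add: basis4_def vec4_eq_iff cols_vec4)
  show "basis4 b0 b2 b1 b3"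
    by (rule basis4_transform[OF assms, of "vec4 1 0 0 0" "vec4 0 0 1 0" "vec4 0 1 0 0" "vec4 0 0 0 1"])
       (simp_all add: basis4_def vec4_eq_iff cols_vec4)
  show "basis4 b0 b1 b3 b2"
    by (rule basis4_transform[OF assms, of "vec4 1 0 0 0" "vec4 0 1 0 0" "vec4 0 0 0 1" "vec4 0 0 1 0"])
       (simp_all add: basis4_def vec4_eq_iff cols_vec4)
qed

text \<open>On each block both matrices are polynomials in the same nilpotent matrix. For each block structure there are
  three functions of degree 0 whose derivatives along \<open>M z\<close> and \<open>N z\<close> are constants, for example \<open>log (z\<^sub>0 / z\<^sub>3)\<close>,
  \<open>log (z\<^sub>1 / z\<^sub>3)\<close> and \<open>z\<^sub>2 / z\<^sub>3\<close> for the blocks \<open>1 + 1 + 2\<close>. Two equations in three unknowns give a combination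
  that is constant along both fields. A change of scale brings it to one of the list, apart from degenerate cases,
  in which a simpler function does or \<open>nondeg\<close> fails.\<close>

lemma block_211_aux:
  assumes b: "basis4 e0 e1 e2 e3"
    and M: "M *v e0 = t0 *s e0" "M *v e1 = t1 *s e1" "M *v e2 = t3 *s e2" "M *v e3 = t3 *s e3 + s *s e2"
    and N: "N *v e0 = t0' *s e0" "N *v e1 = t1' *s e1" "N *v e2 = t3' *s e2" "N *v e3 = t3' *s e3 + s' *s e2"
    and eq: "(t0 - t3) * x + (t1 - t3) * y + s * c = 0" "(t0' - t3') * x + (t1' - t3') * y + s' * c = 0"
    and nz: "y \<noteq> 0" "c \<noteq> 0"
  shows "has_listed_form M N"
proof -
  let ?e2 = "(y / c) *s e2" and ?k = "- x / y"
  have k: "?k * t0 - t1 - (?k - 1) * t3 = s * c / y" if "(t0 - t3) * x + (t1 - t3) * y + s * c = 0" for t0 t1 t3 s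
  proof -
    define X where "X = x / y"
    have "s * c = - ((t0 - t3) * x + (t1 - t3) * y)" using that by (simp only: add_eq_0_iff)
    also have "\<dots> = (- ((t0 - t3) * X) - (t1 - t3)) * y"
    proof -
      have x: "x = X * y" using nz by (simp add: X_def)
      show ?thesis by (subst x) (simp add: algebra_simps)
    qed
    finally have sc: "s * c / y = - ((t0 - t3) * X) - (t1 - t3)" using nz by simp
    have kx: "?k = - X" by (simp add: X_def)
    show ?thesis unfolding kx sc by (simp add: algebra_simps)
  qed
  have b': "basis4 e0 e1 ?e2 e3" using basis4_scale[OF b, of 1 1 "y / c" 1] nz by simp
  have e2: "s *s e2 = (s * c / y) *s ?e2" for s using nz by simp
  show ?thesis
    by (rule nf5[OF b', of M t0 t1 t3 ?k N t0' t1' t3'])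
       (unfold k[OF eq(1)] k[OF eq(2)] e2[symmetric] M N mv_linear, simp_all add: mult.commute add.commute)
qed

lemma block_211:
  assumes b: "basis4 e0 e1 e2 e3"
    and M: "M *v e0 = t0 *s e0" "M *v e1 = t1 *s e1" "M *v e2 = t3 *s e2" "M *v e3 = t3 *s e3 + s *s e2"
    and N: "N *v e0 = t0' *s e0" "N *v e1 = t1' *s e1" "N *v e2 = t3' *s e2" "N *v e3 = t3' *s e3 + s' *s e2"
  shows "has_listed_form M N"
proof -
  obtain x y c where nz: "x \<noteq> 0 \<or> y \<noteq> 0 \<or> c \<noteq> 0"
    and eq: "(t0 - t3) * x + (t1 - t3) * y + s * c = 0" "(t0' - t3') * x + (t1' - t3') * y + s' * c = 0"
    using two_equations[of "t0 - t3" "t1 - t3" s "t0' - t3'" "t1' - t3'" s'] by blast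
  consider "c \<noteq> 0" "y \<noteq> 0" | "c \<noteq> 0" "x \<noteq> 0" | "c \<noteq> 0" "x = 0" "y = 0" | "c = 0" by blast
  then show ?thesis
  proof cases
    case 1
    then show ?thesis using block_211_aux[OF b M N eq] by blast
  next
    case 2
    show ?thesis
      by (rule block_211_aux[OF basis4_swap(1)[OF b] M(2,1,3,4) N(2,1,3,4), of y x c])
         (use eq 2 in \<open>simp_all add: add_ac\<close>)
  next
    case 3
    then have "s = 0" "s' = 0" using eq by auto
    then show ?thesis using nf_diagonal[OF b M(1-3) _ N(1-3), of t3 t3'] M(4) N(4) by simp
  next
    case 4
    have id: "dot (form1 x y 0 (-(x + y)) w) (w$0 *s vec4 t0 0 0 0 + w$1 *s vec4 0 t1 0 0
        + w$2 *s vec4 0 0 t3 0 + w$3 *s vec4 0 0 s t3)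
      = ((t0 - t3) * x + (t1 - t3) * y) * (w$0 * w$1 * w$2 * w$3)" for t0 t1 t3 s w
      by (simp add: form1_def dot4 algebra_simps)
    show ?thesis
    proof (rule has_listed_formI[OF b])
      show "listed_form (form1 x y 0 (-(x + y)))" by (rule listed_form1) (use nz 4 in auto)
      show "M *v e0 = cols e0 e1 e2 e3 *v vec4 t0 0 0 0" "M *v e1 = cols e0 e1 e2 e3 *v vec4 0 t1 0 0"
        "M *v e2 = cols e0 e1 e2 e3 *v vec4 0 0 t3 0" "M *v e3 = cols e0 e1 e2 e3 *v vec4 0 0 s t3"
        by (simp_all add: M cols_vec4)
      show "N *v e0 = cols e0 e1 e2 e3 *v vec4 t0' 0 0 0" "N *v e1 = cols e0 e1 e2 e3 *v vec4 0 t1' 0 0"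
        "N *v e2 = cols e0 e1 e2 e3 *v vec4 0 0 t3' 0" "N *v e3 = cols e0 e1 e2 e3 *v vec4 0 0 s' t3'"
        by (simp_all add: N cols_vec4)
    qed (use eq 4 in \<open>simp_all only: id mult_zero_left mult_zero_right add_0_right\<close>)
  qed
qed

lemma block_22_aux:
  assumes b: "basis4 e0 e1 e2 e3"
    and M: "M *v e0 = t1 *s e0" "M *v e1 = t1 *s e1 + s1 *s e0" "M *v e2 = t3 *s e2" "M *v e3 = t3 *s e3 + s3 *s e2"
    and N: "N *v e0 = t1' *s e0" "N *v e1 = t1' *s e1 + s1' *s e0" "N *v e2 = t3' *s e2" "N *v e3 = t3' *s e3 + s3' *s e2"
    and eq: "x * (t1 - t3) + s1 * c + s3 * e = 0" "x * (t1' - t3') + s1' * c + s3' * e = 0"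
    and x: "x = 0 \<or> x = 1" and nz: "c \<noteq> 0" "e \<noteq> 0"
  shows "has_listed_form M N"
proof -
  define f0 f2 where "f0 = (1 / c) *s e0" and "f2 = (1 / e) *s e2"
  have b': "basis4 f0 e1 f2 e3"
    using basis4_scale[OF b, of "1 / c" 1 "1 / e" 1] nz by (simp add: f0_def f2_def)
  have M': "M *v f0 = t1 *s f0" "M *v e1 = t1 *s e1 + (s1 * c) *s f0" "M *v f2 = t3 *s f2"
    "M *v e3 = t3 *s e3 + (s3 * e) *s f2"
    using nz by (simp_all add: f0_def f2_def mv_linear M mult.commute)
  have N': "N *v f0 = t1' *s f0" "N *v e1 = t1' *s e1 + (s1' * c) *s f0" "N *v f2 = t3' *s f2"
    "N *v e3 = t3' *s e3 + (s3' * e) *s f2"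
    using nz by (simp_all add: f0_def f2_def mv_linear N mult.commute)
  from x show ?thesis
  proof
    assume "x = 0"
    then have "s3 * e = - (s1 * c)" "s3' * e = - (s1' * c)" using eq by (simp_all add: eq_neg_iff_add_eq_0 add.commute)
    then show ?thesis
      using nf2[OF b' M'(1,2,3) _ N'(1,2,3)] M'(4) N'(4) by simp
  next
    assume "x = 1"
    then have "s3 * e = t3 - t1 - s1 * c" "s3' * e = t3' - t1' - s1' * c" using eq by (simp_all add: algebra_simps)
    then show ?thesis
      using nf3[OF b' M'(1,2,3) _ N'(1,2,3)] M'(4) N'(4) by simp
  qed
qed

text \<open>The exponent \<open>\<kappa> = 0\<close> leaves \<open>z\<^sub>0\<close> out of the first integral, so terms in the direction of \<open>e0\<close> may be added to the
  matrices.\<close>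

lemma nf5_zero_scaled:
  assumes b: "basis4 e0 e1 e2 e3"
    and M: "M *v e0 = p *s e0" "M *v e1 = t *s e1 + r *s e0" "M *v e2 = u *s e2 + x *s e0"
      "M *v e3 = u *s e3 + s *s e2 + y *s e0"
    and N: "N *v e0 = p' *s e0" "N *v e1 = t' *s e1 + r' *s e0" "N *v e2 = u' *s e2 + x' *s e0"
      "N *v e3 = u' *s e3 + s' *s e2 + y' *s e0"
    and eq: "s * e = u - t" "s' * e = u' - t'" and nz: "e \<noteq> 0"
  shows "has_listed_form M N"
proof -
  define f2 where "f2 = (1 / e) *s e2"
  have b': "basis4 e0 e1 f2 e3"
    using basis4_scale[OF b, of 1 1 "1 / e" 1] nz by (simp add: f2_def)
  have sc: "s *s e2 = (s * e) *s f2" for s using nz by (simp add: f2_def)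
  have M': "M *v f2 = u *s f2 + (x / e) *s e0" "M *v e3 = u *s e3 + (u - t) *s f2 + y *s e0"
    unfolding M sc eq[symmetric] by (simp_all add: f2_def mv_linear M vector_add_ldistrib mult.commute)
  have N': "N *v f2 = u' *s f2 + (x' / e) *s e0" "N *v e3 = u' *s e3 + (u' - t') *s f2 + y' *s e0"
    unfolding N sc eq[symmetric] by (simp_all add: f2_def mv_linear N vector_add_ldistrib mult.commute)
  show ?thesis by (rule nf5_zero[OF b' M(1,2) M' N(1,2) N'])
qed

lemma block_22:
  assumes b: "basis4 e0 e1 e2 e3"
    and M: "M *v e0 = t1 *s e0" "M *v e1 = t1 *s e1 + s1 *s e0" "M *v e2 = t3 *s e2" "M *v e3 = t3 *s e3 + s3 *s e2"
    and N: "N *v e0 = t1' *s e0" "N *v e1 = t1' *s e1 + s1' *s e0" "N *v e2 = t3' *s e2" "N *v e3 = t3' *s e3 + s3' *s e2"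
  shows "has_listed_form M N"
proof -
  obtain x c e where nz: "x \<noteq> 0 \<or> c \<noteq> 0 \<or> e \<noteq> 0"
    and eq: "(t1 - t3) * x + s1 * c + s3 * e = 0" "(t1' - t3') * x + s1' * c + s3' * e = 0"
    using two_equations[of "t1 - t3" s1 s3 "t1' - t3'" s1' s3'] by blast
  have unit: "1 * (d) + p * (c / x) + q * (e / x) = 0" if "x \<noteq> 0" "d * x + p * c + q * e = 0" for d p q
  proof -
    have "(d * x + p * c + q * e) / x = 0" using that(2) by simp
    then show ?thesis using that(1) by (simp add: add_divide_distrib)
  qed
  have b1: "basis4 e2 e3 e0 e1"
    using basis4_swap(2)[OF basis4_swap(1)[OF basis4_swap(3)[OF basis4_swap(2)[OF b]]]] by simp
  have b2: "basis4 e0 e2 e1 e3" by (rule basis4_swap(2)[OF b])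
  consider (a) "x = 0" "c \<noteq> 0" "e \<noteq> 0" | (b) "x \<noteq> 0" "c \<noteq> 0" "e \<noteq> 0" | (c) "x \<noteq> 0" "c = 0" "e \<noteq> 0"
    | (d) "x \<noteq> 0" "c \<noteq> 0" "e = 0" | (e) "x \<noteq> 0" "c = 0" "e = 0" | (f) "x = 0" "c \<noteq> 0" "e = 0"
    | (g) "x = 0" "c = 0" "e \<noteq> 0" using nz by blast
  then show ?thesis
  proof cases
    case a
    show ?thesis
      by (rule block_22_aux[OF b M N, of 0 c e]) (use eq a in simp_all)
  next
    case b
    show ?thesis
      by (rule block_22_aux[OF \<open>basis4 e0 e1 e2 e3\<close> M N unit[OF b(1) eq(1)] unit[OF b(1) eq(2)]]) (use b in simp_all)
  next
    case c
    have "s3 * (e / x) = t3 - t1" "s3' * (e / x) = t3' - t1'"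
      using unit[OF c(1) eq(1)] unit[OF c(1) eq(2)] c by (simp_all add: algebra_simps)
    then show ?thesis
      using nf5_zero_scaled[OF b M(1,2), of t3 0 s3 0 N t1' t1' s1' t3' 0 s3' 0 "e / x"] M N c by simp
  next
    case d
    have "s1 * (- c / x) = t1 - t3" "s1' * (- c / x) = t1' - t3'"
      using unit[OF d(1) eq(1)] unit[OF d(1) eq(2)] d by (simp_all add: algebra_simps)
    then show ?thesis
      using nf5_zero_scaled[OF b1 M(3,4), of t1 0 s1 0 N t3' t3' s3' t1' 0 s1' 0 "- c / x"] M N d by simp
  next
    case e
    then have "t1 = t3" "t1' = t3'" using eq by auto
    then show ?thesis
      using nf_ratio[OF b2, of M 0 t3 t3 0 t3 0 s1 s3 0 N 0 t3' t3' 0 t3' 0 s1' s3' 0] M N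
      by (simp add: add_ac)
  next
    case f
    then have "s1 = 0" "s1' = 0" using eq by auto
    then show ?thesis
      using nf_ratio[OF b1, of M 0 t3 t3 s3 t1 0 0 0 0 N 0 t3' t3' s3' t1' 0 0 0 0] M N
      by (simp add: add_ac)
  next
    case g
    then have "s3 = 0" "s3' = 0" using eq by auto
    then show ?thesis
      using nf_ratio[OF \<open>basis4 e0 e1 e2 e3\<close>, of M 0 t1 t1 s1 t3 0 0 0 0 N 0 t1' t1' s1' t3' 0 0 0 0] M N
      by (simp add: add_ac)
  qed
qed

text \<open>The functions are \<open>log (z\<^sub>0 / z\<^sub>3)\<close>, \<open>z\<^sub>2 / z\<^sub>3\<close> and \<open>z\<^sub>1 / z\<^sub>3 - z\<^sub>2\<^sup>2 / (2 z\<^sub>3\<^sup>2)\<close>. A solution without logarithmic term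
  but with the quadratic one means that the nilpotent parts of \<open>M\<close> and \<open>N\<close> on the large block are proportional. This
  contradicts \<open>nondeg\<close> on the hyperplane \<open>z\<^sub>0 = 0\<close>.\<close>

lemma block_31:
  assumes nd: "nondeg M N" and b: "basis4 e0 e1 e2 e3"
    and M: "M *v e0 = t0 *s e0" "M *v e1 = t3 *s e1" "M *v e2 = t3 *s e2 + s *s e1"
      "M *v e3 = t3 *s e3 + s *s e2 + p *s e1"
    and N: "N *v e0 = t0' *s e0" "N *v e1 = t3' *s e1" "N *v e2 = t3' *s e2 + s' *s e1"
      "N *v e3 = t3' *s e3 + s' *s e2 + p' *s e1"
  shows "has_listed_form M N"
proof -
  obtain x \<beta> \<gamma> where nz: "x \<noteq> 0 \<or> \<beta> \<noteq> 0 \<or> \<gamma> \<noteq> 0"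
    and eq: "(t0 - t3) * x + s * \<beta> + p * \<gamma> = 0" "(t0' - t3') * x + s' * \<beta> + p' * \<gamma> = 0"
    using two_equations[of "t0 - t3" s p "t0' - t3'" s' p'] by blast
  have b1: "basis4 e1 e0 e2 e3" by (rule basis4_swap(1)[OF b])
  have b2: "basis4 e1 e2 e0 e3" by (rule basis4_swap(2)[OF b1])
  consider (a) "x \<noteq> 0" "\<gamma> \<noteq> 0" | (b) "x \<noteq> 0" "\<gamma> = 0" "\<beta> \<noteq> 0" | (c) "x \<noteq> 0" "\<gamma> = 0" "\<beta> = 0"
    | (d) "x = 0" "\<gamma> = 0" "\<beta> \<noteq> 0" | (e) "x = 0" "\<gamma> \<noteq> 0" using nz by blast
  then show ?thesis
  proof cases
    case a
    define B C where "B = \<beta> / x" and "C = \<gamma> / x"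
    have C: "C \<noteq> 0" using a by (simp add: C_def)
    have eq': "s * B + p * C = t3 - t0" "s' * B + p' * C = t3' - t0'"
    proof -
      have "s * B + p * C = (s * \<beta> + p * \<gamma>) / x" for s p by (simp add: B_def C_def add_divide_distrib)
      moreover have "s * \<beta> + p * \<gamma> = (t3 - t0) * x" "s' * \<beta> + p' * \<gamma> = (t3' - t0') * x"
        using eq by (simp_all add: algebra_simps add_eq_0_iff)
      ultimately show "s * B + p * C = t3 - t0" "s' * B + p' * C = t3' - t0'" using a(1) by simp_all
    qed
    \<comment> \<open>scales the chain such that the quadratic term gets the coefficient of \<open>form4\<close>\<close>
    define k where "k = csqrt (- C / 2)"
    have k2: "k * k = - C / 2" unfolding k_def by (metis power2_csqrt power2_eq_square)
    have k0: "k \<noteq> 0" using k2 C by auto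
    have Ck: "C = - (2 * (k * k))" unfolding k2 by simp
    define f1 f2 where "f1 = (- 1 / C) *s e1" and "f2 = (1 / k) *s e2 + (- B / (C * k)) *s e1"
    have b': "basis4 e0 f1 f2 e3"
      by (rule basis4_transform[OF b, of "vec4 1 0 0 0" "vec4 0 (- 1 / C) 0 0" "vec4 0 (- B / (C * k)) (1 / k) 0" "vec4 0 0 0 1"])
         (use C k0 in \<open>auto simp: basis4_def vec4_eq_iff cols_vec4 f1_def f2_def\<close>)
    have e1: "e1 = (- C) *s f1" using C by (simp add: f1_def)
    have e2: "e2 = k *s f2 + (- B) *s f1"
      using C k0 by (simp add: f1_def f2_def vec_eq_iff field_simps)
    have shape: "T *v f1 = t3 *s f1 \<and> T *v f2 = t3 *s f2 + (2 * (s * k)) *s f1 \<and>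
        T *v e3 = t3 *s e3 + (s * k) *s f2 + (t0 - t3) *s f1"
      if T: "T *v e1 = t3 *s e1" "T *v e2 = t3 *s e2 + s *s e1" "T *v e3 = t3 *s e3 + s *s e2 + p *s e1"
        and q: "s * B + p * C = t3 - t0" for T :: "complex^4^4" and t0 t3 s p
    proof (intro conjI)
      show "T *v f1 = t3 *s f1" by (simp add: f1_def mv_linear T)
      have "T *v f2 = t3 *s f2 + (1 / k) *s (s *s e1)"
        unfolding f2_def mv_linear T by (simp add: vec_eq_iff algebra_simps)
      also have "(1 / k) *s (s *s e1) = (2 * (s * k)) *s f1"
        unfolding e1 Ck using k0 by simp
      finally show "T *v f2 = t3 *s f2 + (2 * (s * k)) *s f1" .
      have "T *v e3 = t3 *s e3 + (s * k) *s f2 + (- (s * B + p * C)) *s f1"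
        unfolding T by (subst e2, subst e1) (simp add: vec_eq_iff algebra_simps)
      then show "T *v e3 = t3 *s e3 + (s * k) *s f2 + (t0 - t3) *s f1" unfolding q by simp
    qed
    note sM = shape[OF M(2-4) eq'(1)] and sN = shape[OF N(2-4) eq'(2)]
    show ?thesis
      using nf4[OF b' M(1) _ _ _ N(1)] sM sN by blast
  next
    case b
    have "s * (\<beta> / x) = t3 - t0" "s' * (\<beta> / x) = t3' - t0'"
    proof -
      have "s * \<beta> = (t3 - t0) * x" "s' * \<beta> = (t3' - t0') * x"
        using eq b by (simp_all add: algebra_simps add_eq_0_iff)
      then show "s * (\<beta> / x) = t3 - t0" "s' * (\<beta> / x) = t3' - t0'" using b by simp_all
    qed
    then show ?thesis
      using nf5_zero_scaled[OF b1, of M t3 t0 0 t3 s s p N t3' t0' 0 t3' s' s' p' "\<beta> / x"] M N b by simp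
  next
    case c
    then have "t0 = t3" "t0' = t3'" using eq by auto
    then show ?thesis
      using nf_ratio[OF b2, of M 0 t3 t3 s t3 0 0 s p N 0 t3' t3' s' t3' 0 0 s' p'] M N
      by (simp add: add_ac)
  next
    case d
    then have "s = 0" "s' = 0" using eq by auto
    then show ?thesis
      using nf_ratio[OF \<open>basis4 e0 e1 e2 e3\<close>, of M 0 t0 t3 0 t3 0 0 p 0 N 0 t0' t3' 0 t3' 0 0 p' 0] M N
      by (simp add: add_ac)
  next
    case e
    have pp: "p = - (s * \<beta> / \<gamma>)" "p' = - (s' * \<beta> / \<gamma>)"
      using eq e by (simp_all add: field_simps add_eq_0_iff)
    have "\<exists>q r. (q \<noteq> 0 \<or> r \<noteq> 0) \<and> q * s + r * s' = 0"
    proof (cases "s = 0")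
      case True
      then show ?thesis by (intro exI[of _ 1] exI[of _ 0]) simp
    next
      case False
      then show ?thesis by (intro exI[of _ s'] exI[of _ "- s"]) simp
    qed
    then obtain q r where qr: "q \<noteq> 0 \<or> r \<noteq> 0" "q * s + r * s' = 0" by blast
    have "q * p + r * p' = - ((q * s + r * s') * (\<beta> / \<gamma>))" unfolding pp by (simp add: algebra_simps)
    then have qp: "q * p + r * p' = 0" using qr(2) by simp
    have False
    proof (rule nondegD[OF nd b, of "vec4 1 0 0 0"])
      fix w z assume w: "dot (vec4 1 0 0 0) w = 0" and z: "z = w$0 *s e0 + w$1 *s e1 + w$2 *s e2 + w$3 *s e3"
      have w0: "w$0 = 0" using w by (simp add: dot4)
      have "q *s (M *v z) + r *s (N *v z) = (q * t3 + r * t3') *s z + ((q * s + r * s') * w$2) *s e1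
          + ((q * s + r * s') * w$3) *s e2 + ((q * p + r * p') * w$3) *s e1"
        unfolding z mv_linear M N by (simp add: w0 vec_eq_iff algebra_simps)
      then have "(- (q * t3 + r * t3')) *s z + q *s (M *v z) + r *s (N *v z) = 0"
        unfolding qr(2) qp by (simp add: add.assoc)
      then show "\<exists>p q r. (q \<noteq> 0 \<or> r \<noteq> 0) \<and> p *s z + q *s (M *v z) + r *s (N *v z) = 0"
        using qr(1) by blast
    qed (simp add: vec4_eq_iff)
    then show ?thesis ..
  qed
qed

text \<open>The functions are the coefficients of \<open>x\<close>, \<open>x\<^sup>2\<close>, \<open>x\<^sup>3\<close> in the logarithm of \<open>z\<^sub>3 + z\<^sub>2 x + z\<^sub>1 x\<^sup>2 + z\<^sub>0 x\<^sup>3\<close>. If the cubic one is absent but the quadratic one is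
  present, the nilpotent parts are proportional on the hyperplane \<open>z\<^sub>3 = 0\<close>, against \<open>nondeg\<close>.\<close>

lemma block_4:
  assumes nd: "nondeg M N" and b: "basis4 e0 e1 e2 e3"
    and M: "M *v e0 = t *s e0" "M *v e1 = t *s e1 + s *s e0" "M *v e2 = t *s e2 + s *s e1 + p *s e0"
      "M *v e3 = t *s e3 + s *s e2 + p *s e1 + q *s e0"
    and N: "N *v e0 = t' *s e0" "N *v e1 = t' *s e1 + s' *s e0" "N *v e2 = t' *s e2 + s' *s e1 + p' *s e0"
      "N *v e3 = t' *s e3 + s' *s e2 + p' *s e1 + q' *s e0"
  shows "has_listed_form M N"
proof -
  obtain \<epsilon> \<beta> \<gamma> where nz: "\<beta> \<noteq> 0 \<or> \<gamma> \<noteq> 0 \<or> \<epsilon> \<noteq> 0"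
    and eq: "s * \<beta> + p * \<gamma> + q * \<epsilon> = 0" "s' * \<beta> + p' * \<gamma> + q' * \<epsilon> = 0"
    using two_equations[of s p q s' p' q'] by blast
  consider (a) "\<epsilon> \<noteq> 0" | (b) "\<epsilon> = 0" "\<gamma> = 0" "\<beta> \<noteq> 0" | (c) "\<epsilon> = 0" "\<gamma> \<noteq> 0" using nz by blast
  then show ?thesis
  proof cases
    case a
    define B C where "B = \<beta> / \<epsilon>" and "C = \<gamma> / \<epsilon>"
    have eq': "s * B + p * C + q = 0" "s' * B + p' * C + q' = 0"
    proof -
      have "s * B + p * C + q = (s * \<beta> + p * \<gamma> + q * \<epsilon>) / \<epsilon>" for s p q
        using a by (simp add: B_def C_def add_divide_distrib)
      then show "s * B + p * C + q = 0" "s' * B + p' * C + q' = 0" using eq by simp_all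
    qed
    \<comment> \<open>the logarithm has the cubic term \<open>z\<^sub>2\<^sup>3 / 3\<close>, whereas \<open>form6\<close> comes from \<open>z\<^sub>2\<^sup>3\<close>\<close>
    obtain k :: complex where k3: "k ^ 3 = 3"
    proof
      show "(of_real (root 3 3) :: complex) ^ 3 = 3"
        by (simp flip: of_real_power)
    qed
    have k3': "k * k * k = 3" using k3 by (simp add: power3_eq_cube)
    have k0: "k \<noteq> 0" using k3' by auto
    define f1 f2 where "f1 = (- 1 / k) *s e1 + (C / k) *s e0"
      and "f2 = k *s e2 + (- (C * k / 2)) *s e1 + ((C * C / 2 - B) * k) *s e0"
    have b': "basis4 e0 f1 f2 e3"
      by (rule basis4_transform[OF b, of "vec4 1 0 0 0" "vec4 (C / k) (- 1 / k) 0 0"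
            "vec4 ((C * C / 2 - B) * k) (- (C * k / 2)) k 0" "vec4 0 0 0 1"])
         (use k0 in \<open>auto simp: basis4_def vec4_eq_iff cols_vec4 f1_def f2_def\<close>)
    have e1: "e1 = (- k) *s f1 + C *s e0" using k0 by (simp add: f1_def vec_eq_iff field_simps)
    have shape: "T *v f1 = t *s f1 + (- (s / k)) *s e0 \<and>
        T *v f2 = t *s f2 + (- 3 * (s / k)) *s f1 + (s * C * k / 2 + p * k) *s e0 \<and>
        T *v e3 = t *s e3 + (s / k) *s f2 + (- (s * C * k / 2 + p * k)) *s f1"
      if T: "T *v e0 = t *s e0" "T *v e1 = t *s e1 + s *s e0" "T *v e2 = t *s e2 + s *s e1 + p *s e0"
        "T *v e3 = t *s e3 + s *s e2 + p *s e1 + q *s e0"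
        and rel: "s * B + p * C + q = 0" for T :: "complex^4^4" and t s p q
    proof (intro conjI)
      show "T *v f1 = t *s f1 + (- (s / k)) *s e0"
        unfolding f1_def mv_linear T by (simp add: vec_eq_iff algebra_simps)
      have "T *v f2 = t *s f2 + (s * k) *s e1 + (p * k - C * k / 2 * s) *s e0"
        unfolding f2_def mv_linear T by (simp add: vec_eq_iff algebra_simps)
      also have "\<dots> = t *s f2 + (- (s * (k * k))) *s f1 + (s * C * k / 2 + p * k) *s e0"
        by (subst e1) (simp add: vec_eq_iff field_simps)
      also have "s * (k * k) = 3 * (s / k)" using k0 k3' by (simp add: field_simps)
      finally show "T *v f2 = t *s f2 + (- 3 * (s / k)) *s f1 + (s * C * k / 2 + p * k) *s e0" by simp
      have e2: "s *s e2 = (s / k) *s f2 + (s * C / 2) *s e1 + (- (s * (C * C / 2 - B))) *s e0"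
        using k0 by (simp add: f2_def vec_eq_iff field_simps)
      have "T *v e3 = t *s e3 + (s / k) *s f2 + (- (s * C * k / 2 + p * k)) *s f1 + (s * B + p * C + q) *s e0"
        unfolding T e2 by (subst (1 2) e1) (simp add: vec_eq_iff field_simps)
      then show "T *v e3 = t *s e3 + (s / k) *s f2 + (- (s * C * k / 2 + p * k)) *s f1"
        unfolding rel by simp
    qed
    note sM = shape[OF M eq'(1)] and sN = shape[OF N eq'(2)]
    show ?thesis
      using nf6[OF b' M(1) _ _ _ N(1)] sM sN by blast
  next
    case b
    then have "s = 0" "s' = 0" using eq by auto
    then show ?thesis
      using nf_ratio[OF \<open>basis4 e0 e1 e2 e3\<close>, of M 0 t t 0 t 0 p p q N 0 t' t' 0 t' 0 p' p' q'] M N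
      by (simp add: add_ac)
  next
    case c
    have pp: "p = - (s * \<beta> / \<gamma>)" "p' = - (s' * \<beta> / \<gamma>)"
      using eq c by (simp_all add: field_simps add_eq_0_iff)
    have "\<exists>u v. (u \<noteq> 0 \<or> v \<noteq> 0) \<and> u * s + v * s' = 0"
    proof (cases "s = 0")
      case True
      then show ?thesis by (intro exI[of _ 1] exI[of _ 0]) simp
    next
      case False
      then show ?thesis by (intro exI[of _ s'] exI[of _ "- s"]) simp
    qed
    then obtain u v where uv: "u \<noteq> 0 \<or> v \<noteq> 0" "u * s + v * s' = 0" by blast
    have "u * p + v * p' = - ((u * s + v * s') * (\<beta> / \<gamma>))" unfolding pp by (simp add: algebra_simps)
    then have up: "u * p + v * p' = 0" using uv(2) by simp
    have False
    proof (rule nondegD[OF nd b, of "vec4 0 0 0 1"])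
      fix w z assume w: "dot (vec4 0 0 0 1) w = 0" and z: "z = w$0 *s e0 + w$1 *s e1 + w$2 *s e2 + w$3 *s e3"
      have w3: "w$3 = 0" using w by (simp add: dot4)
      have "u *s (M *v z) + v *s (N *v z) = (u * t + v * t') *s z + ((u * s + v * s') * w$1) *s e0
          + ((u * s + v * s') * w$2) *s e1 + ((u * p + v * p') * w$2) *s e0"
        unfolding z mv_linear M N by (simp add: w3 vec_eq_iff algebra_simps)
      then have "(- (u * t + v * t')) *s z + u *s (M *v z) + v *s (N *v z) = 0"
        unfolding uv(2) up by (simp add: add.assoc)
      then show "\<exists>p q r. (q \<noteq> 0 \<or> r \<noteq> 0) \<and> p *s z + q *s (M *v z) + r *s (N *v z) = 0"
        using uv(1) by blast
    qed (simp add: vec4_eq_iff)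
    then show ?thesis ..
  qed
qed

section \<open>The affine Lie algebra\<close>

text \<open>On the chain \<open>N\<^sup>3 e, N\<^sup>2 e, N e, e\<close> the matrix \<open>M\<close> is triangular with the eigenvalues \<open>a + 3, a + 2, a + 1, a\<close>. As they are
  distinct, \<open>e\<close> can be corrected to an eigenvector, and then the whole chain consists of eigenvectors.\<close>

lemma affine_type_4:
  assumes comm: "\<And>v. M *v (N *v v) = N *v (M *v v) + N *v v"
    and nil: "\<And>v. N *v (N *v (N *v (N *v v))) = 0" and e: "N *v (N *v (N *v e)) \<noteq> 0"
  shows "has_listed_form M N"
proof -
  let ?e2 = "N *v e" and ?e1 = "N *v (N *v e)" and ?e0 = "N *v (N *v (N *v e))"
  have sc: "c = 0" if "c *s ?e0 = 0" for c using that e by (auto simp: vec_eq_iff)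
  have chain: "basis4 (N *v (N *v (N *v f))) (N *v (N *v f)) (N *v f) f" if f: "N *v (N *v (N *v f)) = ?e0" for f
    unfolding basis4_def
  proof (intro allI impI)
    fix x0 x1 x2 x3
    assume s0: "x0 *s (N *v (N *v (N *v f))) + x1 *s (N *v (N *v f)) + x2 *s (N *v f) + x3 *s f = 0"
    have s1: "x1 *s (N *v (N *v (N *v f))) + x2 *s (N *v (N *v f)) + x3 *s (N *v f) = 0"
      using arg_cong[OF s0, of "(*v) N"] by (simp add: mv_linear nil)
    have s2: "x2 *s (N *v (N *v (N *v f))) + x3 *s (N *v (N *v f)) = 0"
      using arg_cong[OF s1, of "(*v) N"] by (simp add: mv_linear nil)
    have s3: "x3 *s (N *v (N *v (N *v f))) = 0"
      using arg_cong[OF s2, of "(*v) N"] by (simp add: mv_linear nil)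
    have x3: "x3 = 0" by (rule sc) (use s3 f in simp)
    have x2: "x2 = 0" by (rule sc) (use s2 x3 f in simp)
    have x1: "x1 = 0" by (rule sc) (use s1 x2 x3 f in simp)
    have x0: "x0 = 0" by (rule sc) (use s0 x1 x2 x3 f in simp)
    show "x0 = 0 \<and> x1 = 0 \<and> x2 = 0 \<and> x3 = 0" using x0 x1 x2 x3 by simp
  qed
  obtain c0 c1 c2 a where Me: "M *v e = c0 *s ?e0 + c1 *s ?e1 + c2 *s ?e2 + a *s e"
    using basis4_expand[OF chain[OF refl], of "M *v e"] .
  have M2: "M *v ?e2 = c1 *s ?e0 + c2 *s ?e1 + (a + 1) *s ?e2"
    unfolding comm Me mv_linear nil by (simp add: vec_eq_iff algebra_simps)
  have M1: "M *v ?e1 = c2 *s ?e0 + (a + 2) *s ?e1"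
    unfolding comm[of "N *v e"] M2 mv_linear nil by (simp add: vec_eq_iff algebra_simps)
  have M0: "M *v ?e0 = (a + 3) *s ?e0"
    unfolding comm[of "N *v (N *v e)"] M1 mv_linear nil by (simp add: vec_eq_iff algebra_simps)
  define x y z where "x = - c2" and "y = - (c1 + x * c2) / 2" and "z = - (c0 + x * c1 + y * c2) / 3"
  have xyz: "c2 + x = 0" "c1 + x * c2 + 2 * y = 0" "c0 + x * c1 + y * c2 + 3 * z = 0"
  proof -
    have "2 * y = - (c1 + x * c2)" "3 * z = - (c0 + x * c1 + y * c2)" by (simp_all add: y_def z_def)
    then show "c2 + x = 0" "c1 + x * c2 + 2 * y = 0" "c0 + x * c1 + y * c2 + 3 * z = 0"
      by (simp_all add: x_def)
  qed
  define f where "f = e + x *s ?e2 + y *s ?e1 + z *s ?e0"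
  have f3: "N *v (N *v (N *v f)) = ?e0" unfolding f_def mv_linear nil by simp
  have "M *v f = a *s f + (c2 + x) *s ?e2 + (c1 + x * c2 + 2 * y) *s ?e1 + (c0 + x * c1 + y * c2 + 3 * z) *s ?e0"
    unfolding f_def mv_linear Me M2 M1 M0 by (simp add: vec_eq_iff algebra_simps)
  then have Mf: "M *v f = a *s f" unfolding xyz by simp
  have Mf2: "M *v (N *v f) = (a + 1) *s (N *v f)"
    unfolding comm Mf mv_linear by (simp add: vec_eq_iff algebra_simps)
  have Mf1: "M *v (N *v (N *v f)) = (a + 2) *s (N *v (N *v f))"
    unfolding comm[of "N *v f"] Mf2 mv_linear by (simp add: vec_eq_iff algebra_simps)
  have Mf0: "M *v (N *v (N *v (N *v f))) = (a + 3) *s (N *v (N *v (N *v f)))"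
    unfolding comm[of "N *v (N *v f)"] Mf1 mv_linear by (simp add: vec_eq_iff algebra_simps)
  show ?thesis
    by (rule nf7[OF chain[OF f3], of M a N]) (simp_all add: Mf Mf2 Mf1 Mf0 nil)
qed

lemma basis4I:
  assumes ind: "\<And>x1 x2 x3. x1 *s v1 + x2 *s v2 + x3 *s v3 = 0 \<Longrightarrow> x1 = 0 \<and> x2 = 0 \<and> x3 = 0"
    and nu: "\<And>p q r. u \<noteq> p *s v1 + q *s v2 + r *s v3"
  shows "basis4 u v1 v2 v3"
  unfolding basis4_def
proof (intro allI impI)
  fix x0 x1 x2 x3 assume s: "x0 *s u + x1 *s v1 + x2 *s v2 + x3 *s v3 = 0"
  have "x0 = 0"
  proof (rule ccontr)
    assume x0: "x0 \<noteq> 0"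
    have "u = (- x1 / x0) *s v1 + (- x2 / x0) *s v2 + (- x3 / x0) *s v3"
      unfolding vec_eq_iff
    proof
      fix i
      have "x0 * u $ i + x1 * v1 $ i + x2 * v2 $ i + x3 * v3 $ i = 0"
        using arg_cong[OF s, of "\<lambda>t. t $ i"] by simp
      then have "x0 * u $ i = - (x1 * v1 $ i + x2 * v2 $ i + x3 * v3 $ i)"
        by (simp only: eq_neg_iff_add_eq_0 add.assoc)
      then have "u $ i * x0 = - (x1 * v1 $ i + x2 * v2 $ i + x3 * v3 $ i)"
        by (simp only: mult.commute[of "u $ i"])
      then have "u $ i = - (x1 * v1 $ i + x2 * v2 $ i + x3 * v3 $ i) / x0"
        by (rule nonzero_eq_divide_eq[THEN iffD2, OF x0])
      also have "\<dots> = (- x1 / x0) * v1 $ i + (- x2 / x0) * v2 $ i + (- x3 / x0) * v3 $ i"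
        by (simp add: add_divide_distrib diff_divide_distrib)
      finally show "u $ i = ((- x1 / x0) *s v1 + (- x2 / x0) *s v2 + (- x3 / x0) *s v3) $ i"
        by (simp only: vector_add_component vector_smult_component)
    qed
    then show False using nu by blast
  qed
  then show "x0 = 0 \<and> x1 = 0 \<and> x2 = 0 \<and> x3 = 0" using s ind[of x1 x2 x3] by simp
qed

lemma basis4_extend:
  assumes ind: "\<And>x1 x2 x3. x1 *s v1 + x2 *s v2 + x3 *s v3 = 0 \<Longrightarrow> x1 = 0 \<and> x2 = 0 \<and> x3 = 0"
  shows "\<exists>u. basis4 u v1 v2 v3"
proof -
  have "\<exists>u. \<forall>p q r. u \<noteq> p *s v1 + q *s v2 + r *s v3"
  proof (rule ccontr)
    assume "\<not> ?thesis"
    then have all: "\<exists>p q r. u = p *s v1 + q *s v2 + r *s v3" for u by blast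
    have "u \<in> vec.span {v1, v2, v3}" for u
    proof -
      obtain p q r where u: "u = p *s v1 + q *s v2 + r *s v3" using all by blast
      show ?thesis unfolding u by (intro vec.span_add vec.span_scale vec.span_base) auto
    qed
    then have "vec.dim (UNIV :: (complex^4) set) \<le> card {v1, v2, v3}"
      by (intro vec.dim_le_card) auto
    moreover have "card {v1, v2, v3} \<le> 3" by (simp add: card_insert_if)
    ultimately show False by (simp add: card_cart_basis)
  qed
  then show ?thesis using basis4I[OF ind] by blast
qed

text \<open>The generator \<open>e\<close> of the chain is corrected to an eigenvector of \<open>M\<close> as far as the eigenvalues permit. The two
  resonances \<open>b = a\<close> and \<open>b = a + 2\<close> with the eigenvalue \<open>b\<close> of the kernel vector \<open>u\<close> leave a term that gives a
  separate normal form.\<close>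

lemma affine_type_31_aux:
  assumes comm: "\<And>v. M *v (N *v v) = N *v (M *v v) + N *v v"
    and nil: "\<And>v. N *v (N *v (N *v v)) = 0" and b: "basis4 u (N *v (N *v e)) (N *v e) e"
    and Nu: "N *v u = 0" and Mu: "M *v u = b *s u + f *s (N *v (N *v e))"
    and Me: "M *v e = d *s u + c1 *s (N *v (N *v e)) + c2 *s (N *v e) + a *s e"
    and f: "f = 0 \<or> b = a + 2"
  shows "has_listed_form M N"
proof -
  let ?e2 = "N *v e" and ?e1 = "N *v (N *v e)"
  have M2: "M *v ?e2 = c2 *s ?e1 + (a + 1) *s ?e2"
    unfolding comm Me mv_linear nil Nu by (simp add: vec_eq_iff algebra_simps)
  have M1: "M *v ?e1 = (a + 2) *s ?e1"
    unfolding comm[of "N *v e"] M2 mv_linear nil by (simp add: vec_eq_iff algebra_simps)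
  define w where "w = (if b = a then 0 else d / (a - b))"
  define d' where "d' = d + w * (b - a)"
  have d': "d' = 0 \<or> b = a"
  proof (cases "b = a")
    case False
    then have "w * (a - b) = d" by (simp add: w_def)
    then show ?thesis by (simp add: d'_def algebra_simps)
  qed simp
  define x y where "x = - c2" and "y = - (c1 + x * c2 + w * f) / 2"
  have xy: "c2 + x = 0" "c1 + x * c2 + w * f + 2 * y = 0"
    by (simp_all add: x_def y_def)
  define g where "g = e + x *s ?e2 + y *s ?e1 + w *s u"
  have Ng: "N *v g = ?e2 + x *s ?e1" "N *v (N *v g) = ?e1"
    unfolding g_def by (simp_all add: mv_linear nil Nu)
  have "M *v g = a *s g + d' *s u + (c2 + x) *s ?e2 + (c1 + x * c2 + w * f + 2 * y) *s ?e1"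
    unfolding g_def mv_linear Me M2 M1 Mu d'_def by (simp add: vec_eq_iff algebra_simps)
  then have Mg: "M *v g = a *s g + d' *s u" unfolding xy by simp
  have Mg2: "M *v (N *v g) = (a + 1) *s (N *v g)"
    unfolding comm Mg mv_linear Nu by (simp add: vec_eq_iff algebra_simps)
  define h where "h = (1 / 2) *s (N *v (N *v g))"
  have NNg: "N *v (N *v g) = 2 *s h" by (simp add: h_def)
  have Mh: "M *v h = (a + 2) *s h" unfolding h_def Ng(2) mv_linear M1 by (simp add: vec_eq_iff algebra_simps add_divide_distrib)
  have Nh: "N *v h = 0" unfolding h_def mv_linear nil by simp
  have bs: "basis4 (k *s u) h (N *v g) g" if "k \<noteq> 0" for k
    by (rule basis4_transform[OF b, of "vec4 k 0 0 0" "vec4 0 (1 / 2) 0 0" "vec4 0 x 1 0" "vec4 w y x 1"])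
       (use that in \<open>simp add: basis4_def vec4_eq_iff\<close>, simp add: cols_vec4, simp add: cols_vec4 h_def Ng(2),
         simp add: cols_vec4 Ng(1), simp add: cols_vec4 g_def add_ac)
  consider (8) "d' = 0" "f = 0" | (10) "d' = 0" "f \<noteq> 0" "b = a + 2" | (9) "d' \<noteq> 0" "b = a" "f = 0"
    using f d' by auto
  then show ?thesis
  proof cases
    case 8
    show ?thesis
      by (rule nf8[OF bs[of 1], of M b a N]) (simp_all add: 8 Mu Mh Mg2 Mg Nu Nh NNg mv_linear)
  next
    case 10
    have "M *v ((1 / f) *s u) = (a + 2) *s ((1 / f) *s u) + (1 / f * f) *s (2 *s h)"
      unfolding mv_linear Mu 10(3) NNg[symmetric] Ng(2) by (simp add: vec_eq_iff algebra_simps add_divide_distrib)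
    then have "M *v ((1 / f) *s u) = (a + 2) *s ((1 / f) *s u) + 2 *s h" using 10(2) by simp
    then show ?thesis
      by (intro nf10[OF bs[of "1 / f"], of M a N])
         (use 10 in \<open>simp_all add: Mh Mg2 Mg Nu Nh NNg mv_linear add.commute\<close>)
  next
    case 9
    show ?thesis
      by (rule nf9[OF bs[of "d' / 2"], of M a N])
         (use 9 in \<open>simp_all add: Mu Mh Mg2 Mg Nu Nh NNg mv_linear mult.commute\<close>)
  qed
qed

lemma affine_type_31:
  assumes comm: "\<And>v. M *v (N *v v) = N *v (M *v v) + N *v v"
    and nil: "\<And>v. N *v (N *v (N *v v)) = 0" and e: "N *v (N *v e) \<noteq> 0"
  shows "has_listed_form M N"
proof -
  let ?e2 = "N *v e" and ?e1 = "N *v (N *v e)"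
  have sc: "c = 0" if "c *s ?e1 = 0" for c using that e by (auto simp: vec_eq_iff)
  have ind: "x1 = 0 \<and> x2 = 0 \<and> x3 = 0" if s0: "x1 *s ?e1 + x2 *s ?e2 + x3 *s e = 0" for x1 x2 x3
  proof -
    have s1: "x2 *s ?e1 + x3 *s ?e2 = 0"
      using arg_cong[OF s0, of "(*v) N"] by (simp add: mv_linear nil)
    have s2: "x3 *s ?e1 = 0"
      using arg_cong[OF s1, of "(*v) N"] by (simp add: mv_linear nil)
    have x3: "x3 = 0" by (rule sc[OF s2])
    have x2: "x2 = 0" by (rule sc) (use s1 x3 in simp)
    have x1: "x1 = 0" by (rule sc) (use s0 x2 x3 in simp)
    show ?thesis using x1 x2 x3 by simp
  qed
  have "\<exists>u0. basis4 u0 ?e1 ?e2 e" by (rule basis4_extend) (rule ind)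
  then obtain u0 where u0: "basis4 u0 ?e1 ?e2 e" by (elim exE)
  obtain s p q r where Nu0: "N *v u0 = s *s u0 + p *s ?e1 + q *s ?e2 + r *s e"
    using basis4_expand[OF u0, of "N *v u0"] .
  have N2: "N *v (N *v u0) = (s * s) *s u0 + (s * p + q) *s ?e1 + (s * q + r) *s ?e2 + (s * r) *s e"
    unfolding Nu0 mv_linear nil by (simp add: vec_eq_iff algebra_simps)
  have "(s * s * s) *s u0 + (s * s * p + s * q + r) *s ?e1 + (s * s * q + s * r) *s ?e2 + (s * s * r) *s e
      = N *v (N *v (N *v u0))"
    unfolding N2 mv_linear nil Nu0 by (simp add: vec_eq_iff algebra_simps)
  then have "(s * s * s) *s u0 + (s * s * p + s * q + r) *s ?e1 + (s * s * q + s * r) *s ?e2 + (s * s * r) *s e = 0"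
    unfolding nil .
  then have "s * s * s = 0" "s * s * p + s * q + r = 0" using u0 unfolding basis4_def by blast+
  then have s0: "s = 0" and r0: "r = 0" by auto
  \<comment> \<open>The vector outside the Jordan chain is corrected to lie in the kernel of \<open>N\<close>.\<close>
  define u where "u = u0 + (- p) *s ?e2 + (- q) *s e"
  have Nu: "N *v u = 0" unfolding u_def mv_linear Nu0 s0 r0 by (simp add: vec_eq_iff)
  have bu: "basis4 u ?e1 ?e2 e"
    by (rule basis4_transform[OF u0, of "vec4 1 0 (- p) (- q)" "vec4 0 1 0 0" "vec4 0 0 1 0" "vec4 0 0 0 1"])
       (auto simp: basis4_def vec4_eq_iff cols_vec4 u_def)
  obtain d c1 c2 a where Me: "M *v e = d *s u + c1 *s ?e1 + c2 *s ?e2 + a *s e"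
    using basis4_expand[OF bu, of "M *v e"] .
  obtain b f g h where Mu: "M *v u = b *s u + f *s ?e1 + g *s ?e2 + h *s e"
    using basis4_expand[OF bu, of "M *v u"] .
  have "N *v (M *v u) = 0" using comm[of u] by (simp add: Nu mv_linear)
  then have "0 *s u + g *s ?e1 + h *s ?e2 + 0 *s e = 0" unfolding Mu mv_linear Nu nil by simp
  then have "g = 0" "h = 0" using bu unfolding basis4_def by blast+
  then have Mu': "M *v u = b *s u + f *s ?e1" using Mu by simp
  show ?thesis
  proof (cases "b = a + 2")
    case True
    then show ?thesis by (intro affine_type_31_aux[OF comm nil bu Nu Mu' Me]) simp
  next
    case False
    define k where "k = f / (b - a - 2)"
    have k: "f = k * (b - a - 2)" using False by (simp add: k_def diff_diff_eq)
    define u' where "u' = u + k *s ?e1"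
    have bu': "basis4 u' ?e1 ?e2 e"
      by (rule basis4_transform[OF bu, of "vec4 1 k 0 0" "vec4 0 1 0 0" "vec4 0 0 1 0" "vec4 0 0 0 1"])
         (auto simp: basis4_def vec4_eq_iff cols_vec4 u'_def)
    have M2: "M *v ?e2 = c2 *s ?e1 + (a + 1) *s ?e2"
      unfolding comm Me mv_linear nil Nu by (simp add: vec_eq_iff algebra_simps)
    have M1: "M *v ?e1 = (a + 2) *s ?e1"
      unfolding comm[of "N *v e"] M2 mv_linear nil by (simp add: vec_eq_iff algebra_simps)
    have Mu'': "M *v u' = b *s u' + 0 *s ?e1"
      unfolding u'_def mv_linear Mu' M1 k by (simp add: vec_eq_iff algebra_simps)
    have Me': "M *v e = d *s u' + (c1 - d * k) *s ?e1 + c2 *s ?e2 + a *s e"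
      unfolding Me u'_def by (simp add: vec_eq_iff algebra_simps)
    have Nu': "N *v u' = 0" unfolding u'_def mv_linear nil Nu by simp
    show ?thesis by (rule affine_type_31_aux[OF comm nil bu' Nu' Mu'' Me']) simp
  qed
qed

text \<open>Again the generators \<open>v\<close> and \<open>w\<close> of the two chains are corrected by elements of the kernel of \<open>N\<close>. There remain a
  resonance \<open>b = a + 1\<close> and a Jordan block for \<open>a = b\<close>. The resonance \<open>a = b + 1\<close> is the first one with the chains
  exchanged.\<close>

lemma affine_type_22_aux:
  assumes comm: "\<And>v. M *v (N *v v) = N *v (M *v v) + N *v v"
    and nil: "\<And>v. N *v (N *v v) = 0" and bas: "basis4 (N *v v) (N *v w) v w"
    and Mv: "M *v v = q0 *s (N *v v) + q1 *s (N *v w) + a *s v"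
    and Mw: "M *v w = q2 *s (N *v v) + q3 *s (N *v w) + j *s v + b *s w"
    and j: "j = 0 \<or> a = b" and ab: "b + 1 \<noteq> a"
  shows "has_listed_form M N"
proof -
  have MNv: "M *v (N *v v) = (a + 1) *s (N *v v)"
    unfolding comm Mv mv_linear nil by (simp add: vec_eq_iff algebra_simps)
  have MNw: "M *v (N *v w) = j *s (N *v v) + (b + 1) *s (N *v w)"
    unfolding comm Mw mv_linear nil by (simp add: vec_eq_iff algebra_simps)
  define y x t where "y = - q1 / (b + 1 - a)" and "x = - q0 - y * j" and "t = j * y - q3"
  define u where "u = (if a + 1 = b then 0 else (j * x - q2 - t * j) / (a + 1 - b))"
  define Q where "Q = q2 + u * (a + 1 - b) + t * j - j * x"
  have y: "q1 + y * (b + 1 - a) = 0" using ab by (simp add: y_def)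
  have xt: "q0 + x + y * j = 0" "q3 + t - j * y = 0" by (simp_all add: x_def t_def)
  have Q: "Q = 0 \<or> a + 1 = b"
    by (cases "a + 1 = b") (simp_all add: Q_def u_def)
  define v' w' where "v' = v + x *s (N *v v) + y *s (N *v w)" and "w' = w + u *s (N *v v) + t *s (N *v w)"
  have N': "N *v v' = N *v v" "N *v w' = N *v w"
    by (simp_all add: v'_def w'_def mv_linear nil)
  have "M *v v' = a *s v' + (q0 + x + y * j) *s (N *v v) + (q1 + y * (b + 1 - a)) *s (N *v w)"
    unfolding v'_def mv_linear Mv MNv MNw by (simp add: vec_eq_iff algebra_simps)
  then have Mv': "M *v v' = a *s v'" unfolding xt y by simp
  have "M *v w' = b *s w' + j *s v' + Q *s (N *v v) + (q3 + t - j * y) *s (N *v w)"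
    unfolding v'_def w'_def mv_linear Mw MNv MNw Q_def by (simp add: vec_eq_iff algebra_simps)
  then have Mw': "M *v w' = b *s w' + j *s v' + Q *s (N *v v)" unfolding xt by simp
  have b': "basis4 (k *s (N *v v)) (N *v w) (k *s v') w'" if "k \<noteq> 0" for k
    by (rule basis4_transform[OF bas, of "vec4 k 0 0 0" "vec4 0 1 0 0" "vec4 (k * x) (k * y) k 0" "vec4 u t 0 1"])
       (use that in \<open>auto simp: basis4_def vec4_eq_iff cols_vec4 v'_def w'_def vector_add_ldistrib add_ac\<close>)
  consider (12) "j = 0" "Q = 0" | (11) "Q \<noteq> 0" "b = a + 1" "j = 0" | (13) "Q = 0" "j \<noteq> 0" "a = b"
    using j Q by (cases "a = b") auto
  then show ?thesis
  proof cases
    case 12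
    show ?thesis
      by (rule nf12[OF b'[of 1], of M a b N]) (use 12 in \<open>simp_all add: Mv' Mw' MNv MNw N' nil mv_linear\<close>)
  next
    case 11
    show ?thesis
      by (rule nf11[OF b'[of Q], of M a N])
         (use 11 in \<open>simp_all add: Mv' Mw' MNv MNw N' nil mv_linear vector_sadd_rdistrib distrib_left mult.commute\<close>)
  next
    case 13
    show ?thesis
      by (rule nf13[OF b'[of j], of M a N])
         (use 13 in \<open>simp_all add: Mv' Mw' MNv MNw N' nil mv_linear vector_sadd_rdistrib distrib_left mult.commute add.commute\<close>)
  qed
qed

lemma singular_pair:
  fixes p q r s :: complex
  assumes "p * s - q * r = 0"
  shows "\<exists>x y. (x \<noteq> 0 \<or> y \<noteq> 0) \<and> p * x + q * y = 0 \<and> r * x + s * y = 0"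
proof (cases "p = 0 \<and> q = 0")
  case True
  show ?thesis
  proof (cases "s = 0")
    case True
    then show ?thesis using \<open>p = 0 \<and> q = 0\<close> by (intro exI[of _ 0] exI[of _ 1]) simp
  next
    case False
    then show ?thesis using \<open>p = 0 \<and> q = 0\<close>
      by (intro exI[of _ "- s"] exI[of _ r]) (simp add: algebra_simps)
  qed
next
  case False
  then show ?thesis using assms
    by (intro exI[of _ "- q"] exI[of _ p]) (auto simp: algebra_simps)
qed

lemma affine_type_22:
  assumes comm: "\<And>v. M *v (N *v v) = N *v (M *v v) + N *v v"
    and nil: "\<And>v. N *v (N *v v) = 0" and bas: "basis4 (N *v v) (N *v w) v w"
  shows "has_listed_form M N"
proof -
  obtain p0 p1 p r where Mv: "M *v v = p0 *s (N *v v) + p1 *s (N *v w) + p *s v + r *s w"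
    using basis4_expand[OF bas, of "M *v v"] .
  obtain p2 p3 q s where Mw: "M *v w = p2 *s (N *v v) + p3 *s (N *v w) + q *s v + s *s w"
    using basis4_expand[OF bas, of "M *v w"] .
  \<comment> \<open>\<open>M\<close> acts on the quotient by the kernel of \<open>N\<close>; an eigenvector there is extended to a basis
    that triangulates this action.\<close>
  have "\<exists>a. (p - a) * (s - a) - q * r = 0"
  proof -
    have "\<exists>a. poly [:p * s - q * r, - (p + s), 1:] a = 0"
      by (rule alg_closed_imp_poly_has_root) simp
    then show ?thesis by (auto simp: algebra_simps)
  qed
  then obtain a where a: "(p - a) * (s - a) - q * r = 0" by blast
  have "\<exists>x y. (x \<noteq> 0 \<or> y \<noteq> 0) \<and> (p - a) * x + q * y = 0 \<and> r * x + (s - a) * y = 0"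
    using a by (rule singular_pair)
  then obtain x y where xy: "x \<noteq> 0 \<or> y \<noteq> 0" "(p - a) * x + q * y = 0" "r * x + (s - a) * y = 0" by blast
  define v1 where "v1 = x *s v + y *s w"
  define x' y' where "x' = (if x \<noteq> 0 then 0 else 1 :: complex)" and "y' = (if x \<noteq> 0 then 1 else 0 :: complex)"
  define w1 where "w1 = x' *s v + y' *s w"
  have det: "x * y' - y * x' \<noteq> 0" using xy(1) by (auto simp: x'_def y'_def)
  have b1: "basis4 (N *v v1) (N *v w1) v1 w1"
  proof (rule basis4_transform[OF bas, of "vec4 x y 0 0" "vec4 x' y' 0 0" "vec4 0 0 x y" "vec4 0 0 x' y'"])
    show "basis4 (vec4 x y 0 0) (vec4 x' y' 0 0) (vec4 0 0 x y) (vec4 0 0 x' y')"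
      using xy(1) unfolding basis4_def by (auto simp: vec4_eq_iff x'_def y'_def)
  qed (simp_all add: cols_vec4 v1_def w1_def mv_linear)
  obtain q2 q3 j b where Mw1: "M *v w1 = q2 *s (N *v v1) + q3 *s (N *v w1) + j *s v1 + b *s w1"
    using basis4_expand[OF b1, of "M *v w1"] .
  obtain q0 q1 where Mv1: "M *v v1 = q0 *s (N *v v1) + q1 *s (N *v w1) + a *s v1"
  proof -
    define K where "K = (x * p0 + y * p2) *s (N *v v) + (x * p1 + y * p3) *s (N *v w)"
    have "M *v v1 = K + a *s v1 + ((p - a) * x + q * y) *s v + (r * x + (s - a) * y) *s w"
      unfolding v1_def K_def mv_linear Mv Mw by (simp add: vec_eq_iff algebra_simps)
    then have e: "M *v v1 = K + a *s v1" unfolding xy by simp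
    have NK: "N *v K = 0" by (simp add: K_def mv_linear nil)
    obtain k0 k1 k2 k3 where K: "K = k0 *s (N *v v1) + k1 *s (N *v w1) + k2 *s v1 + k3 *s w1"
      using basis4_expand[OF b1, of K] .
    have "k2 *s (N *v v1) + k3 *s (N *v w1) + 0 *s v1 + 0 *s w1 = 0"
      using NK unfolding K mv_linear nil by simp
    then have "k2 = 0" "k3 = 0" using b1 unfolding basis4_def by blast+
    then show ?thesis using that[of k0 k1] e K by simp
  qed
  show ?thesis
  proof (cases "a = b")
    case True
    then show ?thesis by (intro affine_type_22_aux[OF comm nil b1 Mv1 Mw1]) simp_all
  next
    case False
    define k where "k = j / (b - a)"
    have k: "j = k * (b - a)" using False by (simp add: k_def)
    define w2 where "w2 = w1 + k *s v1"
    have b2: "basis4 (N *v v1) (N *v w2) v1 w2"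
      by (rule basis4_transform[OF b1, of "vec4 1 0 0 0" "vec4 k 1 0 0" "vec4 0 0 1 0" "vec4 0 0 k 1"])
         (auto simp: basis4_def vec4_eq_iff cols_vec4 w2_def mv_linear)
    have Mv2: "M *v v1 = (q0 - q1 * k) *s (N *v v1) + q1 *s (N *v w2) + a *s v1"
      unfolding Mv1 w2_def mv_linear by (simp add: vec_eq_iff algebra_simps)
    have Mw2: "M *v w2 = (q2 + k * q0 - k * (q3 + k * q1)) *s (N *v v1) + (q3 + k * q1) *s (N *v w2) + 0 *s v1 + b *s w2"
      unfolding w2_def mv_linear Mv1 Mw1 k by (simp add: vec_eq_iff algebra_simps)
    show ?thesis
    proof (cases "b + 1 = a")
      case False
      then show ?thesis by (intro affine_type_22_aux[OF comm nil b2 Mv2 Mw2]) simp_all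
    next
      case True
      have ab: "a + 1 \<noteq> b"
      proof
        assume "a + 1 = b"
        then have "b + 1 + 1 = b" using True by (simp only:)
        then show False by simp
      qed
      have b3: "basis4 (N *v w2) (N *v v1) w2 v1" using basis4_swap(1,3) b2 by blast
      show ?thesis
        by (rule affine_type_22_aux[OF comm nil b3, of "q3 + k * q1" "q2 + k * q0 - k * (q3 + k * q1)" b q1 "q0 - q1 * k" 0 a])
           (use Mv2 Mw2 ab in \<open>simp_all add: add_ac\<close>)
    qed
  qed
qed

text \<open>It remains to show that \<open>N\<close> has rank at least two if \<open>N\<^sup>2 = 0\<close>. If the rank is at most one, take the hyperplane
  on which a nonzero row of \<open>N\<close> vanishes: \<open>N\<close> is zero there, contrary to \<open>nondeg\<close>.\<close>

lemma affine_classification: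
  assumes nd: "nondeg M N" and comm: "\<And>v. M *v (N *v v) = N *v (M *v v) + N *v v"
  shows "has_listed_form M N"
proof -
  obtain d where "\<forall>v. ((*v) N ^^ d) v = 0" using commutator_nilpotent[OF comm] by blast
  then have nil4: "N *v (N *v (N *v (N *v v))) = 0" for v by (rule nilpotent_power4)
  consider (4) e where "N *v (N *v (N *v e)) \<noteq> 0"
    | (31) e where "\<And>v. N *v (N *v (N *v v)) = 0" "N *v (N *v e) \<noteq> 0"
    | (22) "\<And>v. N *v (N *v v) = 0" by metis
  then show ?thesis
  proof cases
    case 4
    then show ?thesis by (rule affine_type_4[OF comm nil4])
  next
    case 31
    then show ?thesis by (rule affine_type_31[OF comm])
  next
    case 22
    have "\<exists>v w. \<forall>x y. x *s (N *v v) + y *s (N *v w) = 0 \<longrightarrow> x = 0 \<and> y = 0"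
    proof (rule ccontr)
      assume no: "\<not> ?thesis"
      have N0: "N \<noteq> 0"
      proof
        assume "N = 0"
        moreover have "axis 0 1 \<noteq> (0 :: complex^4)" by (simp add: vec_eq_iff axis_def)
        then obtain z where "indep3 z (M *v z) (N *v z)" using nd unfolding nondeg_def by blast
        ultimately have "(0::complex) = 0 \<and> (0::complex) = 0 \<and> (1::complex) = 0"
          unfolding indep3_def by (metis add.right_neutral matrix_vector_mult_0 vec.scale_zero_left vec.scale_zero_right)
        then show False by simp
      qed
      then obtain i where i: "N $ i \<noteq> 0" by (metis vec_eq_iff zero_index)
      have row: "dot (N $ i) z = (N *v z) $ i" for z
        by (simp add: dot_def matrix_vector_mult_def)
      obtain z where z: "dot (N $ i) z = 0" "indep3 z (M *v z) (N *v z)"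
        using nd i unfolding nondeg_def by blast
      have "\<not> (\<forall>v. dot (N $ i) v = 0)" using i dot_eq_zeroD by blast
      then obtain v where v: "(N *v v) $ i \<noteq> 0" unfolding row by blast
      obtain x y where xy: "x *s (N *v v) + y *s (N *v z) = 0" "\<not> (x = 0 \<and> y = 0)"
        using no by blast
      have "x * (N *v v) $ i + y * (N *v z) $ i = 0"
        using arg_cong[OF xy(1), of "\<lambda>t. t $ i"] by simp
      then have "x = 0" using z(1) v unfolding row by simp
      then have "0 *s z + 0 *s (M *v z) + y *s (N *v z) = 0" "y \<noteq> 0" using xy by simp_all
      then show False using z(2) unfolding indep3_def by blast
    qed
    then obtain v w where vw: "\<And>x y. x *s (N *v v) + y *s (N *v w) = 0 \<Longrightarrow> x = 0 \<and> y = 0" by blast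
    have "basis4 (N *v v) (N *v w) v w"
      unfolding basis4_def
    proof (intro allI impI)
      fix x0 x1 x2 x3 assume s: "x0 *s (N *v v) + x1 *s (N *v w) + x2 *s v + x3 *s w = 0"
      have "x2 *s (N *v v) + x3 *s (N *v w) = 0"
        using arg_cong[OF s, of "(*v) N"] by (simp add: mv_linear 22)
      then have "x2 = 0 \<and> x3 = 0" by (rule vw)
      moreover from this have "x0 *s (N *v v) + x1 *s (N *v w) = 0" using s by simp
      then have "x0 = 0 \<and> x1 = 0" by (rule vw)
      ultimately show "x0 = 0 \<and> x1 = 0 \<and> x2 = 0 \<and> x3 = 0" by blast
    qed
    then show ?thesis by (rule affine_type_22[OF comm 22])
  qed
qed

section \<open>Commuting pairs\<close>

lemma quadratic_roots: "\<exists>r1 r2 :: complex. b = r1 + r2 \<and> c = - (r1 * r2)"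
proof -
  have "\<exists>r. poly [:- c, - b, 1:] r = 0" by (rule alg_closed_imp_poly_has_root) simp
  then obtain r where r: "poly [:- c, - b, 1:] r = 0" by (elim exE)
  have "b = r + (b - r)" "c = - (r * (b - r))" using r by (simp_all add: algebra_simps)
  then show ?thesis by (intro exI conjI)
qed

lemma cubic_roots:
  "\<exists>r1 r2 r3 :: complex. k2 = r1 + r2 + r3 \<and> k1 = - (r1 * r2 + r1 * r3 + r2 * r3) \<and> k0 = r1 * r2 * r3"
proof -
  have "\<exists>r. poly [:- k0, - k1, - k2, 1:] r = 0" by (rule alg_closed_imp_poly_has_root) simp
  then obtain r where r: "poly [:- k0, - k1, - k2, 1:] r = 0" by (elim exE)
  obtain r2 r3 where q: "k2 - r = r2 + r3" "k1 + r * (k2 - r) = - (r2 * r3)"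
    using quadratic_roots[of "k2 - r" "k1 + r * (k2 - r)"] by (elim exE conjE)
  have 2: "k2 = r + r2 + r3" using q(1) by (simp add: algebra_simps)
  have 1: "k1 = - (r * r2 + r * r3 + r2 * r3)" using q(2) unfolding 2 by (simp add: algebra_simps)
  have "k0 = r * r * r - k2 * r * r - k1 * r" using r by (simp add: algebra_simps)
  also have "\<dots> = r * r2 * r3" unfolding 1 2 by (simp add: algebra_simps)
  finally show ?thesis using 1 2 by (intro exI conjI)
qed

text \<open>Here \<open>e\<close> and the span of \<open>f\<close>, \<open>u = M f\<close>, \<open>v = M\<^sup>2 f\<close> are invariant, and \<open>N = M\<^sup>2\<close> on the latter. The vectors
  \<open>(M - r\<^sub>2) (M - r\<^sub>3) f\<close> etc., for the roots of the characteristic polynomial, give the Jordan bases.\<close>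

lemma abelian_split:
  assumes nd: "nondeg M N" and b: "basis4 e f u v"
    and e: "M *v e = 0" "N *v e = \<alpha> *s e"
    and M: "M *v f = u" "M *v u = v" "M *v v = k0 *s f + k1 *s u + k2 *s v"
    and N: "N *v f = M *v (M *v f)" "N *v u = M *v (M *v u)" "N *v v = M *v (M *v v)"
  shows "has_listed_form M N"
proof -
  have N': "N *v f = v" "N *v u = k0 *s f + k1 *s u + k2 *s v"
    "N *v v = k0 *s u + k1 *s v + k2 *s (k0 *s f + k1 *s u + k2 *s v)"
    unfolding N M mv_linear by simp_all
  obtain r1 r2 r3 where k: "k2 = r1 + r2 + r3" "k1 = - (r1 * r2 + r1 * r3 + r2 * r3)" "k0 = r1 * r2 * r3"
    using cubic_roots[of k2 k1 k0] by (elim exE conjE)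
  show ?thesis
  proof (cases "r1 \<noteq> r2 \<and> r1 \<noteq> r3 \<and> r2 \<noteq> r3")
    case True
    define g where "g = (\<lambda>p q. (p * q) *s f + (- (p + q)) *s u + 1 *s v)"
    have P: "basis4 (vec4 1 0 0 0) (vec4 0 (r2 * r3) (- (r2 + r3)) 1) (vec4 0 (r1 * r3) (- (r1 + r3)) 1)
        (vec4 0 (r1 * r2) (- (r1 + r2)) 1)"
      unfolding basis4_def
    proof (intro allI impI)
      fix x0 x1 x2 x3
      assume "x0 *s vec4 1 0 0 0 + x1 *s vec4 0 (r2 * r3) (- (r2 + r3)) 1 + x2 *s vec4 0 (r1 * r3) (- (r1 + r3)) 1
        + x3 *s vec4 0 (r1 * r2) (- (r1 + r2)) 1 = 0"
      then have x: "x0 = 0" "x1 * (r2 * r3) + x2 * (r1 * r3) + x3 * (r1 * r2) = 0"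
        "x1 * (- (r2 + r3)) + x2 * (- (r1 + r3)) + x3 * (- (r1 + r2)) = 0" "x1 + x2 + x3 = 0"
        by (simp_all add: vec4_eq_iff)
      let ?U = "x1 * (r2 * r3) + x2 * (r1 * r3) + x3 * (r1 * r2)"
        and ?T = "x1 * (- (r2 + r3)) + x2 * (- (r1 + r3)) + x3 * (- (r1 + r2))" and ?S = "x1 + x2 + x3"
      have "x1 * ((r1 - r2) * (r1 - r3)) = ?S * (r1 * r1) + ?T * r1 + ?U"
        "x2 * ((r2 - r1) * (r2 - r3)) = ?S * (r2 * r2) + ?T * r2 + ?U"
        "x3 * ((r3 - r1) * (r3 - r2)) = ?S * (r3 * r3) + ?T * r3 + ?U" by (simp_all add: algebra_simps)
      then show "x0 = 0 \<and> x1 = 0 \<and> x2 = 0 \<and> x3 = 0" using True unfolding x by auto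
    qed
    have b': "basis4 e (g r2 r3) (g r1 r3) (g r1 r2)"
      by (rule basis4_transform[OF b P]) (simp_all add: cols_vec4 g_def)
    show ?thesis
      by (rule nf_diagonal[OF b', of M 0 r1 r2 r3 N \<alpha> "r1 * r1" "r2 * r2" "r3 * r3"])
         (simp add: e, unfold g_def e M N' mv_linear k, simp_all add: vec_eq_iff algebra_simps)
  next
    case False
    have "\<exists>p r. k2 = p + r + r \<and> k1 = - (p * r + p * r + r * r) \<and> k0 = p * r * r"
    proof -
      consider "r1 = r2" | "r1 = r3" | "r2 = r3" using False by blast
      then show ?thesis
      proof cases
        case 1
        then show ?thesis by (intro exI[of _ r3] exI[of _ r1]) (simp add: k algebra_simps)
      next
        case 2
        then show ?thesis by (intro exI[of _ r2] exI[of _ r1]) (simp add: k algebra_simps)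
      next
        case 3
        then show ?thesis by (intro exI[of _ r1] exI[of _ r2]) (simp add: k algebra_simps)
      qed
    qed
    then obtain p r where k: "k2 = p + r + r" "k1 = - (p * r + p * r + r * r)" "k0 = p * r * r"
      by (elim exE conjE)
    define e1 where "e1 = (r * r) *s f + (- (2 * r)) *s u + 1 *s v"
    show ?thesis
    proof (cases "p = r")
      case False
      define e2 e3 where "e2 = (p * r) *s f + (- (p + r)) *s u + 1 *s v" and "e3 = (- p) *s f + 1 *s u"
      have P: "basis4 (vec4 1 0 0 0) (vec4 0 (r * r) (- (2 * r)) 1) (vec4 0 (p * r) (- (p + r)) 1) (vec4 0 (- p) 1 0)"
        unfolding basis4_def
      proof (intro allI impI)
        fix x0 x1 x2 x3
        assume "x0 *s vec4 1 0 0 0 + x1 *s vec4 0 (r * r) (- (2 * r)) 1 + x2 *s vec4 0 (p * r) (- (p + r)) 1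
          + x3 *s vec4 0 (- p) 1 0 = 0"
        then have x: "x0 = 0" "x1 * (r * r) + x2 * (p * r) - x3 * p = 0"
          "- (x1 * (2 * r)) - x2 * (p + r) + x3 = 0" "x1 + x2 = 0"
          by (simp_all add: vec4_eq_iff algebra_simps)
        let ?U = "x1 * (r * r) + x2 * (p * r) - x3 * p"
          and ?T = "- (x1 * (2 * r)) - x2 * (p + r) + x3" and ?S = "x1 + x2"
        have "x1 * ((p - r) * (p - r)) = ?S * (p * p) + ?T * p + ?U"
          "x3 * (r - p) = ?S * (r * r) + ?T * r + ?U" by (simp_all add: algebra_simps)
        then have "x1 = 0" "x3 = 0" using False unfolding x by simp_all
        then show "x0 = 0 \<and> x1 = 0 \<and> x2 = 0 \<and> x3 = 0" using x by simp
      qed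
      have b': "basis4 e e1 e2 e3"
        by (rule basis4_transform[OF b P]) (simp_all add: cols_vec4 e1_def e2_def e3_def)
      show ?thesis
        by (rule block_211[OF b', of M 0 p r 1 N \<alpha> "p * p" "r * r" "2 * r"])
           (simp add: e, unfold e1_def e2_def e3_def e M N' mv_linear k, simp_all add: vec_eq_iff algebra_simps)
    next
      case True
      define e2 where "e2 = (- r) *s f + 1 *s u"
      have b': "basis4 e e1 e2 f"
        by (rule basis4_transform[OF b, of "vec4 1 0 0 0" "vec4 0 (r * r) (- (2 * r)) 1" "vec4 0 (- r) 1 0" "vec4 0 1 0 0"])
           (auto simp: basis4_def vec4_eq_iff cols_vec4 e1_def e2_def)
      show ?thesis
        by (rule block_31[OF nd b', of 0 r 1 0 \<alpha> "r * r" "2 * r" 1])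
           (simp add: e, unfold e1_def e2_def e M N' mv_linear k True, simp_all add: vec_eq_iff algebra_simps)
    qed
  qed
qed

text \<open>Here \<open>M\<close> is cyclic on \<open>\<complex>\<^sup>4\<close> with characteristic polynomial \<open>x\<^sup>2 (x\<^sup>2 - k2 x - k1)\<close>, and
  \<open>N = M\<^sup>2 + z M (M\<^sup>2 - k2 M - k1)\<close>.\<close>

lemma abelian_cyclic:
  assumes nd: "nondeg M N" and b: "basis4 e f u v"
    and M: "M *v e = f" "M *v f = u" "M *v u = v" "M *v v = k1 *s u + k2 *s v"
    and N: "N *v e = u + z *s (v - k2 *s u - k1 *s f)"
      "N *v f = M *v (M *v f)" "N *v u = M *v (M *v u)" "N *v v = M *v (M *v v)"
  shows "has_listed_form M N"
proof -
  have N': "N *v f = v" "N *v u = k1 *s u + k2 *s v" "N *v v = k1 *s v + k2 *s (k1 *s u + k2 *s v)"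
    unfolding N M mv_linear by simp_all
  obtain r1 r2 where k: "k2 = r1 + r2" "k1 = - (r1 * r2)"
    using quadratic_roots[of k2 k1] by (elim exE conjE)
  have linked: "has_listed_form M N" if r: "k2 = r" "k1 = 0" for r
  proof (cases "r = 0")
    case True
    have b': "basis4 v u f e"
      by (rule basis4_transform[OF b, of "vec4 0 0 0 1" "vec4 0 0 1 0" "vec4 0 1 0 0" "vec4 1 0 0 0"])
         (auto simp: basis4_def vec4_eq_iff cols_vec4)
    show ?thesis
      by (rule block_4[OF nd b', of 0 1 0 0 0 0 1 z])
         (unfold M N(1) N' mv_linear r True, simp_all add: vec_eq_iff algebra_simps)
  next
    case False
    define e1 e2 e3 where "e1 = (- r) *s u + 1 *s v" and "e2 = (- r) *s f + 1 *s u"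
      and "e3 = (- r) *s e + 1 *s f"
    have b': "basis4 v e1 e2 e3"
      by (rule basis4_transform[OF b, of "vec4 0 0 0 1" "vec4 0 0 (- r) 1" "vec4 0 (- r) 1 0" "vec4 (- r) 1 0 0"])
         (use False in \<open>auto simp: basis4_def vec4_eq_iff cols_vec4 e1_def e2_def e3_def\<close>)
    show ?thesis
      by (rule block_31[OF nd b', of r 0 1 0 "r * r" 0 0 "1 - z * r"])
         (unfold e1_def e2_def e3_def M N(1) N' mv_linear r, simp_all add: vec_eq_iff algebra_simps)
  qed
  show ?thesis
  proof (cases "r1 = 0 \<or> r2 = 0")
    case True
    then have "k2 = (if r1 = 0 then r2 else r1)" "k1 = 0" using k by auto
    then show ?thesis by (rule linked)
  next
    case False
    define e2 e3 where "e2 = (- k1) *s f + (- k2) *s u + 1 *s v" and "e3 = (- k1) *s e + (- k2) *s f + 1 *s u"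
    have k1: "k1 \<noteq> 0" using False k by simp
    show ?thesis
    proof (cases "r1 = r2")
      case True
      define w where "w = (- r1) *s u + 1 *s v"
      have b': "basis4 e2 e3 w u"
        by (rule basis4_transform[OF b, of "vec4 0 (- k1) (- k2) 1" "vec4 (- k1) (- k2) 1 0" "vec4 0 0 (- r1) 1" "vec4 0 0 1 0"])
           (use k1 in \<open>auto simp: basis4_def vec4_eq_iff cols_vec4 e2_def e3_def w_def\<close>)
      show ?thesis
        by (rule block_22[OF b', of M 0 1 r1 1 N 0 "z * r1 * r1" "r1 * r1" "2 * r1"])
           (unfold e2_def e3_def w_def M N(1) N' mv_linear k True, simp_all add: vec_eq_iff algebra_simps)
    next
      case False
      define g1 g2 where "g1 = (- r2) *s u + 1 *s v" and "g2 = (- r1) *s u + 1 *s v"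
      have P: "basis4 (vec4 0 0 (- r2) 1) (vec4 0 0 (- r1) 1) (vec4 0 (- k1) (- k2) 1) (vec4 (- k1) (- k2) 1 0)"
        unfolding basis4_def
      proof (intro allI impI)
        fix x0 x1 x2 x3
        assume "x0 *s vec4 0 0 (- r2) 1 + x1 *s vec4 0 0 (- r1) 1 + x2 *s vec4 0 (- k1) (- k2) 1 + x3 *s vec4 (- k1) (- k2) 1 0 = 0"
        then have x: "x3 = 0" "x2 = 0" "x0 + x1 = 0" "x0 * r2 + x1 * r1 = 0"
          using k1 by (auto simp: vec4_eq_iff add_eq_0_iff2)
        have "x1 * (r1 - r2) = (x0 * r2 + x1 * r1) - (x0 + x1) * r2" by (simp add: algebra_simps)
        then have "x1 = 0" using False unfolding x by simp
        then show "x0 = 0 \<and> x1 = 0 \<and> x2 = 0 \<and> x3 = 0" using x by simp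
      qed
      have b': "basis4 g1 g2 e2 e3"
        by (rule basis4_transform[OF b P]) (simp_all add: cols_vec4 e2_def e3_def g1_def g2_def)
      show ?thesis
        by (rule block_211[OF b', of M r1 r2 0 1 N "r1 * r1" "r2 * r2" 0 "z * r1 * r2"])
           (unfold e2_def e3_def g1_def g2_def M N(1) N' mv_linear k, simp_all add: vec_eq_iff algebra_simps)
    qed
  qed
qed

text \<open>The case in which \<open>M\<close> has the kernel vectors \<open>e\<close> and \<open>k = v - k2 u - k1 f\<close>, connected only by \<open>N e = z k\<close>. For \<open>k1 = 0\<close>
  or \<open>z = 0\<close> the fields are dependent along a hyperplane: in the first case that of the functional
  \<open>(1, k2, k2\<^sup>2)\<close> on \<open>f, u, v\<close>, where \<open>M w\<close> and \<open>N w\<close> are multiples of \<open>v - k2 u\<close>; in the second case the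
  one on which \<open>M w\<close> is an eigenvector for the root \<open>r1\<close>.\<close>

lemma abelian_two_kernel:
  assumes nd: "nondeg M N" and b: "basis4 e f u v"
    and M: "M *v e = 0" "M *v f = u" "M *v u = v" "M *v v = k1 *s u + k2 *s v"
    and N: "N *v e = z *s (v - k2 *s u - k1 *s f)"
      "N *v f = M *v (M *v f)" "N *v u = M *v (M *v u)" "N *v v = M *v (M *v v)"
  shows "has_listed_form M N"
proof -
  have N': "N *v f = v" "N *v u = k1 *s u + k2 *s v" "N *v v = k1 *s v + k2 *s (k1 *s u + k2 *s v)"
    unfolding N M mv_linear by simp_all
  obtain r1 r2 where k: "k2 = r1 + r2" "k1 = - (r1 * r2)"
    using quadratic_roots[of k2 k1] by (elim exE conjE)
  have k1: "k1 \<noteq> 0"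
  proof
    assume k10: "k1 = 0"
    show False
    proof (rule nondegD[OF nd b, of "vec4 0 1 k2 (k2 * k2)"])
      show "vec4 0 1 k2 (k2 * k2) \<noteq> 0" by (simp add: vec4_eq_iff)
    next
      fix x w assume x: "dot (vec4 0 1 k2 (k2 * k2)) x = 0"
        and w: "w = x$0 *s e + x$1 *s f + x$2 *s u + x$3 *s v"
      define s where "s = x$2 + k2 * x$3"
      have x1: "x$1 = - k2 * s" using x by (simp add: dot4 s_def eq_neg_iff_add_eq_0 algebra_simps)
      have Mw: "M *v w = s *s (v - k2 *s u)"
        unfolding w mv_linear M k10 x1 by (simp add: vec_eq_iff algebra_simps s_def)
      have Nw: "N *v w = (x$0 * z) *s (v - k2 *s u)"
        unfolding w mv_linear N(1) N' k10 x1 by (simp add: vec_eq_iff algebra_simps s_def)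
      show "\<exists>p q r. (q \<noteq> 0 \<or> r \<noteq> 0) \<and> p *s w + q *s (M *v w) + r *s (N *v w) = 0"
      proof (cases "s = 0")
        case True
        then show ?thesis by (intro exI[of _ 0] exI[of _ 1] exI[of _ 0]) (simp add: Mw)
      next
        case False
        then show ?thesis
          by (intro exI[of _ 0] exI[of _ "x$0 * z"] exI[of _ "- s"]) (simp add: Mw Nw vec_eq_iff algebra_simps)
      qed
    qed
  qed
  have z: "z \<noteq> 0"
  proof
    assume z0: "z = 0"
    have r: "r1 \<noteq> 0" using k1 k by auto
    show False
    proof (rule nondegD[OF nd b, of "vec4 0 r1 (- k1) (r1 * k1 - k1 * k2)"])
      show "vec4 0 r1 (- k1) (r1 * k1 - k1 * k2) \<noteq> 0" using r by (simp add: vec4_eq_iff)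
    next
      fix x w assume x: "dot (vec4 0 r1 (- k1) (r1 * k1 - k1 * k2)) x = 0"
        and w: "w = x$0 *s e + x$1 *s f + x$2 *s u + x$3 *s v"
      define A B where "A = x$1 + k1 * x$3" and "B = x$2 + k2 * x$3"
      have "r1 * (A + r2 * B) = 0" using x by (simp add: dot4 A_def B_def k algebra_simps)
      then have A: "A = - r2 * B" using r by (simp add: eq_neg_iff_add_eq_0)
      have Mw: "M *v w = A *s u + B *s v"
        unfolding w mv_linear M by (simp add: vec_eq_iff algebra_simps A_def B_def)
      have Nw: "N *v w = (B * k1) *s u + (A + k2 * B) *s v"
        unfolding w mv_linear N(1) N' z0 by (simp add: vec_eq_iff algebra_simps A_def B_def)
      show "\<exists>p q r. (q \<noteq> 0 \<or> r \<noteq> 0) \<and> p *s w + q *s (M *v w) + r *s (N *v w) = 0"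
        unfolding Mw Nw A k
        by (intro exI[of _ 0] exI[of _ "- r1"] exI[of _ 1]) (simp add: vec_eq_iff algebra_simps)
    qed
  qed
  define e2 where "e2 = (- k1) *s f + (- k2) *s u + 1 *s v"
  show ?thesis
  proof (cases "r1 = r2")
    case True
    define w where "w = (- r1) *s u + 1 *s v"
    have b': "basis4 e2 e w u"
      by (rule basis4_transform[OF b, of "vec4 0 (- k1) (- k2) 1" "vec4 1 0 0 0" "vec4 0 0 (- r1) 1" "vec4 0 0 1 0"])
         (use k1 in \<open>auto simp: basis4_def vec4_eq_iff cols_vec4 e2_def w_def\<close>)
    show ?thesis
      by (rule block_22[OF b', of M 0 0 r1 1 N 0 z "r1 * r1" "2 * r1"])
         (unfold e2_def w_def M N(1) N' mv_linear k True, simp_all add: vec_eq_iff algebra_simps)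
  next
    case False
    define g1 g2 where "g1 = (- r2) *s u + 1 *s v" and "g2 = (- r1) *s u + 1 *s v"
    have P: "basis4 (vec4 0 0 (- r2) 1) (vec4 0 0 (- r1) 1) (vec4 0 (- k1) (- k2) 1) (vec4 1 0 0 0)"
      unfolding basis4_def
    proof (intro allI impI)
      fix x0 x1 x2 x3
      assume "x0 *s vec4 0 0 (- r2) 1 + x1 *s vec4 0 0 (- r1) 1 + x2 *s vec4 0 (- k1) (- k2) 1 + x3 *s vec4 1 0 0 0 = 0"
      then have x: "x3 = 0" "x2 = 0" "x0 + x1 = 0" "x0 * r2 + x1 * r1 = 0"
        using k1 by (auto simp: vec4_eq_iff add_eq_0_iff2)
      have "x1 * (r1 - r2) = (x0 * r2 + x1 * r1) - (x0 + x1) * r2" by (simp add: algebra_simps)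
      then have "x1 = 0" using False unfolding x by simp
      then show "x0 = 0 \<and> x1 = 0 \<and> x2 = 0 \<and> x3 = 0" using x by simp
    qed
    have b': "basis4 g1 g2 e2 e"
      by (rule basis4_transform[OF b P]) (simp_all add: cols_vec4 e2_def g1_def g2_def)
    show ?thesis
      by (rule block_211[OF b', of M r1 r2 0 0 N "r1 * r1" "r2 * r2" 0 z])
         (unfold e2_def g1_def g2_def M N(1) N' mv_linear k, simp_all add: vec_eq_iff algebra_simps)
  qed
qed

text \<open>Commutativity forces \<open>N = M\<^sup>2\<close> on the hyperplane, and on \<open>e\<close> it determines the difference up to a scalar \<open>\<alpha>\<close> and an element
  of the kernel of \<open>M\<close>.\<close>

lemma abelian_kernel_chain:
  assumes nd: "nondeg M N" and comm: "\<And>w. M *v (N *v w) = N *v (M *v w)" and b: "basis4 e f u v"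
    and M: "M *v e = h *s f" "M *v f = u" "M *v u = v" "M *v v = k0 *s f + k1 *s u + k2 *s v"
    and N: "N *v f = v" "N *v e = \<alpha> *s e + d0 *s f + d1 *s u + d2 *s v"
    and h: "k0 = 0 \<or> h = 0"
  shows "has_listed_form M N"
proof -
  have N': "N *v f = M *v (M *v f)" "N *v u = M *v (M *v u)" "N *v v = M *v (M *v v)"
  proof -
    show f: "N *v f = M *v (M *v f)" unfolding N M ..
    have "M *v (N *v f) = M *v (M *v u)" unfolding N M ..
    then show u: "N *v u = M *v (M *v u)" unfolding comm M .
    have "M *v (N *v u) = M *v (M *v v)" unfolding u M ..
    then show "N *v v = M *v (M *v v)" unfolding comm M(3) .
  qed
  have "M *v (N *v e) - N *v (M *v e) = 0" unfolding comm by simp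
  then have "0 *s e + (\<alpha> * h + d2 * k0) *s f + (d0 + d2 * k1) *s u + (d1 + d2 * k2 - h) *s v = 0"
    unfolding M N mv_linear by (simp add: vec_eq_iff algebra_simps)
  then have c: "\<alpha> * h + d2 * k0 = 0" "d0 + d2 * k1 = 0" "d1 + d2 * k2 - h = 0"
    using b unfolding basis4_def by blast+
  show ?thesis
  proof (cases "k0 = 0")
    case False
    then have "h = 0" "d2 = 0" "d0 = 0" "d1 = 0" using h c by auto
    then show ?thesis using M N by (intro abelian_split[OF nd b _ _ M(2-4) N', of \<alpha>]) simp_all
  next
    case True
    have d: "d0 = - d2 * k1" "d1 = h - d2 * k2" using c by (simp_all add: eq_neg_iff_add_eq_0 eq_diff_eq)
    define k where "k = v - k2 *s u - k1 *s f"
    have Ne: "N *v e = \<alpha> *s e + h *s u + d2 *s k"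
      unfolding N d k_def by (simp add: vec_eq_iff algebra_simps)
    have Mk: "M *v k = 0" unfolding k_def mv_linear M True by (simp add: vec_eq_iff)
    have Nk: "N *v k = 0"
    proof -
      have "N *v k = M *v (M *v k)" unfolding k_def mv_linear N' ..
      then show ?thesis unfolding Mk mv_linear .
    qed
    consider (split) "\<alpha> \<noteq> 0" "h = 0" | (cyclic) "\<alpha> = 0" "h \<noteq> 0" | (two) "\<alpha> = 0" "h = 0"
      using c True by auto
    then show ?thesis
    proof cases
      case split
      define e' where "e' = \<alpha> *s e + d2 *s k"
      have b': "basis4 e' f u v"
        by (rule basis4_transform[OF b, of "vec4 \<alpha> (- d2 * k1) (- d2 * k2) d2" "vec4 0 1 0 0" "vec4 0 0 1 0" "vec4 0 0 0 1"])
           (use split in \<open>auto simp: basis4_def vec4_eq_iff cols_vec4 e'_def k_def vec_eq_iff algebra_simps\<close>)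
      show ?thesis
      proof (rule abelian_split[OF nd b' _ _ M(2-4) N'])
        show "M *v e' = 0" unfolding e'_def mv_linear M Mk using split by simp
        show "N *v e' = \<alpha> *s e'" unfolding e'_def mv_linear Ne Nk using split by simp
      qed
    next
      case cyclic
      have b': "basis4 e (h *s f) (h *s u) (h *s v)"
        using basis4_scale[OF b, of 1 h h h] cyclic by simp
      show ?thesis
      proof (rule abelian_cyclic[OF nd b', of k1 k2 "d2 / h"])
        show "N *v e = h *s u + (d2 / h) *s (h *s v - k2 *s (h *s u) - k1 *s (h *s f))"
          unfolding Ne k_def using cyclic by (simp add: vec_eq_iff right_diff_distrib)
      qed (unfold M mv_linear N' True, simp_all add: vec_eq_iff algebra_simps)
    next
      case two
      show ?thesis
      proof (rule abelian_two_kernel[OF nd b])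
        show "M *v e = 0" using M two by simp
        show "M *v v = k1 *s u + k2 *s v" using M True by simp
        show "N *v e = d2 *s (v - k2 *s u - k1 *s f)" unfolding Ne using two by (simp add: k_def)
      qed (rule M N')+
    qed
  qed
qed

text \<open>Subtraction of an element of the hyperplane from \<open>e\<close> brings \<open>M e\<close> to the form \<open>h *s f\<close>, with \<open>h = 0\<close> if \<open>M\<close> is invertible on
  the hyperplane.\<close>

lemma abelian_chain:
  assumes nd: "nondeg M N" and comm: "\<And>w. M *v (N *v w) = N *v (M *v w)" and b: "basis4 e f u v"
    and M: "M *v e = h0 *s f + h1 *s u + h2 *s v" "M *v f = u" "M *v u = v" "M *v v = k0 *s f + k1 *s u + k2 *s v"
    and N: "N *v f = v" "N *v e = \<alpha> *s e + d0 *s f + d1 *s u + d2 *s v"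
  shows "has_listed_form M N"
proof -
  define y2 where "y2 = (if k0 = 0 then 0 else h0 / k0)"
  define y0 y1 where "y0 = h1 - y2 * k1" and "y1 = h2 - y2 * k2"
  define h where "h = h0 - y2 * k0"
  define e' where "e' = e - y0 *s f - y1 *s u - y2 *s v"
  have h: "k0 = 0 \<or> h = 0" by (auto simp: h_def y2_def)
  have b': "basis4 e' f u v"
    by (rule basis4_transform[OF b, of "vec4 1 (- y0) (- y1) (- y2)" "vec4 0 1 0 0" "vec4 0 0 1 0" "vec4 0 0 0 1"])
       (auto simp: basis4_def vec4_eq_iff cols_vec4 e'_def vec_eq_iff)
  have Me: "M *v e' = h *s f"
    unfolding e'_def mv_linear M h_def y0_def y1_def by (simp add: vec_eq_iff algebra_simps)
  have "M *v (N *v f) = M *v v" unfolding N ..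
  then have Nu: "N *v u = k0 *s f + k1 *s u + k2 *s v" unfolding comm M .
  have "M *v (N *v u) = M *v (k0 *s f + k1 *s u + k2 *s v)" unfolding Nu ..
  then have Nv: "N *v v = k0 *s u + k1 *s v + k2 *s (k0 *s f + k1 *s u + k2 *s v)"
    unfolding comm M mv_linear .
  have Ne: "N *v e' = \<alpha> *s e' + (d0 + \<alpha> * y0 - y1 * k0 - y2 * k2 * k0) *s f
      + (d1 + \<alpha> * y1 - y1 * k1 - y2 * (k0 + k2 * k1)) *s u
      + (d2 + \<alpha> * y2 - y0 - y1 * k2 - y2 * (k1 + k2 * k2)) *s v"
    unfolding e'_def mv_linear N Nu Nv by (simp add: vec_eq_iff algebra_simps)
  show ?thesis by (rule abelian_kernel_chain[OF nd comm b' Me M(2-4) N(1) Ne h])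
qed

lemma hyperplane_expand:
  assumes b: "basis4 e f u v" and l: "dot l e = 1" "dot l f = 0" "dot l u = 0" "dot l v = 0" "dot l w = 0"
  obtains x y z where "w = x *s f + y *s u + z *s v"
proof -
  obtain t x y z where w: "w = t *s e + x *s f + y *s u + z *s v" using basis4_expand[OF b, of w] .
  have "dot l w = t" unfolding w by (simp add: dot_add dot_smult l)
  then have "t = 0" using l by simp
  then show ?thesis using that[of x y z] w by simp
qed

text \<open>The relation for \<open>M\<^sup>2 f\<close> says that \<open>x + y M + w N\<close> agrees with \<open>M\<^sup>2\<close> on \<open>f\<close>. It replaces \<open>N\<close>.\<close>

lemma abelian_cyclic_hyperplane:
  assumes nd: "nondeg M N" and comm: "\<And>w. M *v (N *v w) = N *v (M *v w)"
    and l: "\<And>z. dot l (M *v z) = 0" "\<And>z. dot l (N *v z) = 0" "dot l e = 1" "dot l f = 0"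
    and b: "basis4 e f (M *v f) (N *v f)"
    and MM: "M *v (M *v f) = x *s f + y *s (M *v f) + w *s (N *v f)" and w: "w \<noteq> 0"
  shows "has_listed_form M N"
proof -
  define u v where "u = M *v f" and "v = M *v (M *v f)"
  have b': "basis4 e f u v"
    by (rule basis4_transform[OF b, of "vec4 1 0 0 0" "vec4 0 1 0 0" "vec4 0 0 1 0" "vec4 0 x y w"])
       (use w in \<open>auto simp: basis4_def vec4_eq_iff cols_vec4 u_def v_def MM\<close>)
  let ?M = "lc 0 1 0 M N" and ?N = "lc x y w M N"
  have nd': "nondeg ?M ?N" using nondeg_change[OF nd, of 1 w y 0] w by simp
  have luv: "dot l u = 0" "dot l v = 0" unfolding u_def v_def by (rule l)+
  obtain h0 h1 h2 where Me: "M *v e = h0 *s f + h1 *s u + h2 *s v"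
    using hyperplane_expand[OF b' l(3,4) luv l(1)] .
  obtain k0 k1 k2 where Mv: "M *v v = k0 *s f + k1 *s u + k2 *s v"
    using hyperplane_expand[OF b' l(3,4) luv l(1)] .
  obtain \<alpha> d0 d1 d2 where Ne: "?N *v e = \<alpha> *s e + d0 *s f + d1 *s u + d2 *s v"
    using basis4_expand[OF b'] .
  have c: "?M *v (?N *v t) = ?N *v (?M *v t)" for t
    unfolding lc_mult mv_linear comm by simp
  have "has_listed_form ?M ?N"
  proof (rule abelian_chain[OF nd' c b' _ _ _ _ _ Ne])
    show "?M *v e = h0 *s f + h1 *s u + h2 *s v" by (simp add: lc_mult Me)
    show "?M *v v = k0 *s f + k1 *s u + k2 *s v" by (simp add: lc_mult Mv)
    show "?M *v f = u" "?M *v u = v" by (simp_all add: lc_mult u_def v_def)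
    show "?N *v f = v" by (simp add: lc_mult v_def MM)
  qed
  then show ?thesis by (rule has_listed_form_change) (simp add: w)
qed

lemma abelian_cyclic_hyperplane_change:
  assumes nd: "nondeg M N" and comm: "\<And>w. M *v (N *v w) = N *v (M *v w)"
    and l: "\<And>z. dot l (M *v z) = 0" "\<And>z. dot l (N *v z) = 0" "dot l e = 1" "dot l f = 0"
    and b: "basis4 e f (M *v f) (N *v f)" and det: "p * s - r * q \<noteq> 0"
    and T: "T = lc 0 p q M N" and S: "S = lc 0 r s M N"
    and TT: "T *v (T *v f) = x *s f + y *s (T *v f) + w *s (S *v f)" and w: "w \<noteq> 0"
  shows "has_listed_form M N"
proof -
  have "has_listed_form T S"
  proof (rule abelian_cyclic_hyperplane[OF _ _ _ _ l(3,4) _ TT w])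
    show "nondeg T S" unfolding T S by (rule nondeg_change[OF nd]) (use det in simp)
    show "T *v (S *v w) = S *v (T *v w)" for w
      unfolding T S lc_mult mv_linear comm by (simp add: vec_eq_iff algebra_simps)
    show "dot l (T *v z) = 0" "dot l (S *v z) = 0" for z
      unfolding T S lc_mult by (simp_all add: dot_add dot_smult l)
    show "basis4 e f (T *v f) (S *v f)"
    proof (rule basis4_transform[OF b, of "vec4 1 0 0 0" "vec4 0 1 0 0" "vec4 0 0 p q" "vec4 0 0 r s"])
      show "basis4 (vec4 1 0 0 0) (vec4 0 1 0 0) (vec4 0 0 p q) (vec4 0 0 r s)"
        unfolding basis4_def
      proof (intro allI impI)
        fix x0 x1 x2 x3 :: complex
        assume "x0 *s vec4 1 0 0 0 + x1 *s vec4 0 1 0 0 + x2 *s vec4 0 0 p q + x3 *s vec4 0 0 r s = 0"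
        then have x: "x0 = 0" "x1 = 0" "x2 * p + x3 * r = 0" "x2 * q + x3 * s = 0"
          by (simp_all add: vec4_eq_iff)
        have "x2 * (p * s - r * q) = s * (x2 * p + x3 * r) - r * (x2 * q + x3 * s)"
          "x3 * (p * s - r * q) = p * (x2 * q + x3 * s) - q * (x2 * p + x3 * r)" by (simp_all add: algebra_simps)
        then have "x2 = 0" "x3 = 0" using det unfolding x by simp_all
        then show "x0 = 0 \<and> x1 = 0 \<and> x2 = 0 \<and> x3 = 0" using x by simp
      qed
    qed (simp_all add: cols_vec4 T S lc_mult)
  qed
  then show ?thesis unfolding T S by (rule has_listed_form_change) (use det in simp)
qed

text \<open>If all products of \<open>M\<close> and \<open>N\<close> vanish on the hyperplane, commutativity on \<open>e\<close> leaves so few parameters that on some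
  other hyperplane a fixed combination of the two fields vanishes: \<open>q M - p N\<close>, or, if \<open>p = q = 0\<close>, a combination that
  is found from an eigenvalue of the \<open>2 \<times> 2\<close> matrix of \<open>h1, h2, k1, k2\<close>.\<close>

lemma square_zero_degenerate:
  assumes nd: "nondeg M N" and comm: "\<And>w. M *v (N *v w) = N *v (M *v w)"
    and b: "basis4 e f u v" and f: "M *v f = u" "N *v f = v"
    and sq: "M *v u = 0" "N *v u = 0" "M *v v = 0" "N *v v = 0"
    and e: "M *v e = (- p) *s e + h0 *s f + h1 *s u + h2 *s v" "N *v e = (- q) *s e + k0 *s f + k1 *s u + k2 *s v"
  shows False
proof -
  have "M *v (N *v e) - N *v (M *v e) = 0" unfolding comm by simp
  then have "0 *s e + (p * k0 - q * h0) *s f + (p * k1 - q * h1 + k0) *s u + (p * k2 - q * h2 - h0) *s v = 0"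
    unfolding f sq e mv_linear by (simp add: vec_eq_iff algebra_simps)
  then have c: "p * k0 - q * h0 = 0" "p * k1 - q * h1 + k0 = 0" "p * k2 - q * h2 - h0 = 0"
    using b unfolding basis4_def by blast+
  show False
  proof (cases "p = 0 \<and> q = 0")
    case True
    then have hk: "h0 = 0" "k0 = 0" using c by simp_all
    obtain r1 r2 where r: "- (h1 + k2) = r1 + r2" "h2 * k1 - h1 * k2 = - (r1 * r2)"
      using quadratic_roots[of "- (h1 + k2)" "h2 * k1 - h1 * k2"] by (elim exE conjE)
    have r2: "r2 = - (h1 + k2) - r1" using r(1) by simp
    have "(h1 + r1) * (k2 + r1) - k1 * h2 = 0" using r(2) unfolding r2 by (simp add: algebra_simps)
    then obtain a c where ac: "a \<noteq> 0 \<or> c \<noteq> 0" "(h1 + r1) * a + k1 * c = 0" "h2 * a + (k2 + r1) * c = 0"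
      using singular_pair by blast
    show False
    proof (rule nondegD[OF nd b, of "vec4 (- r1) 1 0 0"])
      fix x z assume x: "dot (vec4 (- r1) 1 0 0) x = 0" and z: "z = x$0 *s e + x$1 *s f + x$2 *s u + x$3 *s v"
      have x1: "x$1 = r1 * x$0" using x by (simp add: dot4)
      have "0 *s z + a *s (M *v z) + c *s (N *v z)
          = (x$0 * ((h1 + r1) * a + k1 * c)) *s u + (x$0 * (h2 * a + (k2 + r1) * c)) *s v"
        unfolding z mv_linear f sq e hk x1 using True by (simp add: vec_eq_iff algebra_simps)
      then have "0 *s z + a *s (M *v z) + c *s (N *v z) = 0" unfolding ac by simp
      then show "\<exists>p q r. (q \<noteq> 0 \<or> r \<noteq> 0) \<and> p *s z + q *s (M *v z) + r *s (N *v z) = 0"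
        using ac(1) by blast
    qed (simp add: vec4_eq_iff)
  next
    case False
    define a d where "a = (if p = 0 then k0 else h0)" and "d = (if p = 0 then q else p)"
    show False
    proof (rule nondegD[OF nd b, of "vec4 a d 0 0"])
      show "vec4 a d 0 0 \<noteq> 0" using False by (auto simp: vec4_eq_iff d_def)
    next
      fix x z assume x: "dot (vec4 a d 0 0) x = 0" and z: "z = x$0 *s e + x$1 *s f + x$2 *s u + x$3 *s v"
      have ad: "a * x$0 + d * x$1 = 0" using x by (simp add: dot4)
      have 1: "h0 * x$0 + p * x$1 = 0" "k0 * x$0 + q * x$1 = 0"
      proof -
        have "h0 * x$0 + p * x$1 = 0 \<and> k0 * x$0 + q * x$1 = 0"
        proof (cases "p = 0")
          case True
          then have q: "q \<noteq> 0" using False by simp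
          have "h0 = 0" using c(1) True q by simp
          then show ?thesis using ad True by (simp add: a_def d_def)
        next
          case False
          have "p * (k0 * x$0 + q * x$1) = (p * k0 - q * h0) * x$0 + q * (h0 * x$0 + p * x$1)"
            by (simp add: algebra_simps)
          then show ?thesis using ad False c(1) by (simp add: a_def d_def)
        qed
        then show "h0 * x$0 + p * x$1 = 0" "k0 * x$0 + q * x$1 = 0" by simp_all
      qed
      have "0 *s z + q *s (M *v z) + (- p) *s (N *v z) = (- x$0 * (p * k0 - q * h0)) *s f
          + ((k0 * x$0 + q * x$1) - x$0 * (p * k1 - q * h1 + k0)) *s u
          + (- (x$0 * (p * k2 - q * h2 - h0)) - (h0 * x$0 + p * x$1)) *s v"
        unfolding z mv_linear f sq e by (simp add: vec_eq_iff algebra_simps)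
      then have "0 *s z + q *s (M *v z) + (- p) *s (N *v z) = 0" unfolding c 1 by simp
      moreover have "q \<noteq> 0 \<or> - p \<noteq> 0" using False by auto
      ultimately show "\<exists>p q r. (q \<noteq> 0 \<or> r \<noteq> 0) \<and> p *s z + q *s (M *v z) + r *s (N *v z) = 0" by blast
    qed
  qed
qed

text \<open>If none of \<open>M\<close>, \<open>N\<close>, \<open>M + N\<close>, \<open>M - N\<close> is cyclic with generator \<open>f\<close>, then \<open>T\<^sup>2 f\<close> lies in the span of \<open>f\<close> and \<open>T f\<close> for these
  four, which determines the quadratic relations up to scalars: after translation of \<open>M\<close> and \<open>N\<close> by multiples of 1 all
  products vanish on \<open>f\<close>.\<close>

lemma abelian_normalized:
  assumes nd: "nondeg M N" and comm: "\<And>w. M *v (N *v w) = N *v (M *v w)"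
    and l0: "l \<noteq> 0" and l: "\<And>z. dot l (M *v z) = 0" "\<And>z. dot l (N *v z) = 0"
  shows "has_listed_form M N"
proof -
  obtain f where f: "dot l f = 0" "indep3 f (M *v f) (N *v f)"
    using nd l0 unfolding nondeg_def by blast
  have "\<exists>e. dot l e = 1"
  proof -
    have "\<not> (\<forall>z. dot l z = 0)" using dot_eq_zeroD[of l] l0 by blast
    then obtain z where "dot l z \<noteq> 0" by blast
    then show ?thesis by (intro exI[of _ "(1 / dot l z) *s z"]) (simp add: dot_smult)
  qed
  then obtain e where e: "dot l e = 1" by blast
  define u v where "u = M *v f" and "v = N *v f"
  have luv: "dot l u = 0" "dot l v = 0" unfolding u_def v_def by (rule l)+
  have b: "basis4 e f u v"
    unfolding basis4_def
  proof (intro allI impI)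
    fix x0 x1 x2 x3 assume s: "x0 *s e + x1 *s f + x2 *s u + x3 *s v = 0"
    have "x0 = dot l (x0 *s e + x1 *s f + x2 *s u + x3 *s v)" by (simp add: dot_add dot_smult e f luv)
    then have x0: "x0 = 0" unfolding s by (simp add: dot4)
    then have "x1 *s f + x2 *s u + x3 *s v = 0" using s by simp
    then show "x0 = 0 \<and> x1 = 0 \<and> x2 = 0 \<and> x3 = 0" using f(2) x0 unfolding indep3_def u_def v_def by blast
  qed
  note ex = hyperplane_expand[OF b e f(1) luv]
  note cyc = abelian_cyclic_hyperplane_change[OF nd comm l e f(1) b[unfolded u_def v_def] _ refl refl]
  obtain a0 a1 a2 where MM: "M *v u = a0 *s f + a1 *s u + a2 *s v" using ex[OF l(1)] .
  obtain b0 b1 b2 where MN: "M *v v = b0 *s f + b1 *s u + b2 *s v" using ex[OF l(1)] .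
  obtain c0 c1 c2 where NN: "N *v v = c0 *s f + c1 *s u + c2 *s v" using ex[OF l(2)] .
  have NM: "N *v u = b0 *s f + b1 *s u + b2 *s v" using MN unfolding u_def v_def comm .
  have cyc': "has_listed_form M N" if det: "p * s - r * q \<noteq> 0"
    and w: "p * p * a0 + 2 * p * q * b0 + q * q * c0 = x"
      "p * p * a1 + 2 * p * q * b1 + q * q * c1 = y * p + w * r"
      "p * p * a2 + 2 * p * q * b2 + q * q * c2 = y * q + w * s" "w \<noteq> 0" for p q r s x y w
  proof (rule cyc[OF det _ w(4)])
    have "lc 0 p q M N *v (lc 0 p q M N *v f) = (p * p * a0 + 2 * p * q * b0 + q * q * c0) *s f
      + (p * p * a1 + 2 * p * q * b1 + q * q * c1) *s u + (p * p * a2 + 2 * p * q * b2 + q * q * c2) *s v"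
      unfolding lc_mult u_def[symmetric] v_def[symmetric] mv_linear MM MN NN NM by (simp add: vec_eq_iff algebra_simps)
    then show "lc 0 p q M N *v (lc 0 p q M N *v f) = x *s f + y *s (lc 0 p q M N *v f) + w *s (lc 0 r s M N *v f)"
      unfolding w(1-3) lc_mult u_def[symmetric] v_def[symmetric] by (simp add: vec_eq_iff algebra_simps)
  qed
  consider (M) "a2 \<noteq> 0" | (N) "c1 \<noteq> 0" | (plus) "(a2 + 2 * b2 + c2) - (a1 + 2 * b1 + c1) \<noteq> 0"
    | (minus) "(a2 - 2 * b2 + c2) + (a1 - 2 * b1 + c1) \<noteq> 0"
    | (none) "a2 = 0" "c1 = 0" "(a2 + 2 * b2 + c2) - (a1 + 2 * b1 + c1) = 0" "(a2 - 2 * b2 + c2) + (a1 - 2 * b1 + c1) = 0"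
    by blast
  then show ?thesis
  proof cases
    case M
    then show ?thesis by (intro cyc'[of 1 1 0 0 a0 a1 a2]) simp_all
  next
    case N
    then show ?thesis by (intro cyc'[of 0 0 1 1 c0 c2 c1]) simp_all
  next
    case plus
    then show ?thesis by (intro cyc'[of 1 1 0 1 _ "a1 + 2 * b1 + c1" "(a2 + 2 * b2 + c2) - (a1 + 2 * b1 + c1)"]) (simp_all add: algebra_simps)
  next
    case minus
    then show ?thesis
      by (intro cyc'[of 1 1 0 "- 1" _ "a1 - 2 * b1 + c1" "(a2 - 2 * b2 + c2) + (a1 - 2 * b1 + c1)"]) simp_all
  next
    case none
    have "2 * (2 * b2 - a1) = ((a2 + 2 * b2 + c2) - (a1 + 2 * b1 + c1)) - ((a2 - 2 * b2 + c2) + (a1 - 2 * b1 + c1)) + 2 * c1"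
      by (simp add: algebra_simps)
    then have a1: "a1 = 2 * b2" unfolding none(3,4) unfolding none(1,2) by simp
    have "c2 - 2 * b1 = ((a2 + 2 * b2 + c2) - (a1 + 2 * b1 + c1)) - a2 - (2 * b2 - a1) + c1"
      by (simp add: algebra_simps)
    then have c2: "c2 = 2 * b1" unfolding none(3) unfolding none(1,2) a1 by simp
    define p q where "p = b2" and "q = b1"
    let ?M = "lc (- p) 1 0 M N" and ?N = "lc (- q) 0 1 M N"
    define u' v' where "u' = (- p) *s f + 1 *s u" and "v' = (- q) *s f + 1 *s v"
    have nd': "nondeg ?M ?N" by (rule nondeg_change[OF nd]) simp
    have comm': "?M *v (?N *v w) = ?N *v (?M *v w)" for w
      unfolding lc_mult mv_linear comm by (simp add: vec_eq_iff algebra_simps)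
    have b': "basis4 e f u' v'"
      by (rule basis4_transform[OF b, of "vec4 1 0 0 0" "vec4 0 1 0 0" "vec4 0 (- p) 1 0" "vec4 0 (- q) 0 1"])
         (auto simp: basis4_def vec4_eq_iff cols_vec4 u'_def v'_def)
    have f': "?M *v f = u'" "?N *v f = v'"
      by (simp_all add: lc_mult u'_def v'_def u_def v_def)
    define A B C where "A = a0 + p * p" and "B = b0 + p * q" and "C = c0 + q * q"
    have sq: "?M *v u' = A *s f" "?N *v u' = B *s f" "?M *v v' = B *s f" "?N *v v' = C *s f"
      unfolding lc_mult u'_def v'_def mv_linear u_def[symmetric] v_def[symmetric] MM MN NN NM none a1 c2 A_def B_def C_def p_def q_def
      by (simp_all add: vec_eq_iff algebra_simps)
    \<comment> \<open>associativity and the independence of \<open>u'\<close> and \<open>v'\<close> make the scalars \<open>A\<close>, \<open>B\<close>, \<open>C\<close> vanish\<close>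
    have "?M *v (?N *v v') = ?N *v (?M *v v')" "?M *v (?N *v u') = ?N *v (?M *v u')" by (rule comm')+
    then have "0 *s e + 0 *s f + C *s u' + (- B) *s v' = 0" "0 *s e + 0 *s f + B *s u' + (- A) *s v' = 0"
      unfolding sq mv_linear f' by (simp_all add: vec_eq_iff)
    then have "C = 0" "- B = 0" "- A = 0" using b' unfolding basis4_def by blast+
    then have ABC: "A = 0" "B = 0" "C = 0" by simp_all
    have sq0: "?M *v u' = 0" "?N *v u' = 0" "?M *v v' = 0" "?N *v v' = 0" unfolding sq ABC by simp_all
    have luv': "dot l u' = 0" "dot l v' = 0" unfolding u'_def v'_def by (simp_all add: dot_add dot_diff dot_smult f luv)
    have "\<exists>h0 h1 h2. M *v e = h0 *s f + h1 *s u' + h2 *s v'"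
      using hyperplane_expand[OF b' e f(1) luv' l(1)] by metis
    then obtain h0 h1 h2 where h: "M *v e = h0 *s f + h1 *s u' + h2 *s v'" by (elim exE)
    have "\<exists>k0 k1 k2. N *v e = k0 *s f + k1 *s u' + k2 *s v'"
      using hyperplane_expand[OF b' e f(1) luv' l(2)] by metis
    then obtain k0 k1 k2 where k: "N *v e = k0 *s f + k1 *s u' + k2 *s v'" by (elim exE)
    have False
    proof (rule square_zero_degenerate[OF nd' comm' b' f' sq0])
      show "?M *v e = (- p) *s e + h0 *s f + h1 *s u' + h2 *s v'" by (simp add: lc_mult h add.assoc)
      show "?N *v e = (- q) *s e + k0 *s f + k1 *s u' + k2 *s v'" by (simp add: lc_mult k add.assoc)
    qed
    then show ?thesis ..
  qed
qed

lemma abelian_classification: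
  assumes nd: "nondeg M N" and comm: "M ** N = N ** M"
  shows "has_listed_form M N"
proof -
  obtain l m n where l: "l \<noteq> 0" "\<forall>z. dot l (M *v z) = m * dot l z" "\<forall>z. dot l (N *v z) = n * dot l z"
    using common_left_eigenvector[OF comm] by (elim exE conjE)
  let ?M = "lc (- m) 1 0 M N" and ?N = "lc (- n) 0 1 M N"
  have c: "M *v (N *v w) = N *v (M *v w)" for w by (simp add: matrix_vector_mul_assoc comm)
  have "has_listed_form ?M ?N"
  proof (rule abelian_normalized[OF _ _ l(1)])
    show "nondeg ?M ?N" by (rule nondeg_change[OF nd]) simp
    show "?M *v (?N *v w) = ?N *v (?M *v w)" for w
      unfolding lc_mult mv_linear c by (simp add: vec_eq_iff algebra_simps)
    show "dot l (?M *v z) = 0" "dot l (?N *v z) = 0" for z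
      unfolding lc_mult by (simp_all add: dot_add dot_diff dot_smult l)
  qed
  then show ?thesis by (rule has_listed_form_change) simp
qed

section \<open>The classification\<close>

lemma trace_commutator: "trace (M ** N - N ** M) = (0::complex)" for M :: "complex^4^4"
  unfolding trace_sub trace_mul_sym[of M N] by simp

lemma trace_lc: "trace (lc a b c M N) = 4 * a + b * trace M + c * trace N"
  unfolding trace_def sum4 lc_def by (simp add: mat_def) (simp add: algebra_simps)

text \<open>The trace of a commutator is 0, so after subtraction of their traces \<open>M\<close> and \<open>N\<close> span a Lie algebra of dimension two.
  If it is not abelian, a generator of the derived algebra takes the place of \<open>N\<close>.\<close>

lemma linear_pair_classification:
  assumes nd: "nondeg M N"
    and lie: "M ** N - N ** M = mat a + (\<chi> i. b *s M $ i) + (\<chi> i. d *s N $ i)"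
  shows "has_listed_form M N"
proof -
  define m n where "m = trace M / 4" and "n = trace N / 4"
  have "4 * a + b * trace M + d * trace N = 0"
    using trace_commutator[of M N] unfolding lie lc_def[symmetric] trace_lc .
  then have "4 * (a + b * m + d * n) = 0" by (simp add: m_def n_def distrib_left)
  then have "a + b * m + d * n = 0" by (metis mult_eq_0_iff zero_neq_numeral)
  then have a: "a = - (b * m + d * n)" by (simp only: eq_neg_iff_add_eq_0 add.assoc)
  let ?M = "lc (- m) 1 0 M N" and ?N = "lc (- n) 0 1 M N"
  have nd': "nondeg ?M ?N" by (rule nondeg_change[OF nd]) simp
  have br: "M *v (N *v z) = N *v (M *v z) + a *s z + b *s (M *v z) + d *s (N *v z)" for z
  proof -
    have "M *v (N *v z) - N *v (M *v z) = (M ** N - N ** M) *v z"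
      by (simp add: matrix_vector_mult_diff_rdistrib matrix_vector_mul_assoc)
    also have "\<dots> = a *s z + b *s (M *v z) + d *s (N *v z)"
      unfolding lie lc_def[symmetric] lc_mult ..
    finally show ?thesis by (simp add: diff_eq_eq add_ac)
  qed
  have comm: "?M *v (?N *v z) = ?N *v (?M *v z) + b *s (?M *v z) + d *s (?N *v z)" for z
    unfolding lc_mult mv_linear br a by (simp add: vec_eq_iff algebra_simps)
  have "has_listed_form ?M ?N"
  proof (cases "b = 0")
    case b0: True
    show ?thesis
    proof (cases "d = 0")
      case True
      have "?M ** ?N = ?N ** ?M"
        by (rule matrix_eqI) (use comm b0 True in \<open>simp flip: matrix_vector_mul_assoc\<close>)
      then show ?thesis by (rule abelian_classification[OF nd'])
    next
      case False
      have "has_listed_form (lc 0 (1 / d) 0 ?M ?N) (lc 0 0 1 ?M ?N)"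
      proof (rule affine_classification)
        show "nondeg (lc 0 (1 / d) 0 ?M ?N) (lc 0 0 1 ?M ?N)" by (rule nondeg_change[OF nd']) (use False in simp)
        show "lc 0 (1 / d) 0 ?M ?N *v (lc 0 0 1 ?M ?N *v v)
            = lc 0 0 1 ?M ?N *v (lc 0 (1 / d) 0 ?M ?N *v v) + lc 0 0 1 ?M ?N *v v" for v
          unfolding lc_mult[of 0 "1 / d" 0] lc_mult[of 0 0 1] mv_linear
          using comm[of v] b0 False by (simp add: vector_add_ldistrib)
      qed
      then show ?thesis by (rule has_listed_form_change) (use False in simp)
    qed
  next
    case False
    have "has_listed_form (lc 0 0 (- 1 / b) ?M ?N) (lc 0 b d ?M ?N)"
    proof (rule affine_classification)
      show "nondeg (lc 0 0 (- 1 / b) ?M ?N) (lc 0 b d ?M ?N)" by (rule nondeg_change[OF nd']) (use False in simp)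
      show "lc 0 0 (- 1 / b) ?M ?N *v (lc 0 b d ?M ?N *v v)
          = lc 0 b d ?M ?N *v (lc 0 0 (- 1 / b) ?M ?N *v v) + lc 0 b d ?M ?N *v v" for v
        unfolding lc_mult[of 0 0 "- 1 / b"] lc_mult[of 0 b d] mv_linear
        using False by (simp add: comm vec_eq_iff algebra_simps)
    qed
    then show ?thesis by (rule has_listed_form_change) (use False in simp)
  qed
  then show ?thesis by (rule has_listed_form_change) simp
qed

text \<open>Where \<open>\<omega> \<noteq> 0\<close>, the vectors \<open>z\<close>, \<open>M z\<close>, \<open>N z\<close> are independent, and by \<open>annihilator_unique\<close> the form \<open>\<Theta>\<close>, transported by \<open>g\<close>,
  is a multiple of \<open>\<omega>\<close> there.\<close>

lemma listed_form_tangential: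
  assumes g: "invertible g" and \<Theta>: "listed_form \<Theta>" and k: "kills g \<Theta> M" "kills g \<Theta> N"
    and c: "c \<noteq> 0" and A: "\<And>z. cross4 z (M *v z) (N *v z) = c *s A z"
  shows "tangential \<Theta> (pullback_form g A)"
  unfolding tangential_def
proof (intro allI impI)
  fix z v assume nz: "pullback_form g A z \<noteq> 0" and v: "dot (pullback_form g A z) v = 0"
  obtain h where h: "\<forall>x. g *v (h *v x) = x" "\<forall>x. h *v (g *v x) = x"
    using invertible_inverse[OF g] by (elim exE conjE)
  define t where "t = transpose h *v \<Theta> z"
  have t: "dot t x = dot (\<Theta> z) (h *v x)" for x unfolding t_def dot_transpose ..
  have Av: "dot (A (g *v z)) (g *v v) = 0" using v unfolding pullback_form_def dot_transpose .
  have Anz: "A (g *v z) \<noteq> 0"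
  proof
    assume "A (g *v z) = 0"
    then have "pullback_form g A z = 0" by (simp add: pullback_form_def)
    then show False using nz by blast
  qed
  have "dot t (g *v z) = 0" unfolding t using h listed_form_euler[OF \<Theta>] by simp
  moreover have "dot t (M *v (g *v z)) = 0" "dot t (N *v (g *v z)) = 0"
    unfolding t using k h(1) unfolding kills_def by simp_all
  ultimately have an: "t $ i * (c * A (g *v z) $ j) = t $ j * (c * A (g *v z) $ i)" for i j
    using annihilator_unique[of t "g *v z" "M *v (g *v z)" "N *v (g *v z)" i j] unfolding A by simp
  obtain j where j: "A (g *v z) $ j \<noteq> 0" using Anz by (auto simp: vec_eq_iff)
  have "A (g *v z) $ j *s t = t $ j *s A (g *v z)"
    using an[of _ j] c by (simp add: vec_eq_iff mult.commute mult.left_commute)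
  then have "dot (A (g *v z) $ j *s t) (g *v v) = dot (t $ j *s A (g *v z)) (g *v v)" by (rule arg_cong)
  then have "A (g *v z) $ j * dot t (g *v v) = 0" unfolding smult_dot Av by simp
  then have "dot t (g *v v) = 0" using j by simp
  then show "dot (\<Theta> z) v = 0" unfolding t using h(2) by simp
qed

theorem mainTheorem14:
  fixes A :: "complex^4 \<Rightarrow> complex^4"
  assumes "codim_one_foliation 2 A"
    and "L_foliation A"
  shows "\<exists>g :: complex^4^4. invertible g \<and>
    ((\<exists>a0 a1 a2 a3. a0 + a1 + a2 + a3 = 0 \<and>
        first_integral (pullback_form g A)
          (mf_power (\<lambda>z. z$0) a0 \<odot> mf_power (\<lambda>z. z$1) a1 \<odot>
           mf_power (\<lambda>z. z$2) a2 \<odot> mf_power (\<lambda>z. z$3) a3))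
   \<or> first_integral (pullback_form g A)
       (mf_single (\<lambda>z. z$1 * z$2 + z$0 * z$3) \<oslash> mf_single (\<lambda>z. z$1 * z$3))
   \<or> first_integral (pullback_form g A)
       (mf_single (\<lambda>z. z$1) \<oslash> mf_single (\<lambda>z. z$3) \<odot>
        mf_exp (mf_single (\<lambda>z. z$0 * z$3 + z$2 * z$1) \<oslash> mf_single (\<lambda>z. z$1 * z$3)))
   \<or> first_integral (pullback_form g A)
       (mf_single (\<lambda>z. z$0) \<oslash> mf_single (\<lambda>z. z$3) \<odot>
        mf_exp (mf_single (\<lambda>z. (z$2)^2 - z$1 * z$3) \<oslash> mf_single (\<lambda>z. (z$3)^2)))
   \<or> (\<exists>\<kappa>. first_integral (pullback_form g A)
       ((mf_single (\<lambda>z. z$1) \<odot> mf_power (\<lambda>z. z$3) (\<kappa> - 1)) \<oslash> mf_power (\<lambda>z. z$0) \<kappa> \<odot>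
        mf_exp (mf_single (\<lambda>z. z$2) \<oslash> mf_single (\<lambda>z. z$3))))
   \<or> first_integral (pullback_form g A)
       (mf_single (\<lambda>z. z$0 * (z$3)^2 + z$1 * z$2 * z$3 + (z$2)^3) \<oslash> mf_single (\<lambda>z. (z$3)^3))
   \<or> first_integral (pullback_form g A)
       (mf_single (\<lambda>z. (z$0 * (z$3)^2 - z$1 * z$2 * z$3 + (z$2)^3 / 3)^2) \<oslash>
        mf_single (\<lambda>z. (z$1 * z$3 - (z$2)^2 / 2)^3))
   \<or> (\<exists>\<kappa>. first_integral (pullback_form g A)
       ((mf_single (\<lambda>z. (z$0)^2) \<odot> mf_power (\<lambda>z. z$3) (2 * (\<kappa> - 1))) \<oslash>
        mf_power (\<lambda>z. z$1 * z$3 - (z$2)^2) \<kappa>))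
   \<or> first_integral (pullback_form g A)
       (mf_single (\<lambda>z. (z$3)^2) \<oslash> mf_single (\<lambda>z. z$1 * z$3 - (z$2)^2) \<odot>
        mf_exp (mf_single (\<lambda>z. z$0) \<oslash> mf_single (\<lambda>z. z$3)))
   \<or> first_integral (pullback_form g A)
       (mf_single (\<lambda>z. z$0) \<oslash> mf_single (\<lambda>z. z$3) \<odot>
        mf_exp (mf_single (\<lambda>z. (z$2)^2 - z$1 * z$3) \<oslash> mf_single (\<lambda>z. z$0 * z$3)))
   \<or> first_integral (pullback_form g A)
       (mf_single (\<lambda>z. z$2) \<oslash> mf_single (\<lambda>z. z$3) \<odot>
        mf_exp (mf_single (\<lambda>z. z$0 * z$3 - z$1 * z$2) \<oslash> mf_single (\<lambda>z. (z$3)^2)))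
   \<or> (\<exists>\<kappa>. first_integral (pullback_form g A)
       (mf_power (\<lambda>z. z$0 * z$3 - z$1 * z$2) \<kappa> \<oslash>
        (mf_power (\<lambda>z. z$2) (\<kappa> + 1) \<odot> mf_power (\<lambda>z. z$3) (\<kappa> - 1))))
   \<or> first_integral (pullback_form g A)
       (mf_single (\<lambda>z. z$0 * z$3 - z$1 * z$2) \<oslash> mf_single (\<lambda>z. (z$3)^2) \<odot>
        mf_exp (mf_single (\<lambda>z. - z$2) \<oslash> mf_single (\<lambda>z. z$3))))"
proof -
  obtain M N c where MN: "c \<noteq> 0 \<and> (\<forall>z. cross4 z (M *v z) (N *v z) = c *s A z) \<and> sat_lin M N \<and>
      (\<exists>a b d. M ** N - N ** M = mat a + (\<chi> i. b *s M $ i) + (\<chi> i. d *s N $ i))"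
    using L_foliation_linear_pair[OF assms] by (elim exE)
  then have c: "c \<noteq> 0" and cross: "\<forall>z. cross4 z (M *v z) (N *v z) = c *s A z" and sat: "sat_lin M N"
    and br: "\<exists>a b d. M ** N - N ** M = mat a + (\<chi> i. b *s M $ i) + (\<chi> i. d *s N $ i)"
    by simp_all
  have "has_listed_form M N"
    using br by (elim exE) (rule linear_pair_classification[OF sat_lin_nondeg[OF sat]])
  then obtain g \<Theta> where g: "invertible g" and \<Theta>: "listed_form \<Theta>" and k: "kills g \<Theta> M" "kills g \<Theta> N"
    unfolding has_listed_form_def by (elim exE conjE)
  have t: "tangential \<Theta> (pullback_form g A)"
    by (rule listed_form_tangential[OF g \<Theta> k c]) (rule cross[rule_format])
  show ?thesis
  proof (rule disjE[OF \<Theta>[unfolded listed_form_def]])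
    assume "\<exists>a0 a1 a2 a3. \<Theta> = form1 a0 a1 a2 a3 \<and> a0 + a1 + a2 + a3 = 0 \<and> (a0 \<noteq> 0 \<or> a1 \<noteq> 0 \<or> a2 \<noteq> 0 \<or> a3 \<noteq> 0)"
    then obtain a0 a1 a2 a3 where a: "\<Theta> = form1 a0 a1 a2 a3" "a0 + a1 + a2 + a3 = 0"
      "a0 \<noteq> 0 \<or> a1 \<noteq> 0 \<or> a2 \<noteq> 0 \<or> a3 \<noteq> 0" by (elim exE conjE)
    show ?thesis
      by (intro exI[of _ g] conjI g, rule disjI1, intro exI conjI, rule a(2))
         (rule first_integral_form1[OF t[unfolded a(1)] a(3)])
  next
    assume "\<exists>\<kappa>. \<Theta> \<in> {form2, form3, form4, form5 \<kappa>, form6, form7, form8 \<kappa>, form9, form10, form11, form12 \<kappa>, form13}"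
    then obtain \<kappa> where "\<Theta> \<in> {form2, form3, form4, form5 \<kappa>, form6, form7, form8 \<kappa>, form9, form10, form11, form12 \<kappa>, form13}"
      by (elim exE)
    then show ?thesis
    proof (elim insertE emptyE, goal_cases)
      case 1
      show ?case
        by (intro exI[of _ g] conjI g, rule disjI2, rule disjI1)
           (rule first_integral_form2[OF t[unfolded 1]])
    next
      case 2
      show ?case
        by (intro exI[of _ g] conjI g, rule disjI2, rule disjI2, rule disjI1)
           (rule first_integral_form3[OF t[unfolded 2]])
    next
      case 3
      show ?case
        by (intro exI[of _ g] conjI g, rule disjI2, rule disjI2, rule disjI2, rule disjI1)
           (rule first_integral_form4[OF t[unfolded 3]])
    next
      case 4
      show ?case
        by (intro exI[of _ g] conjI g, rule disjI2, rule disjI2, rule disjI2, rule disjI2, rule disjI1, rule exI)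
           (rule first_integral_form5[OF t[unfolded 4]])
    next
      case 5
      show ?case
        by (intro exI[of _ g] conjI g, rule disjI2, rule disjI2, rule disjI2, rule disjI2, rule disjI2, rule disjI1)
           (rule first_integral_form6[OF t[unfolded 5]])
    next
      case 6
      show ?case
        by (intro exI[of _ g] conjI g, rule disjI2, rule disjI2, rule disjI2, rule disjI2, rule disjI2, rule disjI2, rule disjI1)
           (rule first_integral_form7[OF t[unfolded 6]])
    next
      case 7
      show ?case
        by (intro exI[of _ g] conjI g, rule disjI2, rule disjI2, rule disjI2, rule disjI2, rule disjI2, rule disjI2, rule disjI2, rule disjI1, rule exI)
           (rule first_integral_form8[OF t[unfolded 7]])
    next
      case 8
      show ?case
        by (intro exI[of _ g] conjI g, rule disjI2, rule disjI2, rule disjI2, rule disjI2, rule disjI2, rule disjI2, rule disjI2, rule disjI2, rule disjI1)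
           (rule first_integral_form9[OF t[unfolded 8]])
    next
      case 9
      show ?case
        by (intro exI[of _ g] conjI g, rule disjI2, rule disjI2, rule disjI2, rule disjI2, rule disjI2, rule disjI2, rule disjI2, rule disjI2, rule disjI2, rule disjI1)
           (rule first_integral_form10[OF t[unfolded 9]])
    next
      case 10
      show ?case
        by (intro exI[of _ g] conjI g, rule disjI2, rule disjI2, rule disjI2, rule disjI2, rule disjI2, rule disjI2, rule disjI2, rule disjI2, rule disjI2, rule disjI2, rule disjI1)
           (rule first_integral_form11[OF t[unfolded 10]])
    next
      case 11
      show ?case
        by (intro exI[of _ g] conjI g, rule disjI2, rule disjI2, rule disjI2, rule disjI2, rule disjI2, rule disjI2, rule disjI2, rule disjI2, rule disjI2, rule disjI2, rule disjI2, rule disjI1, rule exI)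
           (rule first_integral_form12[OF t[unfolded 11]])
    next
      case 12
      show ?case
        by (intro exI[of _ g] conjI g, rule disjI2, rule disjI2, rule disjI2, rule disjI2, rule disjI2, rule disjI2, rule disjI2, rule disjI2, rule disjI2, rule disjI2, rule disjI2, rule disjI2)
           (rule first_integral_form13[OF t[unfolded 12]])
    qed
  qed
qed

end
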